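(* If $G = T \cup C$ is a $3$-regular Halin graph, then $4 \leq \chi_{\mathrm{star}}'(G) \leq 6$. Furthermore, the upper bound is tight, i.e., there exists a $3$-regular Halin graph $G$ with $\chi_{\mathrm{star}}'(G) = 6$.
   Context: All graphs are simple, finite and undirected. A Halin graph is a plane graph that consists of a plane embedding of a tree $T$ and a cycle $C$, where the cycle $C$ connects the leaves of $T$ (the vertices of $C$ are exactly the leaves of $T$) in such a way that $C$ is the boundary of the exterior face, and every interior (non-leaf) vertex of $T$ has degree at least three. One writes $G = T \cup C$; $T$ is the characteristic tree and $C$ the adjoint cycle of $G$. A star $k$-edge-coloring of a graph $G$ is a proper edge-coloring of $G$ with $k$ colors such that no path of length four and no cycle of length four in $G$ (length = number of edges) is bicolored, i.e., at least three colors appear on every path or cycle of length four. The star chromatic index $\chi_{\mathrm{star}}'(G)$ is the smallest $k$ such that $G$ has a star $k$-edge-coloring. *)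

theory Defs
  imports "HOL-Analysis.Analysis"
begin

section \<open>Finite simple graphs\<close>

text \<open>A graph is given by a vertex set and a set of edges, each edge being the set of its two ends.\<close>

definition simple_graph :: "'a set \<Rightarrow> 'a set set \<Rightarrow> bool" where
  "simple_graph V E \<longleftrightarrow> finite V \<and> (\<forall>e\<in>E. e \<subseteq> V \<and> card e = 2)"

definition vdegree :: "'a set set \<Rightarrow> 'a \<Rightarrow> nat" where
  "vdegree E v = card {e \<in> E. v \<in> e}"

definition regular_graph :: "nat \<Rightarrow> 'a set \<Rightarrow> 'a set set \<Rightarrow> bool" where
  "regular_graph d V E \<longleftrightarrow> (\<forall>v\<in>V. vdegree E v = d)"

definition path_edges :: "'a list \<Rightarrow> 'a set set" where
  "path_edges vs = {{vs ! i, vs ! Suc i} | i. Suc i < length vs}"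

definition cycle_edges :: "'a list \<Rightarrow> 'a set set" where
  "cycle_edges vs = path_edges (vs @ [hd vs])"

text \<open>Paths and cycles are given by their lists of distinct vertices; a path has
  \<open>length vs - 1\<close> edges, whereas a cycle, whose first vertex is not repeated at the end of
  the list, has \<open>length vs\<close> edges.\<close>

definition graph_path :: "'a set set \<Rightarrow> 'a list \<Rightarrow> bool" where
  "graph_path E vs \<longleftrightarrow> vs \<noteq> [] \<and> distinct vs \<and> path_edges vs \<subseteq> E"

definition graph_cycle :: "'a set set \<Rightarrow> 'a list \<Rightarrow> bool" where
  "graph_cycle E vs \<longleftrightarrow> 3 \<le> length vs \<and> distinct vs \<and> cycle_edges vs \<subseteq> E"

definition graph_connected :: "'a set \<Rightarrow> 'a set set \<Rightarrow> bool" where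
  "graph_connected V E \<longleftrightarrow>
     V \<noteq> {} \<and> (\<forall>u\<in>V. \<forall>v\<in>V. \<exists>vs. graph_path E vs \<and> hd vs = u \<and> last vs = v)"

definition tree_graph :: "'a set \<Rightarrow> 'a set set \<Rightarrow> bool" where
  "tree_graph V E \<longleftrightarrow> simple_graph V E \<and> graph_connected V E \<and> \<not> (\<exists>vs. graph_cycle E vs)"

definition leaves :: "'a set \<Rightarrow> 'a set set \<Rightarrow> 'a set" where
  "leaves V E = {v \<in> V. vdegree E v = 1}"

section \<open>Star edge-colorings\<close>

definition proper_edge_coloring :: "'a set set \<Rightarrow> ('a set \<Rightarrow> nat) \<Rightarrow> bool" where
  "proper_edge_coloring E f \<longleftrightarrow>
     (\<forall>e\<in>E. \<forall>e'\<in>E. e \<noteq> e' \<and> e \<inter> e' \<noteq> {} \<longrightarrow> f e \<noteq> f e')"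

definition star_edge_coloring :: "'a set set \<Rightarrow> nat \<Rightarrow> ('a set \<Rightarrow> nat) \<Rightarrow> bool" where
  "star_edge_coloring E k f \<longleftrightarrow>
     f ` E \<subseteq> {..<k} \<and>
     proper_edge_coloring E f \<and>
     (\<forall>vs. graph_path E vs \<and> length vs = 5 \<longrightarrow> 3 \<le> card (f ` path_edges vs)) \<and>
     (\<forall>vs. graph_cycle E vs \<and> length vs = 4 \<longrightarrow> 3 \<le> card (f ` cycle_edges vs))"

text \<open>For finite \<open>E\<close> the minimum is attained, since an injective coloring is a star edge-coloring.\<close>

definition star_chromatic_index :: "'a set set \<Rightarrow> nat" where
  "star_chromatic_index E = (LEAST k. \<exists>f. star_edge_coloring E k f)"

section \<open>Plane graphs and Halin graphs\<close>

text \<open>The plane is \<^typ>\<open>complex\<close>, on which the library develops planar topology. The vertices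
  of a plane graph are points of the plane, and \<open>\<gamma> e\<close> is the arc that represents the edge \<open>e\<close>.
  The relative interior of an arc contains neither a vertex nor a point of another arc.\<close>

definition plane_graph ::
  "complex set \<Rightarrow> complex set set \<Rightarrow> (complex set \<Rightarrow> real \<Rightarrow> complex) \<Rightarrow> bool" where
  "plane_graph V E \<gamma> \<longleftrightarrow>
     simple_graph V E \<and>
     (\<forall>e\<in>E. arc (\<gamma> e) \<and> {pathstart (\<gamma> e), pathfinish (\<gamma> e)} = e \<and>
        (path_image (\<gamma> e) - e) \<inter> V = {} \<and>
        (\<forall>e'\<in>E. e' \<noteq> e \<longrightarrow> (path_image (\<gamma> e) - e) \<inter> path_image (\<gamma> e') = {}))"

definition drawing ::
  "complex set \<Rightarrow> complex set set \<Rightarrow> (complex set \<Rightarrow> real \<Rightarrow> complex) \<Rightarrow> complex set" where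
  "drawing V E \<gamma> = V \<union> (\<Union>e\<in>E. path_image (\<gamma> e))"

text \<open>The complement of a compact subset of the plane has exactly one unbounded component, so
  \<^const>\<open>outside\<close> of the drawing, defined as the union of all unbounded components, is a single
  face.\<close>

definition exterior_face ::
  "complex set \<Rightarrow> complex set set \<Rightarrow> (complex set \<Rightarrow> real \<Rightarrow> complex) \<Rightarrow> complex set" where
  "exterior_face V E \<gamma> = outside (drawing V E \<gamma>)"

text \<open>\<open>T\<close> and \<open>C\<close> are the edge sets of the characteristic tree and of the adjoint cycle; the
  tree spans \<open>V\<close>, and the vertex set of the cycle is the set of leaves of the tree.\<close>

definition halin_graph ::
  "complex set \<Rightarrow> complex set set \<Rightarrow> complex set set \<Rightarrow> (complex set \<Rightarrow> real \<Rightarrow> complex) \<Rightarrow> bool" where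
  "halin_graph V T C \<gamma> \<longleftrightarrow>
     plane_graph V (T \<union> C) \<gamma> \<and>
     tree_graph V T \<and>
     (\<forall>v \<in> V - leaves V T. 3 \<le> vdegree T v) \<and>
     (\<exists>cs. graph_cycle C cs \<and> cycle_edges cs = C \<and> set cs = leaves V T) \<and>
     frontier (exterior_face V (T \<union> C) \<gamma>) = drawing (leaves V T) C \<gamma>"

end

theory Submission
  imports Defs
begin

text \<open>
  Write \<open>S(v)\<close> for the set of colors on the edges at \<open>v\<close>, the palette of \<open>v\<close>. A proper edge-coloring
  \<open>f\<close> is a star edge-coloring iff there is no vertex \<open>v\<close> with two neighbors \<open>x\<close>, \<open>y\<close> such that
  \<open>f(vy) \<in> S(x)\<close> and \<open>f(vx) \<in> S(y)\<close>: such a \<open>v\<close> is the middle of a bicolored path or cycle of length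
  four (\<open>star_edge_coloring_iff_star_at\<close>). With three colors every palette of a cubic graph is full,
  which gives the lower bound.

  For the upper bound, root the tree at a leaf. Planarity makes the leaves below any tree edge
  consecutive on the adjoint cycle: otherwise two disjoint tree paths would join two pairs of leaves
  that separate each other on the cycle, although both paths run inside it (\<open>crossing_arcs\<close>,
  \<open>halin_noncrossing\<close>). So the set of vertices below a tree edge is left by exactly three edges, one
  tree edge and two edges of the cycle, and it is either a leaf or built from two smaller sets of this
  kind that share a cycle edge, together with a new vertex (\<open>part\<close>, \<open>side_part\<close>).

  Such a piece is colored from the leaves upwards. The colorings used have the property that the color of
  an edge leaving the piece does not occur at the further neighbors of its inner end (\<open>sound\<close>). Then
  everything that a neighboring piece has to know is the color of each of the three leaving
  edges and the two other colors at its inner end. Up to a permutation of the six colors two kinds of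
  pieces suffice: for a \<open>balanced\<close> piece one particular pattern of this data can be realized, for a
  \<open>skew\<close> piece one of two further patterns can be realized as required. Every piece other than a leaf
  is balanced, or skew, or the mirror image of a skew piece (\<open>part_flexible\<close>), because these three
  classes are closed under joining two pieces and under joining a leaf and a piece. Each class contains a
  pattern to which the root leaf can be attached (\<open>star_6_edge_coloring_of_part\<close>).

  The bound 6 is attained by the triangular prism: its characteristic tree has two inner vertices
  and four leaves. A star 5-edge-coloring of the prism is excluded by comparing the colors of the three
  edges between its triangles (\<open>no_prism_colors\<close>), and a drawing with straight edges and a
  rectangle as the outer cycle shows that it is a Halin graph.
\<close>

section \<open>Star colorings seen from a vertex\<close>

definition inc :: "'a set set \<Rightarrow> 'a \<Rightarrow> 'a set set" where
  "inc E v = {e \<in> E. v \<in> e}"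

definition touching :: "'a set set \<Rightarrow> 'a set \<Rightarrow> 'a set set" where
  "touching E X = {e \<in> E. e \<inter> X \<noteq> {}}"

definition palette :: "'a set set \<Rightarrow> ('a set \<Rightarrow> nat) \<Rightarrow> 'a \<Rightarrow> nat set" where
  "palette E f v = f ` inc E v"

text \<open>This is the condition that \<open>v\<close> is not the middle vertex of a path or cycle of length four whose
  edges alternate between two colors.\<close>

definition star_at :: "'a set set \<Rightarrow> ('a set \<Rightarrow> nat) \<Rightarrow> 'a \<Rightarrow> bool" where
  "star_at E f v \<longleftrightarrow> (\<forall>x y. {v, x} \<in> E \<longrightarrow> {v, y} \<in> E \<longrightarrow> x \<noteq> y \<longrightarrow>
     \<not> (f {v, y} \<in> palette E f x \<and> f {v, x} \<in> palette E f y))"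

lemma path_edges_simps [simp]:
  "path_edges [] = {}" "path_edges [x] = {}"
  "path_edges (x # y # zs) = insert {x, y} (path_edges (y # zs))"
proof -
  show "path_edges (x # y # zs) = insert {x, y} (path_edges (y # zs))"
  proof (intro set_eqI iffI)
    fix e assume "e \<in> path_edges (x # y # zs)"
    then obtain i where i: "Suc i < length (x # y # zs)"
      "e = {(x # y # zs) ! i, (x # y # zs) ! Suc i}"
      unfolding path_edges_def by blast
    show "e \<in> insert {x, y} (path_edges (y # zs))"
    proof (cases i)
      case 0 then show ?thesis using i by simp
    next
      case (Suc j)
      then have "e \<in> path_edges (y # zs)" unfolding path_edges_def using i by auto
      then show ?thesis by simp
    qed
  next
    fix e assume "e \<in> insert {x, y} (path_edges (y # zs))"
    then consider "e = {x, y}" | i where "Suc i < length (y # zs)" "e = {(y # zs) ! i, (y # zs) ! Suc i}"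
      unfolding path_edges_def by blast
    then show "e \<in> path_edges (x # y # zs)"
    proof cases
      case 1 then show ?thesis unfolding path_edges_def by (auto intro!: exI[of _ 0])
    next
      case 2 then show ?thesis unfolding path_edges_def
        by (intro CollectI exI[of _ "Suc i"]) auto
    qed
  qed
qed (auto simp: path_edges_def)

lemma card_ge_3_not_subset_pair: "card (S::nat set) \<ge> 3 \<Longrightarrow> \<not> S \<subseteq> {a, b}"
  using card_mono[of "{a,b}" S] card_insert_le_m1[of 2 "{b}" a] by (auto simp: card_insert_if split: if_splits)

text \<open>Let \<open>x\<close>, \<open>y\<close> be two neighbors of \<open>v\<close> that violate the condition at \<open>v\<close>, and follow the edge of color
  \<open>f {v, y}\<close> from \<open>x\<close> to \<open>x'\<close> and the edge of color \<open>f {v, x}\<close> from \<open>y\<close> to \<open>y'\<close>. Properness keeps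
  \<open>x'\<close> and \<open>y'\<close> away from the other three vertices, so the result is a bicolored path if \<open>x' \<noteq> y'\<close> and a
  bicolored 4-cycle otherwise. Conversely, the middle vertex of a bicolored path or cycle violates the condition.\<close>

lemma star_edge_coloring_iff_star_at:
  assumes E: "\<And>e. e \<in> E \<Longrightarrow> card e = 2"
  shows "star_edge_coloring E k f \<longleftrightarrow>
    f ` E \<subseteq> {..<k} \<and> (\<forall>v. inj_on f (inc E v)) \<and> (\<forall>v. star_at E f v)"
proof -
  have loop: "{x} \<notin> E" for x using E[of "{x}"] by auto
  have proper: "proper_edge_coloring E f \<longleftrightarrow> (\<forall>v. inj_on f (inc E v))"
    unfolding proper_edge_coloring_def inj_on_def inc_def by blast
  have pathcol: "3 \<le> card (f ` insert {a,b} (insert {b,c} (insert {c,d} {{d,e}})))"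
    if P: "\<forall>v. inj_on f (inc E v)" and S: "star_at E f c"
      and ed: "{a,b} \<in> E" "{b,c} \<in> E" "{c,d} \<in> E" "{d,e} \<in> E" and ne: "a \<noteq> c" "b \<noteq> d" "c \<noteq> e"
    for a b c d e
  proof -
    have inj: "f {u,x} \<noteq> f {u,y}" if "{u,x} \<in> E" "{u,y} \<in> E" "x \<noteq> y" for u x y
      using inj_onD[OF P[rule_format, of u], of "{u,x}" "{u,y}"] that
      by (auto simp: inc_def doubleton_eq_iff)
    have 1: "f {a,b} \<noteq> f {b,c}" and 2: "f {b,c} \<noteq> f {c,d}" and 3: "f {c,d} \<noteq> f {d,e}"
      using inj[of b a c] inj[of c b d] inj[of d c e] ed ne by (simp_all add: insert_commute)
    have 4: "\<not> (f {a,b} = f {c,d} \<and> f {b,c} = f {d,e})"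
    proof
      assume *: "f {a,b} = f {c,d} \<and> f {b,c} = f {d,e}"
      have "f {c,d} \<in> palette E f b" unfolding palette_def inc_def
        using * ed by (intro image_eqI[of _ _ "{a,b}"]) auto
      moreover have "f {c,b} \<in> palette E f d" unfolding palette_def inc_def
        using * ed by (intro image_eqI[of _ _ "{d,e}"]) (auto simp: insert_commute)
      ultimately show False
        using S[unfolded star_at_def, rule_format, of b d] ed ne by (simp add: insert_commute)
    qed
    have fin: "finite (f ` insert {a,b} (insert {b,c} (insert {c,d} {{d,e}})))" by simp
    show ?thesis
    proof (cases "f {a,b} = f {c,d}")
      case True
      then have "card {f {a,b}, f {b,c}, f{d,e}} = 3" using 1 2 3 4 by auto
      then show ?thesis using card_mono[OF fin, of "{f {a,b}, f {b,c}, f{d,e}}"] by auto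
    next
      case False
      then have "card {f {a,b}, f {b,c}, f{c,d}} = 3" using 1 2 3 4 by auto
      then show ?thesis using card_mono[OF fin, of "{f {a,b}, f {b,c}, f{c,d}}"] by auto
    qed
  qed
  show ?thesis
  proof
    assume *: "star_edge_coloring E k f"
    then have P: "\<forall>v. inj_on f (inc E v)" using proper unfolding star_edge_coloring_def by blast
    have "star_at E f v" for v
      unfolding star_at_def
    proof (intro allI impI notI)
      fix x y assume ed: "{v,x} \<in> E" "{v,y} \<in> E" and xy: "x \<noteq> y"
        and both: "f {v,y} \<in> palette E f x \<and> f {v,x} \<in> palette E f y"
      obtain e where e: "e \<in> E" "x \<in> e" "f e = f {v,y}"
        using both unfolding palette_def inc_def by auto
      obtain e' where e': "e' \<in> E" "y \<in> e'" "f e' = f {v,x}"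
        using both unfolding palette_def inc_def by auto
      obtain x' where x': "e = {x, x'}" using e E[OF e(1)] by (auto simp: card_2_iff)
      obtain y' where y': "e' = {y, y'}" using e' E[OF e'(1)] by (auto simp: card_2_iff)
      have vx: "v \<noteq> x" and vy: "v \<noteq> y" using ed loop by auto
      have inj: "\<And>u e1 e2. e1 \<in> E \<Longrightarrow> e2 \<in> E \<Longrightarrow> u \<in> e1 \<Longrightarrow> u \<in> e2 \<Longrightarrow> f e1 = f e2 \<Longrightarrow> e1 = e2"
        using P unfolding inj_on_def inc_def by blast
      have ne12: "{v,x} \<noteq> {v,y}" using xy by (simp add: doubleton_eq_iff)
      have "e \<noteq> {v,x}" using inj[of "{v,x}" "{v,y}" v] ed e ne12 by auto
      then have x'v: "x' \<noteq> v" using x' by auto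
      have "e' \<noteq> {v,y}" using inj[of "{v,x}" "{v,y}" v] ed e' ne12 by auto
      then have y'v: "y' \<noteq> v" using y' by auto
      have x'x: "x' \<noteq> x" using e x' loop by auto
      have y'y: "y' \<noteq> y" using e' y' loop by auto
      have x'y: "x' \<noteq> y"
      proof
        assume "x' = y"
        then have "e = {v,y}" using inj[of e "{v,y}" y] e ed x' by auto
        then show False using x' vx xy by (auto simp: doubleton_eq_iff)
      qed
      have y'x: "y' \<noteq> x"
      proof
        assume "y' = x"
        then have "e' = {v,x}" using inj[of e' "{v,x}" x] e' ed y' by auto
        then show False using y' vy xy by (auto simp: doubleton_eq_iff)
      qed
      have com: "{x',x} \<in> E" "{x,v} \<in> E" "{y,y'} \<in> E"
         "f {x',x} = f {v,y}" "f {x,v} = f {v,x}" "f {y,y'} = f {v,x}"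
        using e e' x' y' ed by (simp_all add: insert_commute)
      show False
      proof (cases "x' = y'")
        case True
        have "graph_cycle E [x',x,v,y]" unfolding graph_cycle_def cycle_edges_def
          using com ed True x'x x'v x'y vx vy xy by (auto simp: insert_commute)
        then have "3 \<le> card (f ` cycle_edges [x',x,v,y])"
          using *[unfolded star_edge_coloring_def, THEN conjunct2, THEN conjunct2, THEN conjunct2, rule_format, of "[x',x,v,y]"]
          by simp
        moreover have "f ` cycle_edges [x',x,v,y] \<subseteq> {f {v,x}, f{v,y}}"
          unfolding cycle_edges_def using com True by (auto simp: insert_commute)
        ultimately show False using card_ge_3_not_subset_pair by blast
      next
        case False
        have "graph_path E [x',x,v,y,y']" unfolding graph_path_def
          using com ed False x'x x'v x'y y'x y'y y'v vx vy xy by auto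
        then have "3 \<le> card (f ` path_edges [x',x,v,y,y'])"
          using *[unfolded star_edge_coloring_def, THEN conjunct2, THEN conjunct2, THEN conjunct1, rule_format, of "[x',x,v,y,y']"]
           by simp
        moreover have "f ` path_edges [x',x,v,y,y'] \<subseteq> {f {v,x}, f{v,y}}"
          using com by auto
        ultimately show False using card_ge_3_not_subset_pair by blast
      qed
    qed
    then show "f ` E \<subseteq> {..<k} \<and> (\<forall>v. inj_on f (inc E v)) \<and> (\<forall>v. star_at E f v)"
      using * P unfolding star_edge_coloring_def by blast
  next
    assume *: "f ` E \<subseteq> {..<k} \<and> (\<forall>v. inj_on f (inc E v)) \<and> (\<forall>v. star_at E f v)"
    show "star_edge_coloring E k f"
      unfolding star_edge_coloring_def
    proof (intro conjI allI impI)
      fix vs assume vs: "graph_path E vs \<and> length vs = 5"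
      then obtain a b c d e where vs': "vs = [a,b,c,d,e]"
        by (auto simp: eval_nat_numeral length_Suc_conv)
      show "3 \<le> card (f ` path_edges vs)"
        using pathcol[of c a b d e] * vs unfolding vs' graph_path_def by simp
    next
      fix vs assume vs: "graph_cycle E vs \<and> length vs = 4"
      then obtain a b c d where vs': "vs = [a,b,c,d]"
        by (auto simp: eval_nat_numeral length_Suc_conv)
      show "3 \<le> card (f ` cycle_edges vs)"
        using pathcol[of c a b d a] * vs unfolding vs' graph_cycle_def cycle_edges_def by force
    qed (use * proper in auto)
  qed
qed

text \<open>With three colors all three appear at every vertex, so any two neighbors of a vertex violate the
  star condition there.\<close>

lemma no_star_3_edge_coloring:
  assumes E: "\<And>e. e \<in> E \<Longrightarrow> card e = 2" "\<And>e. e \<in> E \<Longrightarrow> e \<subseteq> V"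
    and cubic: "regular_graph 3 V E" and "V \<noteq> {}" and col: "star_edge_coloring E k f"
  shows "4 \<le> k"
proof (rule ccontr)
  assume k: "\<not> 4 \<le> k"
  have c: "f ` E \<subseteq> {..<k}" "\<And>v. inj_on f (inc E v)" "\<And>v. star_at E f v"
    using iffD1[OF star_edge_coloring_iff_star_at[OF E(1)] col] by blast+
  have full: "palette E f v = {..<3}" if "v \<in> V" for v
  proof (rule card_subset_eq)
    show "palette E f v \<subseteq> {..<3}" using c(1) k unfolding palette_def inc_def by fastforce
    have "card (inc E v) = 3" using cubic that unfolding regular_graph_def vdegree_def inc_def by auto
    then show "card (palette E f v) = card {..<3::nat}"
      unfolding palette_def using card_image[OF c(2), of v] by simp
  qed simp
  obtain v where v: "v \<in> V" using \<open>V \<noteq> {}\<close> by auto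
  have "card (inc E v) = 3" using cubic v unfolding regular_graph_def vdegree_def inc_def by auto
  then obtain e e' where ee: "e \<in> inc E v" "e' \<in> inc E v" "e \<noteq> e'"
    by (auto simp: card_3_iff)
  have other: "\<exists>x. e = {v,x}" if "e \<in> inc E v" for e
    using that E(1)[of e] unfolding inc_def by (auto simp: card_2_iff)
  obtain x y where xy: "e = {v,x}" "e' = {v,y}" "x \<noteq> y"
    using other[of e] other[of e'] ee by blast
  have "x \<in> V" "y \<in> V" using ee E(2) xy unfolding inc_def by auto
  moreover have "f e \<in> palette E f v" "f e' \<in> palette E f v" using ee unfolding palette_def by auto
  ultimately show False
    using c(3)[of v] ee xy full v unfolding star_at_def inc_def by auto
qed

section \<open>Pieces of a Halin graph\<close>

text \<open>If at most one edge at each vertex leaves \<open>X\<close>, then every pair of edges at a vertex of \<open>X\<close> has one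
  edge inside \<open>X\<close>. A single leaf fails this, as all three of its edges leave.\<close>

definition separated :: "'a set set \<Rightarrow> 'a set \<Rightarrow> bool" where
  "separated E X \<longleftrightarrow> (\<forall>v\<in>X. \<forall>e\<in>inc E v. \<forall>e'\<in>inc E v. \<not> e \<subseteq> X \<longrightarrow> \<not> e' \<subseteq> X \<longrightarrow> e = e')"

definition boundary :: "'a set set \<Rightarrow> 'a set \<Rightarrow> 'a set set" where
  "boundary E X = {e \<in> touching E X. \<not> e \<subseteq> X}"

text \<open>A piece \<open>X\<close> of a Halin graph whose tree is rooted at a leaf: \<open>p\<close> leads to the parent, and \<open>l\<close> and \<open>r\<close> are the
  cycle edges that leave the piece on its left and on its right. Two neighboring pieces share the cycle edge
  \<open>m\<close>, and their parent edges \<open>a\<close>, \<open>b\<close> end at the same vertex \<open>w\<close>.\<close>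

inductive part :: "'a set set \<Rightarrow> 'a set \<Rightarrow> 'a set \<Rightarrow> 'a set \<Rightarrow> 'a set \<Rightarrow> bool" for E where
  leaf: "\<lbrakk>inc E v = {p, l, r}; p \<noteq> l; p \<noteq> r; l \<noteq> r\<rbrakk> \<Longrightarrow> part E {v} p l r"
| node: "\<lbrakk>part E A a l m; part E B b m r; A \<inter> B = {}; w \<notin> A; w \<notin> B;
    touching E A \<inter> touching E B = {m}; inc E w = {p, a, b}; p \<inter> (A \<union> B) = {}\<rbrakk>
    \<Longrightarrow> part E (insert w (A \<union> B)) p l r"

text \<open>The situation in which two pieces \<open>A\<close> and \<open>B\<close> are joined at a vertex \<open>w\<close>, reduced to the facts that the
  coloring argument needs: \<open>m\<close> is the only edge that touches both, and each piece has
  exactly three edges leaving it. It is symmetric under exchanging left and right.\<close>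

locale junction =
  fixes E :: "'a set set" and A B :: "'a set" and a b l m r p :: "'a set" and w :: 'a
  assumes card2: "e \<in> E \<Longrightarrow> card e = 2"
    and distinct_A: "distinct [a, l, m]" and boundary_A: "boundary E A = {a, l, m}"
    and distinct_B: "distinct [b, m, r]" and boundary_B: "boundary E B = {b, m, r}"
    and AB_disjoint: "A \<inter> B = {}" and w_notin: "w \<notin> A" "w \<notin> B"
    and AB_edges: "touching E A \<inter> touching E B = {m}"
    and inc_w: "inc E w = {p, a, b}" and p_disjoint: "p \<inter> (A \<union> B) = {}"
begin

abbreviation X where "X \<equiv> insert w (A \<union> B)"

lemma edgeD: "e \<in> E \<Longrightarrow> x \<in> e \<Longrightarrow> y \<in> e \<Longrightarrow> x \<noteq> y \<Longrightarrow> e = {x, y}"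
  using card2[of e] by (auto simp: card_2_iff)

lemma touch:
  "a \<in> touching E A" "l \<in> touching E A" "m \<in> touching E A" 
  "b \<in> touching E B" "m \<in> touching E B" "r \<in> touching E B"
  "\<not> a \<subseteq> A" "\<not> l \<subseteq> A" "\<not> m \<subseteq> A" "\<not> b \<subseteq> B" "\<not> m \<subseteq> B" "\<not> r \<subseteq> B"
  using boundary_A boundary_B unfolding boundary_def by blast+

lemma inc_wD: "p \<in> inc E w" "a \<in> inc E w" "b \<in> inc E w"
  unfolding inc_w by simp_all

lemma edges: "p \<in> E" "a \<in> E" "b \<in> E" "l \<in> E" "m \<in> E" "r \<in> E"
  using inc_wD touch by (simp_all add: inc_def touching_def)

lemma w_in: "w \<in> p" "w \<in> a" "w \<in> b"
  using inc_wD by (simp_all add: inc_def)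

lemma p_touch: "p \<notin> touching E A" "p \<notin> touching E B"
  using p_disjoint unfolding touching_def by blast+

lemma touch_both: "e \<in> touching E A \<Longrightarrow> e \<in> touching E B \<Longrightarrow> e = m"
  using AB_edges by blast

lemma not_touch: "a \<notin> touching E B" "l \<notin> touching E B" "b \<notin> touching E A" "r \<notin> touching E A"
  using touch_both[OF touch(1)] touch_both[OF touch(2)] touch_both[OF _ touch(4)] touch_both[OF _ touch(6)]
    distinct_A distinct_B by auto

lemma w_lr: "w \<notin> l" "w \<notin> m" "w \<notin> r"
proof -
  have *: "e = p \<or> e = a \<or> e = b" if "e \<in> E" "w \<in> e" for e
  proof -
    have "e \<in> inc E w" using that unfolding inc_def by simp
    then show ?thesis unfolding inc_w by simp
  qed
  show "w \<notin> l" using *[of l] edges(4) touch(2) p_touch(1) not_touch(3) distinct_A by auto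
  show "w \<notin> m" using *[of m] edges(5) touch(5) p_touch(2) not_touch(1) distinct_B by auto
  show "w \<notin> r" using *[of r] edges(6) touch(6) p_touch(2) not_touch(1) distinct_B by auto
qed

lemma a_end: obtains x where "x \<in> A" "a = {w, x}" "a \<inter> A = {x}"
proof -
  obtain x where x: "x \<in> a" "x \<in> A" using touch(1) unfolding touching_def by blast
  have "w \<noteq> x" using x w_notin by auto
  then have "a = {w, x}" by (rule edgeD[OF edges(2) w_in(2) x(1)])
  then show ?thesis using that[of x] x w_notin by simp
qed

lemma b_end: obtains x where "x \<in> B" "b = {w, x}" "b \<inter> B = {x}"
proof -
  obtain x where x: "x \<in> b" "x \<in> B" using touch(4) unfolding touching_def by blast
  have "w \<noteq> x" using x w_notin by auto
  then have "b = {w, x}" by (rule edgeD[OF edges(3) w_in(3) x(1)])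
  then show ?thesis using that[of x] x w_notin by simp
qed

lemma m_ends: obtains x y where "x \<in> A" "y \<in> B" "m = {x, y}" "m \<inter> A = {x}" "m \<inter> B = {y}"
proof -
  obtain x y where xy: "x \<in> m" "x \<in> A" "y \<in> m" "y \<in> B"
    using touch(3,5) unfolding touching_def by blast
  then have n: "x \<notin> B" "y \<notin> A" using AB_disjoint by blast+
  then have "x \<noteq> y" using xy by blast
  then have "m = {x, y}" by (rule edgeD[OF edges(5) xy(1,3)])
  then show ?thesis using that[of x y] xy n by simp
qed

lemma inside: "a \<subseteq> X" "b \<subseteq> X" "m \<subseteq> X"
proof -
  show "a \<subseteq> X" by (rule a_end) blast
  show "b \<subseteq> X" by (rule b_end) blast
  show "m \<subseteq> X" by (rule m_ends) blast
qed

lemma lr_meet: "p \<inter> X = {w}" "l \<inter> X = l \<inter> A" "r \<inter> X = r \<inter> B"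
proof -
  show "p \<inter> X = {w}" using p_disjoint w_in by blast
  have "l \<inter> B = {}" "r \<inter> A = {}" using not_touch edges unfolding touching_def by simp_all
  then show "l \<inter> X = l \<inter> A" "r \<inter> X = r \<inter> B" using w_lr by blast+
qed

lemma outside: "\<not> p \<subseteq> X" "\<not> l \<subseteq> X" "\<not> r \<subseteq> X"
proof -
  show "\<not> p \<subseteq> X"
  proof
    assume "p \<subseteq> X"
    then have "p = {w}" using lr_meet(1) by (simp add: Int_absorb2)
    then show False using card2[OF edges(1)] by simp
  qed
  show "\<not> l \<subseteq> X" using lr_meet(2) touch(8) by (metis inf.absorb_iff1)
  show "\<not> r \<subseteq> X" using lr_meet(3) touch(12) by (metis inf.absorb_iff1)
qed

lemma touching_X: "touching E X = insert p (touching E A \<union> touching E B)"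
proof -
  have "touching E X = inc E w \<union> touching E A \<union> touching E B"
    unfolding touching_def inc_def by blast
  then show ?thesis unfolding inc_w using touch(1,4) by (simp add: insert_absorb)
qed

lemma boundary_X: "boundary E X = {p, l, r}"
proof (intro equalityI subsetI)
  fix e assume "e \<in> boundary E X"
  then have e: "e \<in> touching E X" "\<not> e \<subseteq> X" unfolding boundary_def by auto
  then have "e = p \<or> e \<in> boundary E A \<or> e \<in> boundary E B"
    unfolding touching_X boundary_def by blast
  then show "e \<in> {p, l, r}"
    unfolding boundary_A boundary_B using inside e(2) by auto
next
  fix e assume "e \<in> {p, l, r}"
  then consider "e = p" | "e = l" | "e = r" by blast
  then show "e \<in> boundary E X"
    unfolding touching_X boundary_def using outside touch(2,6) by cases simp_all
qed

lemma distinct_X: "distinct [p, l, r]"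
  using p_touch touch not_touch by auto

lemma separated_X:
  assumes sA: "(\<exists>v. A = {v} \<and> inc E v = {a, l, m}) \<or> separated E A"
    and sB: "(\<exists>v. B = {v} \<and> inc E v = {b, m, r}) \<or> separated E B"
  shows "separated E X"
  unfolding separated_def
proof (intro ballI impI)
  fix v e e' assume v: "v \<in> X" and e: "e \<in> inc E v" "e' \<in> inc E v" "\<not> e \<subseteq> X" "\<not> e' \<subseteq> X"
  consider "v = w" | "v \<in> A" | "v \<in> B" using v by auto
  then show "e = e'"
  proof cases
    case 1
    then show ?thesis using e inside inc_w by auto
  next
    case 2
    from sA show ?thesis
    proof
      assume "\<exists>v. A = {v} \<and> inc E v = {a, l, m}"
      then have "inc E v = {a, l, m}" using 2 by auto
      then show ?thesis using e inside by auto
    next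
      assume "separated E A"
      moreover have "\<not> e \<subseteq> A" "\<not> e' \<subseteq> A" using e by auto
      ultimately show ?thesis using 2 e unfolding separated_def by blast
    qed
  next
    case 3
    from sB show ?thesis
    proof
      assume "\<exists>v. B = {v} \<and> inc E v = {b, m, r}"
      then have "inc E v = {b, m, r}" using 3 by auto
      then show ?thesis using e inside by auto
    next
      assume "separated E B"
      moreover have "\<not> e \<subseteq> B" "\<not> e' \<subseteq> B" using e by auto
      ultimately show ?thesis using 3 e unfolding separated_def by blast
    qed
  qed
qed

lemma junction_mirror: "junction E B A b a r m l p w"
proof
  show "card e = 2" if "e \<in> E" for e using card2[OF that] .
  show "distinct [b, r, m]" "distinct [a, m, l]" using distinct_A distinct_B by auto
  show "boundary E B = {b, r, m}" "boundary E A = {a, m, l}"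
    unfolding boundary_A boundary_B by (simp_all add: insert_commute)
  show "B \<inter> A = {}" "touching E B \<inter> touching E A = {m}" using AB_disjoint AB_edges by (simp_all add: Int_commute)
  show "inc E w = {p, b, a}" unfolding inc_w by (simp add: insert_commute)
  show "p \<inter> (B \<union> A) = {}" using p_disjoint by (simp add: Un_commute)
qed (use w_notin in simp_all)

end

lemma
  assumes E: "\<And>e. e \<in> E \<Longrightarrow> card e = 2" and "part E X p l r"
  shows part_distinct: "distinct [p, l, r]"
    and part_boundary: "boundary E X = {p, l, r}"
    and part_separated: "(\<exists>v. X = {v} \<and> inc E v = {p, l, r}) \<or> separated E X"
proof -
  have "distinct [p, l, r] \<and> boundary E X = {p, l, r} \<and>
      ((\<exists>v. X = {v} \<and> inc E v = {p, l, r}) \<or> separated E X)"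
    using assms(2)
  proof (induction rule: part.induct)
    case (leaf v p l r)
    have "touching E {v} = inc E v" unfolding touching_def inc_def by auto
    moreover have "\<not> e \<subseteq> {v}" if "e \<in> inc E v" for e
      using E[of e] that card_mono[of "{v}" e] unfolding inc_def by auto
    ultimately have "boundary E {v} = inc E v" unfolding boundary_def by auto
    then show ?case using leaf by auto
  next
    case (node A a l m B b r w p)
    have A: "distinct [a, l, m]" "boundary E A = {a, l, m}"
        "(\<exists>v. A = {v} \<and> inc E v = {a, l, m}) \<or> separated E A"
      and B: "distinct [b, m, r]" "boundary E B = {b, m, r}"
        "(\<exists>v. B = {v} \<and> inc E v = {b, m, r}) \<or> separated E B"
      using node.IH by (simp_all only:)
    interpret junction E A B a b l m r p w
      by unfold_locales (erule E | fact A B node.hyps)+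
    show ?case using distinct_X boundary_X separated_X[OF A(3) B(3)] by (simp only: simp_thms)
  qed
  then show "distinct [p, l, r]" "boundary E X = {p, l, r}"
    "(\<exists>v. X = {v} \<and> inc E v = {p, l, r}) \<or> separated E X" by auto
qed

lemma junction_node:
  assumes "\<And>e. e \<in> E \<Longrightarrow> card e = 2"
    and "part E A a l m" "part E B b m r" "A \<inter> B = {}" "w \<notin> A" "w \<notin> B"
    "touching E A \<inter> touching E B = {m}" "inc E w = {p, a, b}" "p \<inter> (A \<union> B) = {}"
  shows "junction E A B a b l m r p w"
proof -
  have "distinct [a, l, m]" "boundary E A = {a, l, m}"
    by (rule part_distinct, erule assms(1), rule assms(2), rule part_boundary, erule assms(1), rule assms(2))
  moreover have "distinct [b, m, r]" "boundary E B = {b, m, r}"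
    by (rule part_distinct, erule assms(1), rule assms(3), rule part_boundary, erule assms(1), rule assms(3))
  ultimately show ?thesis by unfold_locales (erule assms(1) | assumption | rule assms(4-9))+
qed

text \<open>A coloring of the edges that touch \<open>X\<close> in which the star condition holds for pairs of edges at a vertex
  \<open>v\<close> of \<open>X\<close> whenever at least one of them, \<open>{v, x}\<close>, lies inside. If the other one leaves
  \<open>X\<close>, the palette of its outer end \<open>y\<close> is not yet known; the condition is then made safe by asking that the
  color of the leaving edge is not in the palette of \<open>x\<close>. So no later choice of colors outside \<open>X\<close> can spoil it.\<close>

definition sound :: "'a set set \<Rightarrow> 'a set \<Rightarrow> ('a set \<Rightarrow> nat) \<Rightarrow> bool" where
  "sound E X f \<longleftrightarrow> (\<forall>e\<in>touching E X. f e < 6) \<and> (\<forall>v\<in>X. inj_on f (inc E v)) \<and>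
     (\<forall>v\<in>X. \<forall>x\<in>X. \<forall>y. {v, x} \<in> E \<longrightarrow> {v, y} \<in> E \<longrightarrow> x \<noteq> y \<longrightarrow> f {v, y} \<in> palette E f x \<longrightarrow>
        y \<in> X \<and> f {v, x} \<notin> palette E f y)"

text \<open>The intersection \<open>e \<inter> X\<close> consists of the inner end of the leaving edge \<open>e\<close>, so \<open>Q\<close> collects the other colors there.\<close>

definition end_state :: "'a set set \<Rightarrow> 'a set \<Rightarrow> ('a set \<Rightarrow> nat) \<Rightarrow> 'a set \<Rightarrow> nat \<Rightarrow> nat set \<Rightarrow> bool" where
  "end_state E X f e c Q \<longleftrightarrow> f e = c \<and> (\<forall>x\<in>e \<inter> X. palette E f x = insert c Q)"

lemma palette_cong: "(\<And>e. e \<in> touching E X \<Longrightarrow> f e = g e) \<Longrightarrow> v \<in> X \<Longrightarrow> palette E f v = palette E g v"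
  unfolding palette_def inc_def touching_def by (intro image_cong) auto

text \<open>For a leaf \<open>v\<close> that has just been joined to its neighbors \<open>w\<close> and \<open>u\<close> while its third edge \<open>l\<close> still leaves the piece:
  the pairs of edges at \<open>v\<close> to be checked are \<open>a, m\<close> and the two pairs that contain \<open>l\<close>.\<close>

lemma leaf_obligation:
  assumes E: "\<And>e. e \<in> E \<Longrightarrow> card e = 2"
    and v: "inc E v = {a, l, m}" "v \<in> X" and a: "a = {v, w}" "w \<in> X" and m: "m = {v, u}" "u \<in> X"
    and l: "\<not> l \<subseteq> X"
    and c: "\<not> (f m \<in> palette E f w \<and> f a \<in> palette E f u)" "f l \<notin> palette E f w" "f l \<notin> palette E f u"
    and xy: "{v, x} \<in> E" "{v, y} \<in> E" "x \<noteq> y" "x \<in> X" "f {v, y} \<in> palette E f x"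
  shows "y \<in> X \<and> f {v, x} \<notin> palette E f y"
proof -
  have nl: "v \<noteq> x" "v \<noteq> y" using xy E[of "{v,x}"] E[of "{v,y}"] by auto
  have "{v, x} \<in> inc E v" "{v, y} \<in> inc E v" using xy unfolding inc_def by simp_all
  then have vx: "{v, x} = a \<or> {v, x} = l \<or> {v, x} = m" and vy: "{v, y} = a \<or> {v, y} = l \<or> {v, y} = m"
    unfolding v(1) by simp_all
  have "{v, x} \<noteq> l" using l v(2) xy(4) by blast
  then have x: "x = w \<or> x = u" using vx a m by (auto simp: doubleton_eq_iff)
  have y: "y = w \<or> y = u \<or> {v, y} = l" using vy a m by (auto simp: doubleton_eq_iff)
  show ?thesis
    using x y c xy(3,5) a m by auto
qed

context junction
begin

definition join :: "('a set \<Rightarrow> nat) \<Rightarrow> ('a set \<Rightarrow> nat) \<Rightarrow> nat \<Rightarrow> 'a set \<Rightarrow> nat" where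
  "join f g c e = (if e \<in> touching E A then f e else if e \<in> touching E B then g e else c)"

lemma join_A: "e \<in> touching E A \<Longrightarrow> join f g c e = f e"
  unfolding join_def by simp

lemma join_B: "f m = g m \<Longrightarrow> e \<in> touching E B \<Longrightarrow> join f g c e = g e"
  unfolding join_def using touch_both by auto

lemma join_p: "join f g c p = c"
  unfolding join_def using p_touch by simp

lemma palette_join:
  assumes "f m = g m"
  shows "v \<in> A \<Longrightarrow> palette E (join f g c) v = palette E f v"
    and "v \<in> B \<Longrightarrow> palette E (join f g c) v = palette E g v"
    and "palette E (join f g c) w = {c, f a, g b}"
proof -
  show "palette E (join f g c) v = palette E f v" if "v \<in> A"
    by (rule palette_cong[OF join_A that])
  show "palette E (join f g c) v = palette E g v" if "v \<in> B"
    by (rule palette_cong[OF join_B[of f g, OF assms] that])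
  show "palette E (join f g c) w = {c, f a, g b}"
    unfolding palette_def inc_w using join_A[OF touch(1)] join_B[of f g, OF assms touch(4)] join_p by simp
qed

text \<open>Palettes of vertices of \<open>A\<close> and \<open>B\<close> do not change when the colorings are merged, since they agree on the only
  common edge \<open>m\<close>. In a separated piece the pairs of edges at its vertices are therefore covered by soundness
  before the join, even the pairs with an edge that used to leave and no longer does. What remains are
  the three pairs of edges at \<open>w\<close>, and the pairs at a piece that is a single leaf.\<close>

lemma sound_join:
  assumes f: "sound E A f" and g: "sound E B g" and fg: "f m = g m"
    and c: "c < 6" "distinct [c, f a, g b]"
    and W: "\<And>x y. x \<in> a \<inter> A \<Longrightarrow> y \<in> b \<inter> B \<Longrightarrow>
      c \<notin> palette E f x \<and> c \<notin> palette E g y \<and> \<not> (g b \<in> palette E f x \<and> f a \<in> palette E g y)"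
    and LA: "separated E A \<or> (\<forall>v\<in>A. \<forall>x y. {v, x} \<in> E \<longrightarrow> {v, y} \<in> E \<longrightarrow> x \<noteq> y \<longrightarrow> x \<in> X \<longrightarrow>
        join f g c {v, y} \<in> palette E (join f g c) x \<longrightarrow>
        y \<in> X \<and> join f g c {v, x} \<notin> palette E (join f g c) y)"
    and LB: "separated E B \<or> (\<forall>v\<in>B. \<forall>x y. {v, x} \<in> E \<longrightarrow> {v, y} \<in> E \<longrightarrow> x \<noteq> y \<longrightarrow> x \<in> X \<longrightarrow>
        join f g c {v, y} \<in> palette E (join f g c) x \<longrightarrow>
        y \<in> X \<and> join f g c {v, x} \<notin> palette E (join f g c) y)"
  shows "sound E X (join f g c)"
proof -
  let ?h = "join f g c"
  have hA: "\<And>e. e \<in> touching E A \<Longrightarrow> ?h e = f e" and hB: "\<And>e. e \<in> touching E B \<Longrightarrow> ?h e = g e"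
    using join_A join_B[of f g, OF fg] by auto
  have pal: "\<And>v. v \<in> A \<Longrightarrow> palette E ?h v = palette E f v"
       "\<And>v. v \<in> B \<Longrightarrow> palette E ?h v = palette E g v"
       "palette E ?h w = {c, f a, g b}"
    using palette_join[of f g, OF fg] by auto
  have incA: "inc E v \<subseteq> touching E A" if "v \<in> A" for v using that unfolding inc_def touching_def by auto
  have incB: "inc E v \<subseteq> touching E B" if "v \<in> B" for v using that unfolding inc_def touching_def by auto
  have "?h e < 6" if "e \<in> touching E X" for e
    using that f g c hA hB join_p[of f g c] unfolding touching_X sound_def by auto
  moreover have "inj_on ?h (inc E v)" if v: "v \<in> X" for v
  proof -
    consider "v = w" | "v \<in> A" | "v \<in> B" using v by auto
    then show ?thesis
    proof cases
      case 1
      have "?h p = c" "?h a = f a" "?h b = g b" using join_p hA hB touch by auto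
      then show ?thesis using c unfolding 1 inc_w inj_on_def by auto
    next
      case 2
      then have "inj_on f (inc E v)" using f unfolding sound_def by blast
      then show ?thesis using incA[OF 2] hA by (simp add: inj_on_def subset_iff)
    next
      case 3
      then have "inj_on g (inc E v)" using g unfolding sound_def by blast
      then show ?thesis using incB[OF 3] hB by (simp add: inj_on_def subset_iff)
    qed
  qed
  moreover have "y \<in> X \<and> ?h {v, x} \<notin> palette E ?h y"
    if v: "v \<in> X" and x: "x \<in> X" and vx: "{v, x} \<in> E" and vy: "{v, y} \<in> E" and xy: "x \<noteq> y"
      and h: "?h {v, y} \<in> palette E ?h x" for v x y
  proof -
    \<comment> \<open>If \<open>x\<close> lies outside the piece, separation puts \<open>y\<close> inside, and soundness applied with \<open>y\<close> in the role of \<open>x\<close> shows that the color of \<open>{v, x}\<close> is not in the palette of \<open>y\<close>.\<close>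
    have side: ?thesis if C: "v \<in> C" "C \<subseteq> X" "separated E C" and k: "sound E C k"
      "\<And>e. e \<in> touching E C \<Longrightarrow> ?h e = k e" for C k
    proof -
      have palk: "\<And>v. v \<in> C \<Longrightarrow> palette E ?h v = palette E k v"
        using palette_cong k(2) by metis
      have hk: "?h {v, x} = k {v, x}" "?h {v, y} = k {v, y}"
        using k(2) vx vy C(1) unfolding touching_def by auto
      have s: "y' \<in> C \<and> ?h {v, x'} \<notin> palette E ?h y'"
        if "x' \<in> C" "{v, x'} \<in> E" "{v, y'} \<in> E" "x' \<noteq> y'" "?h {v, y'} \<in> palette E ?h x'" for x' y'
      proof -
        have "k {v, y'} \<in> palette E k x'"
          using that(1,3,5) palk k(2)[of "{v, y'}"] C(1) unfolding touching_def by simp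
        then have "y' \<in> C \<and> k {v, x'} \<notin> palette E k y'"
          using that k(1) C(1) unfolding sound_def by blast
        then show ?thesis
          using that(2) palk k(2)[of "{v, x'}"] C(1) unfolding touching_def by simp
      qed
      show ?thesis
      proof (cases "x \<in> C")
        case True
        then show ?thesis using s[OF _ vx vy xy h] C(2) by blast
      next
        case False
        have "y \<in> C"
        proof (rule ccontr)
          assume "y \<notin> C"
          have "{v, x} \<in> inc E v" "{v, y} \<in> inc E v" using vx vy unfolding inc_def by simp_all
          then have "{v, x} = {v, y}"
            using C(3)[unfolded separated_def, rule_format, OF C(1)] False \<open>y \<notin> C\<close> by simp
          then show False using xy by (simp add: doubleton_eq_iff)
        qed
        then show ?thesis using s[OF _ vy vx xy[symmetric]] False C(2) by blast
      qed
    qed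
    consider "v = w" | "v \<in> A" | "v \<in> B" using v by auto
    then show ?thesis
    proof cases
      case 1
      obtain xa where xa: "xa \<in> A" "a = {w, xa}" "a \<inter> A = {xa}" by (rule a_end)
      obtain xb where xb: "xb \<in> B" "b = {w, xb}" "b \<inter> B = {xb}" by (rule b_end)
      have nw: "w \<noteq> x" "w \<noteq> y" using vx vy card2[of "{w,x}"] card2[of "{w,y}"] 1 by auto
      have "{w, x} \<in> inc E w" "{w, y} \<in> inc E w" using vx vy 1 unfolding inc_def by simp_all
      then have wx: "{w, x} = p \<or> {w, x} = a \<or> {w, x} = b" and wy: "{w, y} = p \<or> {w, y} = a \<or> {w, y} = b"
        unfolding inc_w by simp_all
      have "{w, x} \<noteq> p" using x outside(1) by blast
      then have X1: "x = xa \<or> x = xb" using wx xa(2) xb(2) by (auto simp: doubleton_eq_iff)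
      have Y1: "y = xa \<or> y = xb \<or> {w, y} = p" using wy xa(2) xb(2) by (auto simp: doubleton_eq_iff)
      have hab: "?h p = c" "?h {w, xa} = f a" "?h {w, xb} = g b" 
        using join_p hA hB touch xa xb by auto
      show ?thesis
        using X1 Y1 xy h W[of xa xb] xa xb hab pal 1 by auto
    next
      case 2
      from LA show ?thesis
      proof
        assume "separated E A"
        then show ?thesis using side[of A f] 2 f hA by blast
      next
        assume "\<forall>v\<in>A. \<forall>x y. {v, x} \<in> E \<longrightarrow> {v, y} \<in> E \<longrightarrow> x \<noteq> y \<longrightarrow> x \<in> X \<longrightarrow>
          ?h {v, y} \<in> palette E ?h x \<longrightarrow> y \<in> X \<and> ?h {v, x} \<notin> palette E ?h y"
        from this[rule_format, OF 2 vx vy xy x h] show ?thesis .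
      qed
    next
      case 3
      from LB show ?thesis
      proof
        assume "separated E B"
        then show ?thesis using side[of B g] 3 g hB by blast
      next
        assume "\<forall>v\<in>B. \<forall>x y. {v, x} \<in> E \<longrightarrow> {v, y} \<in> E \<longrightarrow> x \<noteq> y \<longrightarrow> x \<in> X \<longrightarrow>
          ?h {v, y} \<in> palette E ?h x \<longrightarrow> y \<in> X \<and> ?h {v, x} \<notin> palette E ?h y"
        from this[rule_format, OF 3 vx vy xy x h] show ?thesis .
      qed
    qed
  qed
  ultimately show ?thesis unfolding sound_def by blast
qed

end

section \<open>Coloring the pieces\<close>

definition colorable ::
  "'a set set \<Rightarrow> 'a set \<Rightarrow> 'a set \<Rightarrow> 'a set \<Rightarrow> 'a set \<Rightarrow> nat \<Rightarrow> nat set \<Rightarrow> nat \<Rightarrow> nat set \<Rightarrow> nat \<Rightarrow> nat set \<Rightarrow> bool"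
  where
  "colorable E X p l r cp P cl L cr R \<longleftrightarrow> (\<exists>f. sound E X f \<and>
     end_state E X f p cp P \<and> end_state E X f l cl L \<and> end_state E X f r cr R)"

lemma colorable_mirror: "colorable E X p l r cp P cl L cr R \<Longrightarrow> colorable E X p r l cp P cr R cl L"
  unfolding colorable_def by blast

lemma sound_single:
  assumes "\<And>e. e \<in> E \<Longrightarrow> card e = 2" and "\<And>e. e \<in> inc E v \<Longrightarrow> f e < 6" and "inj_on f (inc E v)"
  shows "sound E {v} f"
proof -
  have "touching E {v} = inc E v" unfolding touching_def inc_def by simp
  moreover have "{v} \<notin> E" using assms(1)[of "{v}"] by auto
  ultimately show ?thesis using assms(2,3) unfolding sound_def by simp
qed

context junction
begin

text \<open>The new edge \<open>p\<close> must avoid \<open>ca\<close>, \<open>cb\<close> and the colors \<open>P1\<close>, \<open>P2\<close> next to them, six entries in all. So there is room for \<open>p\<close>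
  only if these entries overlap. The edge \<open>m\<close> was safe on both of its sides before the join, so its two
  ends impose nothing new, and the ends of \<open>l\<close> and \<open>r\<close> are inherited.\<close>

lemma colorable_node:
  assumes sep: "separated E A" "separated E B"
    and A: "colorable E A a l m ca P1 cl L cm M1" and B: "colorable E B b m r cb P2 cm M2 cr R"
    and c: "cp < 6" "distinct [cp, ca, cb]" "cp \<notin> P1" "cp \<notin> P2" "cb \<notin> P1 \<or> ca \<notin> P2"
  shows "colorable E X p l r cp {ca, cb} cl L cr R"
proof -
  obtain f where f: "sound E A f" "end_state E A f a ca P1" "end_state E A f l cl L" "end_state E A f m cm M1"
    using A unfolding colorable_def by blast
  obtain g where g: "sound E B g" "end_state E B g b cb P2" "end_state E B g m cm M2" "end_state E B g r cr R"
    using B unfolding colorable_def by blast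
  have fg: "f m = g m" using f(4) g(3) unfolding end_state_def by simp
  have fa: "f a = ca" and gb: "g b = cb" using f(2) g(2) unfolding end_state_def by simp_all
  have s: "sound E X (join f g cp)"
  proof (rule sound_join[OF f(1) g(1) fg])
    fix x y assume "x \<in> a \<inter> A" "y \<in> b \<inter> B"
    then have "palette E f x = insert ca P1" "palette E g y = insert cb P2"
      using f(2) g(2) unfolding end_state_def by simp_all
    then show "cp \<notin> palette E f x \<and> cp \<notin> palette E g y \<and> \<not> (g b \<in> palette E f x \<and> f a \<in> palette E g y)"
      using c fa gb by auto
  qed (use c sep fa gb in simp_all)
  have "end_state E X (join f g cp) p cp {ca, cb}"
    unfolding end_state_def lr_meet by (simp add: join_p palette_join[of f g, OF fg] fa gb)
  moreover have "end_state E X (join f g cp) l cl L"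
    using f(3) unfolding end_state_def lr_meet
    by (simp add: join_A[OF touch(2)] palette_join(1)[of f g, OF fg])
  moreover have "end_state E X (join f g cp) r cr R"
    using g(4) unfolding end_state_def lr_meet
    by (simp add: join_B[of f g, OF fg touch(6)] palette_join(2)[of f g, OF fg])
  ultimately show ?thesis using s unfolding colorable_def by blast
qed

text \<open>Here the left piece is the leaf \<open>v\<close>, so \<open>v\<close> is the inner end of both \<open>a\<close> and \<open>l\<close>, and \<open>cl\<close> must not be
  visible from \<open>w\<close> or from the other end of \<open>m\<close>.\<close>

lemma colorable_leaf_node:
  assumes v: "A = {v}" "inc E v = {a, l, m}"
    and B: "separated E B" "colorable E B b m r cb P cm M cr R"
    and c: "cp < 6" "ca < 6" "cl < 6" "distinct [cp, ca, cb]" "distinct [ca, cl, cm]"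
      "cp \<notin> {cl, cm}" "cp \<notin> P" "cl \<noteq> cb" "cl \<notin> M"
      "cm \<noteq> cb \<or> ca \<notin> M" "ca \<notin> P \<or> cb \<noteq> cm"
  shows "colorable E X p l r cp {ca, cb} cl {ca, cm} cr R"
proof -
  obtain g where g: "sound E B g" "end_state E B g b cb P" "end_state E B g m cm M" "end_state E B g r cr R"
    using B unfolding colorable_def by blast
  have gm: "g m = cm" and gb: "g b = cb" using g(2,3) unfolding end_state_def by simp_all
  define f where "f e = (if e = a then ca else if e = l then cl else cm)" for e
  have fe: "f a = ca" "f l = cl" "f m = cm" using distinct_A unfolding f_def by auto
  have fg: "f m = g m" using fe gm by simp
  have cm: "cm < 6" using g(1) touch(5) gm unfolding sound_def by auto
  have palv: "palette E f v = {ca, cl, cm}" unfolding palette_def v(2) using fe by simp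
  have f: "sound E A f"
    unfolding v(1) using c cm fe by (intro sound_single card2) (auto simp: v(2) inj_on_def)
  let ?h = "join f g cp"
  have hv: "palette E ?h v = {ca, cl, cm}" using palette_join(1)[of f g, OF fg] palv v(1) by simp
  have hw: "palette E ?h w = {cp, ca, cb}" using palette_join(3)[of f g, OF fg] fe gb by simp
  have he: "?h a = ca" "?h l = cl" "?h m = cm" using fe join_A touch by simp_all
  obtain x u where xu: "x \<in> A" "u \<in> B" "m = {x, u}" "m \<inter> A = {x}" "m \<inter> B = {u}" by (rule m_ends)
  have hu: "palette E ?h u = insert cm M"
    using palette_join(2)[of f g, OF fg xu(2)] g(3) xu(5) unfolding end_state_def by simp
  have s: "sound E X ?h"
  proof (rule sound_join[OF f g(1) fg])
    fix x y assume "x \<in> a \<inter> A" "y \<in> b \<inter> B"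
    then have xy: "palette E f x = {ca, cl, cm}" "palette E g y = insert cb P"
      using palv v(1) g(2) unfolding end_state_def by simp_all
    show "cp \<notin> palette E f x \<and> cp \<notin> palette E g y \<and> \<not> (g b \<in> palette E f x \<and> f a \<in> palette E g y)"
      unfolding xy fe gb using c by auto
  next
    have a: "a = {v, w}" using a_end v(1) by (metis insert_commute singletonD)
    have m: "m = {v, u}" using xu v(1) by simp
    have X: "v \<in> X" "w \<in> X" "u \<in> X" using v(1) xu(2) by simp_all
    have o: "\<not> (?h m \<in> palette E ?h w \<and> ?h a \<in> palette E ?h u)" "?h l \<notin> palette E ?h w" "?h l \<notin> palette E ?h u"
      unfolding he hw hu using c by auto
    have "y' \<in> X \<and> ?h {v, x'} \<notin> palette E ?h y'"
      if "{v, x'} \<in> E" "{v, y'} \<in> E" "x' \<noteq> y'" "x' \<in> X" "?h {v, y'} \<in> palette E ?h x'" for x' y'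
      by (rule leaf_obligation[OF card2 v(2) X(1) a X(2) m X(3) outside(2) o that])
    then show "separated E A \<or> (\<forall>v\<in>A. \<forall>x y. {v, x} \<in> E \<longrightarrow> {v, y} \<in> E \<longrightarrow> x \<noteq> y \<longrightarrow> x \<in> X \<longrightarrow>
        ?h {v, y} \<in> palette E ?h x \<longrightarrow> y \<in> X \<and> ?h {v, x} \<notin> palette E ?h y)"
      unfolding v(1) by blast
  qed (use c B(1) fe gb in simp_all)
  have "end_state E X ?h p cp {ca, cb}"
    unfolding end_state_def lr_meet by (simp add: join_p hw)
  moreover have "end_state E X ?h l cl {ca, cm}"
    unfolding end_state_def lr_meet
  proof (intro conjI ballI)
    fix x assume "x \<in> l \<inter> A"
    then have "x = v" using v(1) by simp
    then show "palette E ?h x = insert cl {ca, cm}" using hv by (simp add: insert_commute)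
  qed (rule he(2))
  moreover have "end_state E X ?h r cr R"
    using g(4) unfolding end_state_def lr_meet
    by (simp add: join_B[of f g, OF fg touch(6)] palette_join(2)[of f g, OF fg])
  ultimately show ?thesis using s unfolding colorable_def by blast
qed

text \<open>Two leaves with a common parent form a triangle \<open>a, b, m\<close>. If it gets the three colors that its leaving edges
  do not have, then no color of a leaving edge occurs on the triangle.\<close>

lemma colorable_cherry:
  assumes v: "A = {v}" "inc E v = {a, l, m}" and u: "B = {u}" "inc E u = {b, m, r}"
    and c: "distinct [cp, cl, cr, ca, cb, cm]" "{cp, cl, cr, ca, cb, cm} \<subseteq> {..<6}"
  shows "colorable E X p l r cp {ca, cb} cl {ca, cm} cr {cb, cm}"
proof -
  define f where "f e = (if e = a then ca else if e = l then cl else cm)" for e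
  have fe: "f a = ca" "f l = cl" "f m = cm" using distinct_A unfolding f_def by auto
  define g where "g e = (if e = b then cb else if e = r then cr else cm)" for e
  have ge: "g b = cb" "g r = cr" "g m = cm" using distinct_B unfolding g_def by auto
  have fg: "f m = g m" using fe ge by simp
  have palv: "palette E f v = {ca, cl, cm}" unfolding palette_def v(2) using fe by simp
  have palu: "palette E g u = {cb, cm, cr}" unfolding palette_def u(2) using ge by simp
  have f: "sound E A f"
    unfolding v(1) using c fe by (intro sound_single card2) (auto simp: v(2) inj_on_def)
  have g: "sound E B g"
    unfolding u(1) using c ge by (intro sound_single card2) (auto simp: u(2) inj_on_def)
  let ?h = "join f g cp"
  have hv: "palette E ?h v = {ca, cl, cm}" using palette_join(1)[of f g, OF fg] palv v(1) by simp
  have hu: "palette E ?h u = {cb, cm, cr}" using palette_join(2)[of f g, OF fg] palu u(1) by simp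
  have hw: "palette E ?h w = {cp, ca, cb}" using palette_join(3)[of f g, OF fg] fe ge by simp
  have he: "?h a = ca" "?h l = cl" "?h m = cm" "?h b = cb" "?h r = cr"
    using fe ge join_A join_B[of f g, OF fg] touch by simp_all
  have a: "a = {v, w}"
  proof -
    obtain x where "x \<in> A" "a = {w, x}" by (rule a_end)
    then show ?thesis using v(1) by auto
  qed
  have b: "b = {u, w}"
  proof -
    obtain x where "x \<in> B" "b = {w, x}" by (rule b_end)
    then show ?thesis using u(1) by auto
  qed
  have m: "m = {v, u}"
  proof -
    obtain x y where "x \<in> A" "y \<in> B" "m = {x, y}" by (rule m_ends)
    then show ?thesis using u(1) v(1) by auto
  qed
  have X: "v \<in> X" "u \<in> X" "w \<in> X" using v(1) u(1) by simp_all
  have s: "sound E X ?h"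
  proof (rule sound_join[OF f g fg])
    fix x y assume "x \<in> a \<inter> A" "y \<in> b \<inter> B"
    then have xy: "x = v" "y = u"
      using v(1) u(1) by auto
    show "cp \<notin> palette E f x \<and> cp \<notin> palette E g y \<and> \<not> (g b \<in> palette E f x \<and> f a \<in> palette E g y)"
      unfolding xy palv palu fe ge using c(1) by auto
  next
    have o: "\<not> (?h m \<in> palette E ?h w \<and> ?h a \<in> palette E ?h u)" "?h l \<notin> palette E ?h w" "?h l \<notin> palette E ?h u"
      unfolding he hw hu using c(1) by auto
    have "y' \<in> X \<and> ?h {v, x'} \<notin> palette E ?h y'"
      if "{v, x'} \<in> E" "{v, y'} \<in> E" "x' \<noteq> y'" "x' \<in> X" "?h {v, y'} \<in> palette E ?h x'" for x' y'
      by (rule leaf_obligation[OF card2 v(2) X(1) a X(3) m X(2) outside(2) o that])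
    then show "separated E A \<or> (\<forall>v\<in>A. \<forall>x y. {v, x} \<in> E \<longrightarrow> {v, y} \<in> E \<longrightarrow> x \<noteq> y \<longrightarrow> x \<in> X \<longrightarrow>
        ?h {v, y} \<in> palette E ?h x \<longrightarrow> y \<in> X \<and> ?h {v, x} \<notin> palette E ?h y)"
      unfolding v(1) by blast
  next
    have u2: "inc E u = {b, r, m}" unfolding u(2) by (simp add: insert_commute)
    have mu: "m = {u, v}" unfolding m by (simp add: insert_commute)
    have o: "\<not> (?h m \<in> palette E ?h w \<and> ?h b \<in> palette E ?h v)" "?h r \<notin> palette E ?h w" "?h r \<notin> palette E ?h v"
      unfolding he hw hv using c(1) by auto
    have "y' \<in> X \<and> ?h {u, x'} \<notin> palette E ?h y'"
      if "{u, x'} \<in> E" "{u, y'} \<in> E" "x' \<noteq> y'" "x' \<in> X" "?h {u, y'} \<in> palette E ?h x'" for x' y'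
      by (rule leaf_obligation[OF card2 u2 X(2) b X(3) mu X(1) outside(3) o that])
    then show "separated E B \<or> (\<forall>v\<in>B. \<forall>x y. {v, x} \<in> E \<longrightarrow> {v, y} \<in> E \<longrightarrow> x \<noteq> y \<longrightarrow> x \<in> X \<longrightarrow>
        ?h {v, y} \<in> palette E ?h x \<longrightarrow> y \<in> X \<and> ?h {v, x} \<notin> palette E ?h y)"
      unfolding u(1) by blast
  qed (use c fe ge in simp_all)
  have "end_state E X ?h p cp {ca, cb}"
    unfolding end_state_def lr_meet by (simp add: join_p hw)
  moreover have "end_state E X ?h l cl {ca, cm}"
    unfolding end_state_def lr_meet
  proof (intro conjI ballI)
    fix x assume "x \<in> l \<inter> A"
    then have "x = v" using v(1) by simp
    then show "palette E ?h x = insert cl {ca, cm}" using hv by (simp add: insert_commute)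
  qed (rule he(2))
  moreover have "end_state E X ?h r cr {cb, cm}"
    unfolding end_state_def lr_meet
  proof (intro conjI ballI)
    fix x assume "x \<in> r \<inter> B"
    then have "x = u" using u(1) by simp
    then show "palette E ?h x = insert cr {cb, cm}" using hu by (simp add: insert_commute)
  qed (rule he(5))
  ultimately show ?thesis using s unfolding colorable_def by blast
qed

end

text \<open>An enumeration of the six colors. Quantifying over all enumerations expresses realizability of a pattern up
  to every permutation of colors.\<close>

definition hexad :: "nat \<Rightarrow> nat \<Rightarrow> nat \<Rightarrow> nat \<Rightarrow> nat \<Rightarrow> nat \<Rightarrow> bool" where
  "hexad u v w x y z \<longleftrightarrow> distinct [u, v, w, x, y, z] \<and> {u, v, w, x, y, z} \<subseteq> {..<6}"

text \<open>With the leaving edges colored \<open>u, v, w\<close>, their inner ends see exactly the other three colors, and each inner end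
  misses a different one of them.\<close>

definition balanced :: "'a set set \<Rightarrow> 'a set \<Rightarrow> 'a set \<Rightarrow> 'a set \<Rightarrow> 'a set \<Rightarrow> bool" where
  "balanced E X p l r \<longleftrightarrow> (\<forall>u v w x y z. hexad u v w x y z \<longrightarrow>
     colorable E X p l r u {x, y} v {x, z} w {y, z})"

text \<open>At the right end the two remaining colors are those of the other two leaving edges. The first pattern
  reuses the color of the right edge at both other ends, the second pattern does not. The second one can be
  closed up at the root and serves for most joins; the first one is used when the left edge is shared with a
  neighboring piece that is not a single leaf.\<close>

definition skew :: "'a set set \<Rightarrow> 'a set \<Rightarrow> 'a set \<Rightarrow> 'a set \<Rightarrow> 'a set \<Rightarrow> bool" where
  "skew E X p l r \<longleftrightarrow> (\<forall>u v w x y z. hexad u v w x y z \<longrightarrow>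
     colorable E X p l r u {w, x} v {w, y} w {u, v} \<and>
     colorable E X p l r u {x, y} v {x, z} w {u, v})"

text \<open>Balanced and skew pieces have this pattern in common: it leaves open the end that becomes the end of the shared
  edge in a join.\<close>

definition half_balanced :: "'a set set \<Rightarrow> 'a set \<Rightarrow> 'a set \<Rightarrow> 'a set \<Rightarrow> 'a set \<Rightarrow> bool" where
  "half_balanced E X p l r \<longleftrightarrow> (\<forall>u v w x y z. hexad u v w x y z \<longrightarrow>
     (\<exists>R. colorable E X p l r u {x, y} v {x, z} w R))"

lemma balanced_mirror: "balanced E X p l r \<Longrightarrow> balanced E X p r l"
  unfolding balanced_def
proof (intro allI impI)
  fix u v w x y z
  assume *: "\<forall>u v w x y z. hexad u v w x y z \<longrightarrow> colorable E X p l r u {x, y} v {x, z} w {y, z}"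
    and "hexad u v w x y z"
  then have "hexad u w v y x z" unfolding hexad_def by auto
  from *[rule_format, OF this] show "colorable E X p r l u {x, y} v {x, z} w {y, z}"
    using colorable_mirror by (metis insert_commute)
qed

lemma balanced_half: "balanced E X p l r \<Longrightarrow> half_balanced E X p l r"
  unfolding balanced_def half_balanced_def by blast

lemma skew_half: "skew E X p l r \<Longrightarrow> half_balanced E X p l r"
  unfolding skew_def half_balanced_def by blast

context junction
begin

text \<open>In this and the next two lemmas the enumerations are chosen such that \<open>P1\<close>, \<open>P2\<close> and the colors of \<open>a\<close>, \<open>b\<close> together leave
  out the color intended for \<open>p\<close>, and such that the inherited ends complete the claimed pattern. In this first one
  \<open>p\<close> repeats the color of \<open>m\<close>.\<close>

lemma half_half:
  assumes sep: "separated E A" "separated E B"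
    and A: "half_balanced E A a l m" and B: "half_balanced E B b r m"
  shows "balanced E X p l r"
  unfolding balanced_def
proof (intro allI impI)
  fix c0 c1 c2 c3 c4 c5 assume h: "hexad c0 c1 c2 c3 c4 c5"
  then have h1: "hexad c4 c1 c0 c3 c2 c5" and h2: "hexad c3 c2 c0 c5 c1 c4"
    unfolding hexad_def by auto
  obtain R where 1: "colorable E A a l m c4 {c3, c2} c1 {c3, c5} c0 R"
    using A h1 unfolding half_balanced_def by blast
  obtain L where "colorable E B b r m c3 {c5, c1} c2 {c5, c4} c0 L"
    using B h2 unfolding half_balanced_def by blast
  then have 2: "colorable E B b m r c3 {c5, c1} c0 L c2 {c5, c4}" by (rule colorable_mirror)
  have "colorable E X p l r c0 {c4, c3} c1 {c3, c5} c2 {c5, c4}"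
    by (rule colorable_node[OF sep 1 2]) (use h in \<open>auto simp: hexad_def\<close>)
  then show "colorable E X p l r c0 {c3, c4} c1 {c3, c5} c2 {c4, c5}"
    by (simp add: insert_commute)
qed

lemma half_skew:
  assumes sep: "separated E A" "separated E B"
    and A: "half_balanced E A a l m" and B: "skew E B b m r"
  shows "skew E X p r l"
  unfolding skew_def
proof (intro allI impI conjI)
  fix c0 c1 c2 c3 c4 c5 assume h: "hexad c0 c1 c2 c3 c4 c5"
  then have h1: "hexad c3 c2 c4 c1 c5 c0" and h2: "hexad c2 c4 c1 c3 c5 c0"
    unfolding hexad_def by auto
  obtain R where 1: "colorable E A a l m c3 {c1, c5} c2 {c1, c0} c4 R"
    using A h1 unfolding half_balanced_def by blast
  have 2: "colorable E B b m r c2 {c1, c3} c4 {c1, c5} c1 {c2, c4}"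
    using B h2 unfolding skew_def by blast
  have "colorable E X p l r c0 {c3, c2} c2 {c1, c0} c1 {c2, c4}"
    by (rule colorable_node[OF sep 1 2]) (use h in \<open>auto simp: hexad_def\<close>)
  from colorable_mirror[OF this] show "colorable E X p r l c0 {c2, c3} c1 {c2, c4} c2 {c0, c1}"
    by (simp add: insert_commute)
next
  fix c0 c1 c2 c3 c4 c5 assume h: "hexad c0 c1 c2 c3 c4 c5"
  then have h1: "hexad c4 c2 c5 c1 c3 c0" and h2: "hexad c3 c5 c1 c2 c4 c0"
    unfolding hexad_def by auto
  obtain R where 1: "colorable E A a l m c4 {c1, c3} c2 {c1, c0} c5 R"
    using A h1 unfolding half_balanced_def by blast
  have 2: "colorable E B b m r c3 {c1, c2} c5 {c1, c4} c1 {c3, c5}"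
    using B h2 unfolding skew_def by blast
  have "colorable E X p l r c0 {c4, c3} c2 {c1, c0} c1 {c3, c5}"
    by (rule colorable_node[OF sep 1 2]) (use h in \<open>auto simp: hexad_def\<close>)
  from colorable_mirror[OF this] show "colorable E X p r l c0 {c3, c4} c1 {c3, c5} c2 {c0, c1}"
    by (simp add: insert_commute)
qed

lemma skew_skew:
  assumes sep: "separated E A" "separated E B"
    and A: "skew E A a m l" and B: "skew E B b m r"
  shows "balanced E X p l r"
  unfolding balanced_def
proof (intro allI impI)
  fix c0 c1 c2 c3 c4 c5 assume h: "hexad c0 c1 c2 c3 c4 c5"
  then have h1: "hexad c3 c5 c1 c4 c2 c0" and h2: "hexad c4 c5 c2 c1 c3 c0"
    unfolding hexad_def by auto
  have "colorable E A a m l c3 {c1, c4} c5 {c1, c2} c1 {c3, c5}"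
    using A h1 unfolding skew_def by blast
  then have 1: "colorable E A a l m c3 {c1, c4} c1 {c3, c5} c5 {c1, c2}" by (rule colorable_mirror)
  have 2: "colorable E B b m r c4 {c2, c1} c5 {c2, c3} c2 {c4, c5}"
    using B h2 unfolding skew_def by blast
  show "colorable E X p l r c0 {c3, c4} c1 {c3, c5} c2 {c4, c5}"
    by (rule colorable_node[OF sep 1 2]) (use h in \<open>auto simp: hexad_def\<close>)
qed

lemma leaf_leaf:
  assumes v: "A = {v}" "inc E v = {a, l, m}" and u: "B = {u}" "inc E u = {b, m, r}"
  shows "balanced E X p l r"
  unfolding balanced_def
  by (intro allI impI colorable_cherry[OF v u]) (auto simp: hexad_def)

lemma leaf_balanced:
  assumes v: "A = {v}" "inc E v = {a, l, m}" and B: "separated E B" "balanced E B b m r"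
  shows "skew E X p l r"
  unfolding skew_def
proof (intro allI impI conjI)
  fix c0 c1 c2 c3 c4 c5 assume h: "hexad c0 c1 c2 c3 c4 c5"
  then have "hexad c3 c4 c2 c5 c1 c0" unfolding hexad_def by auto
  then have 1: "colorable E B b m r c3 {c5, c1} c4 {c5, c0} c2 {c1, c0}"
    using B(2) unfolding balanced_def by blast
  have "colorable E X p l r c0 {c2, c3} c1 {c2, c4} c2 {c1, c0}"
    by (rule colorable_leaf_node[OF v B(1) 1]) (use h in \<open>auto simp: hexad_def\<close>)
  then show "colorable E X p l r c0 {c2, c3} c1 {c2, c4} c2 {c0, c1}" by (simp add: insert_commute)
next
  fix c0 c1 c2 c3 c4 c5 assume h: "hexad c0 c1 c2 c3 c4 c5"
  then have "hexad c4 c5 c2 c3 c1 c0" unfolding hexad_def by auto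
  then have 1: "colorable E B b m r c4 {c3, c1} c5 {c3, c0} c2 {c1, c0}"
    using B(2) unfolding balanced_def by blast
  have "colorable E X p l r c0 {c3, c4} c1 {c3, c5} c2 {c1, c0}"
    by (rule colorable_leaf_node[OF v B(1) 1]) (use h in \<open>auto simp: hexad_def\<close>)
  then show "colorable E X p l r c0 {c3, c4} c1 {c3, c5} c2 {c0, c1}" by (simp add: insert_commute)
qed

lemma leaf_skew:
  assumes v: "A = {v}" "inc E v = {a, l, m}" and B: "separated E B" "skew E B b m r"
  shows "balanced E X p l r"
  unfolding balanced_def
proof (intro allI impI)
  fix c0 c1 c2 c3 c4 c5 assume h: "hexad c0 c1 c2 c3 c4 c5"
  then have "hexad c4 c5 c2 c3 c1 c0" unfolding hexad_def by auto
  then have 1: "colorable E B b m r c4 {c3, c1} c5 {c3, c0} c2 {c4, c5}"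
    using B(2) unfolding skew_def by blast
  show "colorable E X p l r c0 {c3, c4} c1 {c3, c5} c2 {c4, c5}"
    by (rule colorable_leaf_node[OF v B(1) 1]) (use h in \<open>auto simp: hexad_def\<close>)
qed

lemma leaf_skew':
  assumes v: "A = {v}" "inc E v = {a, l, m}" and B: "separated E B" "skew E B b r m"
  shows "skew E X p l r"
  unfolding skew_def
proof (intro allI impI conjI)
  fix c0 c1 c2 c3 c4 c5 assume h: "hexad c0 c1 c2 c3 c4 c5"
  then have "hexad c3 c2 c4 c1 c5 c0" unfolding hexad_def by auto
  then have "colorable E B b r m c3 {c1, c5} c2 {c1, c0} c4 {c3, c2}"
    using B(2) unfolding skew_def by blast
  then have 1: "colorable E B b m r c3 {c1, c5} c4 {c3, c2} c2 {c1, c0}" by (rule colorable_mirror)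
  have "colorable E X p l r c0 {c2, c3} c1 {c2, c4} c2 {c1, c0}"
    by (rule colorable_leaf_node[OF v B(1) 1]) (use h in \<open>auto simp: hexad_def\<close>)
  then show "colorable E X p l r c0 {c2, c3} c1 {c2, c4} c2 {c0, c1}" by (simp add: insert_commute)
next
  fix c0 c1 c2 c3 c4 c5 assume h: "hexad c0 c1 c2 c3 c4 c5"
  then have "hexad c4 c2 c5 c1 c3 c0" unfolding hexad_def by auto
  then have "colorable E B b r m c4 {c1, c3} c2 {c1, c0} c5 {c4, c2}"
    using B(2) unfolding skew_def by blast
  then have 1: "colorable E B b m r c4 {c1, c3} c5 {c4, c2} c2 {c1, c0}" by (rule colorable_mirror)
  have "colorable E X p l r c0 {c3, c4} c1 {c3, c5} c2 {c1, c0}"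
    by (rule colorable_leaf_node[OF v B(1) 1]) (use h in \<open>auto simp: hexad_def\<close>)
  then show "colorable E X p l r c0 {c3, c4} c1 {c3, c5} c2 {c0, c1}" by (simp add: insert_commute)
qed

end

text \<open>Mirror images are included to make the notion symmetric; for balanced pieces this is automatic.\<close>

definition flexible :: "'a set set \<Rightarrow> 'a set \<Rightarrow> 'a set \<Rightarrow> 'a set \<Rightarrow> 'a set \<Rightarrow> bool" where
  "flexible E X p l r \<longleftrightarrow> balanced E X p l r \<or> skew E X p l r \<or> skew E X p r l"

lemma flexible_mirror: "flexible E X p l r \<Longrightarrow> flexible E X p r l"
  unfolding flexible_def using balanced_mirror by blast

lemma (in junction) flexible_leaf:
  assumes v: "A = {v}" "inc E v = {a, l, m}" and B: "separated E B" "flexible E B b m r"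
  shows "flexible E X p l r"
  using B(2) leaf_balanced[OF v B(1)] leaf_skew[OF v B(1)] leaf_skew'[OF v B(1)]
  unfolding flexible_def by blast

text \<open>Balanced pieces and pieces with their skew end at \<open>m\<close> are half balanced in the required sense. The others have
  their skew end at the outer edge, \<open>l\<close> or \<open>r\<close>, so the cases are: none, one or both of the outer ends are skew.\<close>

lemma (in junction) flexible_node:
  assumes A: "separated E A" "flexible E A a l m" and B: "separated E B" "flexible E B b m r"
  shows "flexible E X p l r"
proof -
  interpret mirror: junction E B A b a r m l p w by (rule junction_mirror)
  have M: "mirror.X = X" by (simp add: Un_commute)
  have a: "half_balanced E A a l m \<or> skew E A a m l"
    using A(2) balanced_half skew_half unfolding flexible_def by blast
  have b: "half_balanced E B b r m \<or> skew E B b m r"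
    using B(2) balanced_mirror balanced_half skew_half unfolding flexible_def by blast
  show ?thesis
    using a b half_half[OF A(1) B(1)] half_skew[OF A(1) B(1)] skew_skew[OF A(1) B(1)]
      mirror.half_skew[OF B(1) A(1), unfolded M]
    unfolding flexible_def by blast
qed

lemma part_flexible:
  assumes E: "\<And>e. e \<in> E \<Longrightarrow> card e = 2" and "part E X p l r"
  shows "(\<exists>v. X = {v} \<and> inc E v = {p, l, r}) \<or> flexible E X p l r"
  using assms(2)
proof (induction rule: part.induct)
  case (leaf v p l r)
  then show ?case by blast
next
  case (node A a l m B b r w p)
  interpret junction E A B a b l m r p w
    by (rule junction_node) (fact E node.hyps)+
  interpret mirror: junction E B A b a r m l p w by (rule junction_mirror)
  have M: "mirror.X = insert w (A \<union> B)" by (simp add: Un_commute)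
  have sA: "(\<exists>v. A = {v} \<and> inc E v = {a, l, m}) \<or> separated E A"
    by (rule part_separated) (fact E node.hyps)+
  have sB: "(\<exists>v. B = {v} \<and> inc E v = {b, m, r}) \<or> separated E B"
    by (rule part_separated) (fact E node.hyps)+
  consider (ll) v u where "A = {v}" "inc E v = {a, l, m}" "B = {u}" "inc E u = {b, m, r}"
    | (ln) v where "A = {v}" "inc E v = {a, l, m}" "separated E B" "flexible E B b m r"
    | (nl) u where "B = {u}" "inc E u = {b, m, r}" "separated E A" "flexible E A a l m"
    | (nn) "separated E A" "flexible E A a l m" "separated E B" "flexible E B b m r"
    using sA sB node.IH by metis
  then have "flexible E (insert w (A \<union> B)) p l r"
  proof cases
    case ll
    then show ?thesis using leaf_leaf unfolding flexible_def by blast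
  next
    case ln
    then show ?thesis by (rule flexible_leaf)
  next
    case nl
    have "inc E u = {b, r, m}" using nl(2) by (simp add: insert_commute)
    from mirror.flexible_leaf[OF nl(1) this nl(3) flexible_mirror[OF nl(4)]]
    show ?thesis unfolding M by (rule flexible_mirror)
  next
    case nn
    then show ?thesis by (rule flexible_node)
  qed
  then show ?case by blast
qed

text \<open>At the root leaf the leaving edges \<open>p, l, r\<close> meet. Their colors may be taken to be \<open>0, 1, 2\<close>; the ends of \<open>p\<close> and \<open>l\<close>
  avoid these colors, and the end of \<open>r\<close> sees either none of them or both \<open>0\<close> and \<open>1\<close>. In all cases at most one of any
  two of the edges sees the color of the other.\<close>

lemma star_6_edge_coloring_of_part:
  assumes E: "\<And>e. e \<in> E \<Longrightarrow> card e = 2" and X: "part E X p l r" "\<rho> \<notin> X" "inc E \<rho> = {p, l, r}"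
    and V: "\<And>e. e \<in> E \<Longrightarrow> e \<subseteq> insert \<rho> X" and nsing: "\<nexists>v. X = {v}"
  shows "\<exists>f. star_edge_coloring E 6 f"
proof -
  have h: "hexad 0 1 2 3 4 5" unfolding hexad_def by simp
  have "flexible E X p l r" using part_flexible[OF E X(1)] nsing by blast
  then consider "balanced E X p l r" | "skew E X p l r" | "skew E X p r l"
    unfolding flexible_def by blast
  then have "\<exists>l' r' R. inc E \<rho> = {p, l', r'} \<and> colorable E X p l' r' 0 {3, 4} 1 {3, 5} 2 R
      \<and> (R = {4, 5} \<or> R = {0, 1})"
  proof cases
    case 1
    then have "colorable E X p l r 0 {3, 4} 1 {3, 5} 2 {4, 5}" using h unfolding balanced_def by blast
    then show ?thesis using X(3) by blast
  next
    case 2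
    then have "colorable E X p l r 0 {3, 4} 1 {3, 5} 2 {0, 1}" using h unfolding skew_def by blast
    then show ?thesis using X(3) by blast
  next
    case 3
    then have "colorable E X p r l 0 {3, 4} 1 {3, 5} 2 {0, 1}" using h unfolding skew_def by blast
    moreover have "inc E \<rho> = {p, r, l}" using X(3) by (simp add: insert_commute)
    ultimately show ?thesis by blast
  qed
  then obtain l' r' R where \<rho>: "inc E \<rho> = {p, l', r'}" and R: "R = {4, 5} \<or> R = {0, 1}"
    and C: "colorable E X p l' r' 0 {3, 4} 1 {3, 5} 2 R"
    by (elim exE conjE) (rule that)
  obtain f where f: "sound E X f" "end_state E X f p 0 {3, 4}" "end_state E X f l' 1 {3, 5}" "end_state E X f r' 2 R"
    using C unfolding colorable_def by blast
  have fe: "f p = 0" "f l' = 1" "f r' = 2" using f(2-4) unfolding end_state_def by (simp_all only:)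
  have tX: "e \<in> touching E X" if "e \<in> E" for e
  proof -
    have "\<not> e \<subseteq> {\<rho>}" using E[OF that] card_mono[of "{\<rho>}" e] by auto
    then have "e \<inter> X \<noteq> {}" using V[OF that] by blast
    then show ?thesis using that unfolding touching_def by simp
  qed
  have inj: "inj_on f (inc E v)" for v
  proof -
    have "inc E v = {}" if "v \<notin> insert \<rho> X" using V that unfolding inc_def by blast
    then consider "v \<in> X" | "v = \<rho>" | "inc E v = {}" by blast
    then show ?thesis
    proof cases
      case 1 then show ?thesis using f(1) unfolding sound_def by blast
    next
      case 2 then show ?thesis unfolding 2 \<rho> inj_on_def using fe by auto
    qed simp
  qed
  have "star_at E f v" for v
    unfolding star_at_def
  proof (intro allI impI notI, elim conjE)
    fix x y assume vx: "{v, x} \<in> E" and vy: "{v, y} \<in> E" and xy: "x \<noteq> y"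
      and 1: "f {v, y} \<in> palette E f x" and 2: "f {v, x} \<in> palette E f y"
    have s: "\<And>x y. v \<in> X \<Longrightarrow> x \<in> X \<Longrightarrow> {v, x} \<in> E \<Longrightarrow> {v, y} \<in> E \<Longrightarrow> x \<noteq> y \<Longrightarrow> f {v, y} \<in> palette E f x
        \<Longrightarrow> y \<in> X \<and> f {v, x} \<notin> palette E f y"
      using f(1) unfolding sound_def by blast
    have nl: "v \<noteq> x" "v \<noteq> y" using vx vy E[of "{v,x}"] E[of "{v,y}"] by auto
    show False
    proof (cases "v \<in> X")
      case True
      have "x \<in> X \<or> y \<in> X" using V[OF vx] V[OF vy] xy by blast
      then show False using s[OF True _ vx vy xy] s[OF True _ vy vx xy[symmetric]] 1 2 by blast
    next
      case False
      then have v: "v = \<rho>" using V[OF vx] by blast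
      have X: "x \<in> X" "y \<in> X" using V[OF vx] V[OF vy] nl v by auto
      have "{v, x} \<in> inc E \<rho>" "{v, y} \<in> inc E \<rho>" using vx vy v unfolding inc_def by simp_all
      then have cx: "{v, x} = p \<or> {v, x} = l' \<or> {v, x} = r'" and cy: "{v, y} = p \<or> {v, y} = l' \<or> {v, y} = r'"
        unfolding \<rho> by simp_all
      have px: "{v, x} = p \<Longrightarrow> palette E f x = {0, 3, 4}" "{v, x} = l' \<Longrightarrow> palette E f x = {1, 3, 5}"
        "{v, x} = r' \<Longrightarrow> palette E f x = insert 2 R"
        using f X unfolding end_state_def by auto
      have py: "{v, y} = p \<Longrightarrow> palette E f y = {0, 3, 4}" "{v, y} = l' \<Longrightarrow> palette E f y = {1, 3, 5}"
        "{v, y} = r' \<Longrightarrow> palette E f y = insert 2 R"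
        using f X unfolding end_state_def by auto
      have "{v, x} \<noteq> {v, y}" using xy by (simp add: doubleton_eq_iff)
      then have ne: "f {v, x} \<noteq> f {v, y}" using cx cy fe by auto
      show False using cx
      proof (elim disjE)
        assume x: "{v, x} = p"
        show False using cy ne 1 2 unfolding x using px(1)[OF x] py fe R by auto
      next
        assume x: "{v, x} = l'"
        show False using cy ne 1 2 unfolding x using px(2)[OF x] py fe R by auto
      next
        assume x: "{v, x} = r'"
        show False using cy ne 1 2 unfolding x using px(3)[OF x] py fe R by auto
      qed
    qed
  qed
  moreover have "f ` E \<subseteq> {..<6}" using f(1) tX unfolding sound_def by auto
  ultimately show ?thesis using star_edge_coloring_iff_star_at[OF E] inj by blast
qed

section \<open>Crossing arcs inside a closed curve\<close>

text \<open>The arc \<open>c\<close> cuts the inside of the closed curve formed by \<open>c1\<close> and \<open>c2\<close> into two regions, the one bounded by \<open>c1\<close> and \<open>c\<close>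
  and the one bounded by \<open>c2\<close> and \<open>c\<close>. An arc \<open>h\<close> inside that avoids \<open>c\<close> stays in one of them, so both its ends lie
  in the closure of that region. But \<open>u\<close> is not on the boundary of the second region and \<open>v\<close> is not on the
  boundary of the first.\<close>

lemma crossing_arcs:
  fixes c1 c2 c h :: "real \<Rightarrow> complex"
  assumes c1: "arc c1" "pathstart c1 = x" "pathfinish c1 = y"
    and c2: "arc c2" "pathstart c2 = x" "pathfinish c2 = y"
    and c: "arc c" "pathstart c = x" "pathfinish c = y"
    and h: "arc h" "pathstart h = u" "pathfinish h = v"
    and c12: "path_image c1 \<inter> path_image c2 = {x, y}"
    and cJ: "path_image c \<inter> (path_image c1 \<union> path_image c2) = {x, y}"
    and hJ: "path_image h \<inter> (path_image c1 \<union> path_image c2) = {u, v}"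
    and u: "u \<in> path_image c1" "u \<notin> {x, y}" and v: "v \<in> path_image c2" "v \<notin> {x, y}"
    and cin: "path_image c \<inter> outside (path_image c1 \<union> path_image c2) = {}"
    and hin: "path_image h \<inter> outside (path_image c1 \<union> path_image c2) = {}"
  shows "path_image c \<inter> path_image h \<noteq> {}"
proof
  assume disj: "path_image c \<inter> path_image h = {}"
  let ?J = "path_image c1 \<union> path_image c2"
  define I1 where "I1 = inside (path_image c1 \<union> path_image c)"
  define I2 where "I2 = inside (path_image c2 \<union> path_image c)"
  have xy: "x \<noteq> y" using c1 arc_distinct_ends by blast
  have J: "z \<in> ?J \<or> z \<in> inside ?J" if "z \<notin> outside ?J" for z
    using that by (metis ComplI UnE Un_iff union_with_inside)
  have sub: "path_image c1 \<inter> path_image c \<subseteq> {x, y}" "path_image c2 \<inter> path_image c \<subseteq> {x, y}"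
    using cJ by blast+
  have ends: "x \<in> path_image c1" "y \<in> path_image c1" "x \<in> path_image c2" "y \<in> path_image c2"
    "x \<in> path_image c" "y \<in> path_image c"
    using c1 c2 c pathstart_in_path_image pathfinish_in_path_image by metis+
  have c1c: "path_image c1 \<inter> path_image c = {x, y}" and c2c: "path_image c2 \<inter> path_image c = {x, y}"
    using sub ends by auto
  \<comment> \<open>Any interior point of \<open>c\<close> will do; the midpoint of the parameter interval gives one.\<close>
  have ne: "path_image c \<inter> inside ?J \<noteq> {}"
  proof -
    have inj: "inj_on c {0..1}" using c(1) unfolding arc_def by simp
    have "c (1/2) \<noteq> c 0" "c (1/2) \<noteq> c 1"
      using inj_onD[OF inj, of "1/2" 0] inj_onD[OF inj, of "1/2" 1] by auto
    then have n: "c (1/2) \<notin> {x, y}" using c(2,3) unfolding pathstart_def pathfinish_def by simp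
    have in_c: "c (1/2) \<in> path_image c" unfolding path_image_def by simp
    then have "c (1/2) \<notin> ?J" using n cJ by blast
    moreover have "c (1/2) \<notin> outside ?J" using in_c cin by blast
    ultimately show ?thesis using J in_c by blast
  qed
  have split: "I1 \<inter> I2 = {}" "I1 \<union> I2 \<union> (path_image c - {x, y}) = inside ?J"
    unfolding I1_def I2_def
    using split_inside_simple_closed_curve[OF arc_imp_simple_path[OF c1(1)] c1(2,3)
        arc_imp_simple_path[OF c2(1)] c2(2,3) arc_imp_simple_path[OF c(1)] c(2,3) xy c12 c1c c2c ne]
    by blast+
  have cl: "closed (path_image c1 \<union> path_image c)" "closed (path_image c2 \<union> path_image c)"
    using c c1 c2 closed_arc_image by blast+
  have op: "open I1" "open I2" unfolding I1_def I2_def using cl open_inside by blast+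
  have clI: "closure I1 \<subseteq> path_image c1 \<union> path_image c \<union> I1" "closure I2 \<subseteq> path_image c2 \<union> path_image c \<union> I2"
    unfolding I1_def I2_def using closure_inside_subset[OF cl(1)] closure_inside_subset[OF cl(2)] by simp_all
  define K where "K = h ` {0<..<1}"
  have ph: "continuous_on {0..1} h" using h(1) unfolding arc_def path_def by simp
  have injh: "inj_on h {0..1}" using h(1) unfolding arc_def by simp
  have conK: "connected K" unfolding K_def
    by (intro connected_continuous_image continuous_on_subset[OF ph]) auto
  have K: "K \<subseteq> I1 \<union> I2"
  proof
    fix z assume "z \<in> K"
    then obtain t where t: "0 < t" "t < 1" "z = h t" unfolding K_def by auto
    have zh: "z \<in> path_image h" unfolding path_image_def t(3) using t by simp
    have "h t \<noteq> h 0" "h t \<noteq> h 1"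
      using inj_onD[OF injh, of t 0] inj_onD[OF injh, of t 1] t by auto
    then have "z \<notin> {u, v}" using h(2,3) t(3) unfolding pathstart_def pathfinish_def by simp
    then have "z \<notin> ?J" using zh hJ by blast
    then have "z \<in> inside ?J" using zh hin J by blast
    moreover have "z \<notin> path_image c" using zh disj by blast
    ultimately show "z \<in> I1 \<union> I2" using split(2) by blast
  qed
  have "I1 \<inter> K = {} \<or> I2 \<inter> K = {}"
    using connectedD[OF conK op] K split(1) by blast
  then have KI: "K \<subseteq> I1 \<or> K \<subseteq> I2" using K by blast
  have cK: "h ` {0..1} \<subseteq> closure I" if "K \<subseteq> I" for I
  proof -
    have "h ` closure {0<..<1} \<subseteq> closure I"
      by (rule image_closure_subset) (use that ph closure_subset in \<open>auto simp: K_def\<close>)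
    then show ?thesis by simp
  qed
  have uh: "u \<in> h ` {0..1}" "v \<in> h ` {0..1}" using h(2,3) unfolding pathstart_def pathfinish_def by auto
  have nJ: "u \<notin> inside ?J" "v \<notin> inside ?J" using u v inside_no_overlap by blast+
  have nI: "u \<notin> I1" "u \<notin> I2" "v \<notin> I1" "v \<notin> I2" using nJ split(2) by blast+
  have nc: "u \<notin> path_image c" "v \<notin> path_image c" using u v cJ by blast+
  have n12: "u \<notin> path_image c2" "v \<notin> path_image c1" using u v c12 by blast+
  from KI show False
  proof
    assume "K \<subseteq> I1"
    then have "v \<in> closure I1" using cK uh by blast
    then show False using clI(1) nI nc n12 by blast
  next
    assume "K \<subseteq> I2"
    then have "u \<in> closure I2" using cK uh by blast
    then show False using clI(2) nI nc n12 by blast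
  qed
qed

definition path_drawing :: "(complex set \<Rightarrow> real \<Rightarrow> complex) \<Rightarrow> complex list \<Rightarrow> complex set" where
  "path_drawing \<gamma> vs = (\<Union>e\<in>path_edges vs. path_image (\<gamma> e))"

lemma path_edges_subset: "e \<in> path_edges vs \<Longrightarrow> e \<subseteq> set vs"
  unfolding path_edges_def by auto

lemma path_edges_append: "path_edges (xs @ y # ys) = path_edges (xs @ [y]) \<union> path_edges (y # ys)"
proof (induction xs)
  case (Cons x xs)
  then show ?case by (cases xs) auto
qed (cases ys, auto)

lemma path_edges_cover: "v \<in> set vs \<Longrightarrow> 2 \<le> length vs \<Longrightarrow> \<exists>e\<in>path_edges vs. v \<in> e"
proof (induction vs rule: induct_list012)
  case (3 x y zs)
  then show ?case by (cases zs) auto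
qed auto

lemma path_edges_ends:
  assumes "distinct vs" "{hd vs, last vs} \<in> path_edges vs" 
  shows "length vs = 2"
proof -
  obtain i where i: "Suc i < length vs" "{hd vs, last vs} = {vs ! i, vs ! Suc i}"
    using assms(2) unfolding path_edges_def by blast
  have ne: "vs \<noteq> []" using i by auto
  have "hd vs = vs ! 0" "last vs = vs ! (length vs - 1)" using ne by (simp_all add: hd_conv_nth last_conv_nth)
  then have "vs ! 0 = vs ! i \<and> vs ! (length vs - 1) = vs ! Suc i \<or> vs ! 0 = vs ! Suc i"
    using i(2) by (auto simp: doubleton_eq_iff)
  moreover have n: "vs ! 0 = vs ! i \<longleftrightarrow> 0 = i" "vs ! 0 = vs ! Suc i \<longleftrightarrow> 0 = Suc i"
      "vs ! (length vs - 1) = vs ! Suc i \<longleftrightarrow> length vs - 1 = Suc i"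
    by (rule nth_eq_iff_index_eq[OF assms(1)]; use i(1) in linarith)+
  ultimately have "0 = i \<and> length vs - 1 = Suc i" unfolding n by simp
  then show ?thesis using i(1) by linarith
qed

lemma plane_edge:
  assumes "plane_graph V E \<gamma>" "e \<in> E"
  shows "arc (\<gamma> e)" "{pathstart (\<gamma> e), pathfinish (\<gamma> e)} = e" "card e = 2" "e \<subseteq> V"
    "e \<subseteq> path_image (\<gamma> e)"
proof -
  note edge = assms(1)[unfolded plane_graph_def, THEN conjunct2, THEN bspec, OF assms(2)]
  show "arc (\<gamma> e)" using edge by simp
  show *: "{pathstart (\<gamma> e), pathfinish (\<gamma> e)} = e" using edge by (simp only:)
  show "card e = 2" "e \<subseteq> V" using assms unfolding plane_graph_def simple_graph_def by simp_all
  have "{pathstart (\<gamma> e), pathfinish (\<gamma> e)} \<subseteq> path_image (\<gamma> e)"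
    by (simp add: pathstart_in_path_image pathfinish_in_path_image)
  then show "e \<subseteq> path_image (\<gamma> e)" unfolding * .
qed

lemma plane_edges_meet:
  assumes "plane_graph V E \<gamma>" "e \<in> E" "e' \<in> E" "e \<noteq> e'"
  shows "path_image (\<gamma> e) \<inter> path_image (\<gamma> e') \<subseteq> e \<inter> e'"
proof -
  have "(path_image (\<gamma> e) - e) \<inter> path_image (\<gamma> e') = {}" "(path_image (\<gamma> e') - e') \<inter> path_image (\<gamma> e) = {}"
    using assms(1)[unfolded plane_graph_def, THEN conjunct2, THEN bspec, OF assms(2)]
      assms(1)[unfolded plane_graph_def, THEN conjunct2, THEN bspec, OF assms(3)] assms(2-4) by simp_all
  then show ?thesis by blast
qed

lemma arc_along_path:
  assumes G: "plane_graph V E \<gamma>" and "graph_path E vs" "2 \<le> length vs"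
  shows "\<exists>g. arc g \<and> pathstart g = hd vs \<and> pathfinish g = last vs \<and> path_image g = path_drawing \<gamma> vs"
  using assms(2,3)
proof (induction vs rule: induct_list012)
  case (3 x y zs)
  have e: "{x, y} \<in> E" and rest: "graph_path E (y # zs)" and d: "distinct (x # y # zs)"
    using 3(3) unfolding graph_path_def by auto
  have "\<exists>g. arc g \<and> pathstart g = x \<and> pathfinish g = y \<and> path_image g = path_image (\<gamma> {x, y})"
  proof -
    have "pathstart (\<gamma> {x, y}) = x \<and> pathfinish (\<gamma> {x, y}) = y \<or>
        pathstart (\<gamma> {x, y}) = y \<and> pathfinish (\<gamma> {x, y}) = x"
      using plane_edge(2)[OF G e] by (auto simp: doubleton_eq_iff)
    then show ?thesis
    proof
      assume "pathstart (\<gamma> {x, y}) = x \<and> pathfinish (\<gamma> {x, y}) = y"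
      then show ?thesis using plane_edge(1)[OF G e] by blast
    next
      assume "pathstart (\<gamma> {x, y}) = y \<and> pathfinish (\<gamma> {x, y}) = x"
      then show ?thesis using plane_edge(1)[OF G e]
        by (intro exI[of _ "reversepath (\<gamma> {x, y})"]) (simp add: arc_reversepath)
    qed
  qed
  then obtain g where g: "arc g" "pathstart g = x" "pathfinish g = y" "path_image g = path_image (\<gamma> {x, y})"
    by blast
  show ?case
  proof (cases zs)
    case Nil
    then show ?thesis using g by (intro exI[of _ g]) (simp add: path_drawing_def)
  next
    case (Cons z zs')
    then have "2 \<le> length (y # zs)" by simp
    from "3.IH"(2)[OF rest this] obtain k where k: "arc k" "pathstart k = y" "pathfinish k = last (y # zs)"
      "path_image k = path_drawing \<gamma> (y # zs)" by auto
    have meet: "path_image g \<inter> path_image k \<subseteq> {pathstart k}"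
    proof
      fix t assume t: "t \<in> path_image g \<inter> path_image k"
      then obtain e' where e': "e' \<in> path_edges (y # zs)" "t \<in> path_image (\<gamma> e')"
        unfolding k(4) path_drawing_def by blast
      have e'E: "e' \<in> E" using rest e' unfolding graph_path_def by blast
      have x: "x \<notin> e'" using path_edges_subset[OF e'(1)] d by auto
      then have "{x, y} \<noteq> e'" by blast
      then have "t \<in> {x, y} \<inter> e'" using plane_edges_meet[OF G e e'E] t e' g(4) by blast
      then show "t \<in> {pathstart k}" using x k(2) by auto
    qed
    have "arc (g +++ k)" by (rule arc_join[OF g(1) k(1)]) (use g k meet in auto)
    moreover have "path_image (g +++ k) = path_drawing \<gamma> (x # y # zs)"
      using g k by (simp add: path_image_join path_drawing_def)
    ultimately show ?thesis using g k by (intro exI[of _ "g +++ k"]) simp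
  qed
qed auto

lemma path_drawings_meet:
  assumes G: "plane_graph V E \<gamma>" and "path_edges vs \<subseteq> E" "path_edges ws \<subseteq> E" "path_edges vs \<inter> path_edges ws = {}"
  shows "path_drawing \<gamma> vs \<inter> path_drawing \<gamma> ws \<subseteq> set vs \<inter> set ws"
proof
  fix z assume "z \<in> path_drawing \<gamma> vs \<inter> path_drawing \<gamma> ws"
  then obtain e e' where e: "e \<in> path_edges vs" "z \<in> path_image (\<gamma> e)" "e' \<in> path_edges ws" "z \<in> path_image (\<gamma> e')"
    unfolding path_drawing_def by blast
  then have "z \<in> e \<inter> e'" using plane_edges_meet[OF G, of e e'] assms by blast
  then show "z \<in> set vs \<inter> set ws" using path_edges_subset e by blast
qed

lemma drawing_compact:
  assumes "plane_graph V E \<gamma>"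
  shows "compact (drawing V E \<gamma>)"
proof -
  have fV: "finite V" and E: "E \<subseteq> Pow V" using assms unfolding plane_graph_def simple_graph_def by auto
  then have fE: "finite E" by (meson finite_Pow_iff finite_subset)
  have "compact (path_image (\<gamma> e))" if "e \<in> E" for e
    using plane_edge(1)[OF assms that] compact_arc_image by blast
  then show ?thesis unfolding drawing_def
    using fE by (intro compact_Un finite_imp_compact[OF fV] compact_UN) auto
qed

text \<open>The exterior face \<open>O\<close> meets the connected set \<open>outside J\<close>, and its frontier \<open>J\<close> does not. Hence \<open>O\<close> contains
  all of \<open>outside J\<close>, and nothing is drawn there.\<close>

lemma outer_boundary:
  assumes G: "plane_graph V E \<gamma>" and J: "frontier (exterior_face V E \<gamma>) = J" "J \<subseteq> drawing V E \<gamma>"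
  shows "drawing V E \<gamma> \<inter> outside J = {}"
proof -
  let ?D = "drawing V E \<gamma>"
  have D: "bounded ?D" using drawing_compact[OF G] compact_imp_bounded by blast
  then have bJ: "bounded J" using J(2) bounded_subset by blast
  have O: "outside ?D \<subseteq> outside J" using outside_mono[OF J(2)] .
  have "outside ?D \<noteq> {}" using D outside_bounded_nonempty by blast
  moreover have con: "connected (outside J)" using connected_outside[OF bJ] by simp
  ultimately have "outside J \<subseteq> outside ?D"
    using connected_Int_frontier[OF con, of "outside ?D"] O J(1) outside_no_overlap[of J]
    unfolding exterior_face_def by blast
  then show ?thesis using outside_no_overlap[of ?D] by blast
qed

section \<open>Tree paths do not cross\<close>

lemma path_inner_not_leaf:
  assumes "graph_path T P" "z \<in> set P" "z \<noteq> hd P" "z \<noteq> last P"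
  shows "vdegree T z \<noteq> 1"
proof
  assume "vdegree T z = 1"
  then obtain e where e: "{e \<in> T. z \<in> e} = {e}" unfolding vdegree_def by (rule card_1_singletonE)
  obtain i where i: "i < length P" "P ! i = z" using assms(2) by (auto simp: in_set_conv_nth)
  have "P \<noteq> []" using i by auto
  then have ends: "hd P = P ! 0" "last P = P ! (length P - 1)" by (simp_all add: hd_conv_nth last_conv_nth)
  have "i \<noteq> 0" "i \<noteq> length P - 1" using i(2) assms(3,4) unfolding ends by (rule_tac notI, simp)+
  then obtain k where k: "i = Suc k" "Suc i < length P" using i by (cases i) auto
  have d: "distinct P" and PT: "path_edges P \<subseteq> T" using assms(1) unfolding graph_path_def by auto
  have "{P ! k, z} \<in> path_edges P" "{z, P ! Suc i} \<in> path_edges P"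
    unfolding path_edges_def using i k by auto
  then have "{P ! k, z} \<in> {e \<in> T. z \<in> e}" "{z, P ! Suc i} \<in> {e \<in> T. z \<in> e}" using PT by auto
  then have "{P ! k, z} = {z, P ! Suc i}" unfolding e by simp
  then have "P ! k = P ! Suc i" by (auto simp: doubleton_eq_iff)
  moreover have "P ! k \<noteq> P ! Suc i" using nth_eq_iff_index_eq[OF d, of k "Suc i"] k by simp
  ultimately show False by simp
qed

text \<open>The leaves \<open>a\<close>, \<open>c\<close> split the outer cycle into two arcs, one through \<open>b\<close> and one through \<open>d\<close>. Inner vertices
  of a path have degree at least two, so a tree path between leaves meets the outer cycle only
  in its ends; as nothing is drawn outside the cycle, disjoint paths from \<open>a\<close> to \<open>c\<close> and from \<open>b\<close> to \<open>d\<close> would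
  contradict the lemma on crossing arcs.\<close>

lemma halin_noncrossing:
  assumes H: "halin_graph V T C \<gamma>" and TC: "T \<inter> C = {}"
    and cs: "graph_cycle C cs" "cycle_edges cs = C" "set cs = leaves V T"
    and split: "cs = a # S1 @ b # S2 @ c # S3 @ d # S4"
    and P: "graph_path T P" "hd P = a" "last P = c" and Q: "graph_path T Q" "hd Q = b" "last Q = d"
    and disj: "set P \<inter> set Q = {}"
  shows False
proof -
  have G: "plane_graph V (T \<union> C) \<gamma>" and bd: "frontier (exterior_face V (T \<union> C) \<gamma>) = drawing (leaves V T) C \<gamma>"
    using H unfolding halin_graph_def by blast+
  define vs1 where "vs1 = (a # S1 @ b # S2) @ [c]"
  define vs2 where "vs2 = c # S3 @ d # S4 @ [a]"
  have dist: "distinct cs" using cs unfolding graph_cycle_def by simp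
  have C: "path_edges vs1 \<union> path_edges vs2 = C"
    using cs(2) path_edges_append[of "a # S1 @ b # S2" c "S3 @ d # S4 @ [a]"]
    unfolding cycle_edges_def split vs1_def vs2_def by simp
  have p1: "graph_path (T \<union> C) vs1" and p2: "graph_path (T \<union> C) vs2"
    using dist C unfolding graph_path_def split vs1_def vs2_def by auto
  have l1: "2 \<le> length vs1" "length vs1 \<noteq> 2" and l2: "2 \<le> length vs2" unfolding vs1_def vs2_def by simp_all
  have e1: "hd vs1 = a" "last vs1 = c" and e2: "hd vs2 = c" "last vs2 = a" unfolding vs1_def vs2_def by simp_all
  have s12: "set vs1 \<inter> set vs2 = {a, c}" using dist unfolding split vs1_def vs2_def by auto
  have sl: "set vs1 \<union> set vs2 = leaves V T" unfolding cs(3)[symmetric] split vs1_def vs2_def by auto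
  have ac: "a \<noteq> c" "b \<noteq> d" "b \<notin> {a, c}" "d \<notin> {a, c}" using dist unfolding split by auto
  have card2: "card e = 2" if "e \<in> T \<union> C" for e using plane_edge(3)[OF G that] .
  \<comment> \<open>The two halves of the cycle could only share the edge \<open>{a, c}\<close>, but the first one passes through \<open>b\<close>.\<close>
  have edis: "path_edges vs1 \<inter> path_edges vs2 = {}"
  proof (rule ccontr)
    assume "path_edges vs1 \<inter> path_edges vs2 \<noteq> {}"
    then obtain e where e: "e \<in> path_edges vs1" "e \<in> path_edges vs2" by blast
    then have "e \<subseteq> {a, c}" using path_edges_subset[OF e(1)] path_edges_subset[OF e(2)] s12 by blast
    moreover have "card e = 2" using card2 C e by blast
    ultimately have "e = {a, c}" using card_seteq[of "{a, c}" e] ac by simp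
    then have "{hd vs1, last vs1} \<in> path_edges vs1" using e e1 by simp
    then show False using path_edges_ends p1 l1 unfolding graph_path_def by blast
  qed
  obtain g1 where g1: "arc g1" "pathstart g1 = a" "pathfinish g1 = c" "path_image g1 = path_drawing \<gamma> vs1"
    using arc_along_path[OF G p1 l1(1)] e1 by auto
  obtain g2 where g2: "arc g2" "pathstart g2 = c" "pathfinish g2 = a" "path_image g2 = path_drawing \<gamma> vs2"
    using arc_along_path[OF G p2 l2] e2 by auto
  have long: "2 \<le> length P" if "graph_path T P" "hd P \<noteq> last P" for P
    using that unfolding graph_path_def by (cases P rule: remdups_adj.cases) auto
  have pTC: "graph_path (T \<union> C) P" if "graph_path T P" for P using that unfolding graph_path_def by blast
  have lP: "2 \<le> length P" and lQ: "2 \<le> length Q" using long P Q ac by auto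
  obtain g where g: "arc g" "pathstart g = a" "pathfinish g = c" "path_image g = path_drawing \<gamma> P"
    using arc_along_path[OF G pTC[OF P(1)] lP] P by auto
  obtain h where h: "arc h" "pathstart h = b" "pathfinish h = d" "path_image h = path_drawing \<gamma> Q"
    using arc_along_path[OF G pTC[OF Q(1)] lQ] Q by auto
  have cover: "set vs \<subseteq> path_drawing \<gamma> vs" if cov: "path_edges vs \<subseteq> T \<union> C" "2 \<le> length vs" for vs
  proof
    fix v assume "v \<in> set vs"
    then obtain e where e: "e \<in> path_edges vs" "v \<in> e" using path_edges_cover[OF _ cov(2)] by blast
    then have "e \<in> T \<union> C" using cov(1) by blast
    then have "v \<in> path_image (\<gamma> e)" using plane_edge(5)[OF G] e(2) by blast
    then show "v \<in> path_drawing \<gamma> vs" using e(1) unfolding path_drawing_def by blast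
  qed
  have sub: "path_edges vs1 \<subseteq> T \<union> C" "path_edges vs2 \<subseteq> T \<union> C" "path_edges P \<subseteq> T" "path_edges Q \<subseteq> T"
    using p1 p2 P(1) Q(1) unfolding graph_path_def by simp_all
  have c1: "set vs1 \<subseteq> path_drawing \<gamma> vs1" "set vs2 \<subseteq> path_drawing \<gamma> vs2"
    "set P \<subseteq> path_drawing \<gamma> P" "set Q \<subseteq> path_drawing \<gamma> Q"
    using cover[OF sub(1) l1(1)] cover[OF sub(2) l2] cover[OF _ lP] cover[OF _ lQ] sub(3,4) by blast+
  define J where "J = path_drawing \<gamma> vs1 \<union> path_drawing \<gamma> vs2"
  have J: "J = (\<Union>e\<in>C. path_image (\<gamma> e))" unfolding J_def path_drawing_def C[symmetric] by blast
  have "drawing (leaves V T) C \<gamma> = J"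
    unfolding drawing_def sl[symmetric] J[symmetric] using c1 unfolding J_def by blast
  moreover have "J \<subseteq> drawing V (T \<union> C) \<gamma>" unfolding J drawing_def by blast
  ultimately have out: "drawing V (T \<union> C) \<gamma> \<inter> outside J = {}"
    using outer_boundary[OF G] bd by simp
  have tree_arc: "path_drawing \<gamma> R \<inter> J = {hd R, last R}"
    if "graph_path T R" "2 \<le> length R" "hd R \<in> leaves V T" "last R \<in> leaves V T" for R
  proof
    have R: "path_edges R \<subseteq> T" "R \<noteq> []" using that(1) unfolding graph_path_def by auto
    have i: "path_edges R \<inter> path_edges vs1 = {}" "path_edges R \<inter> path_edges vs2 = {}" using R TC C by blast+
    have "path_drawing \<gamma> R \<inter> J \<subseteq> set R \<inter> leaves V T"
      using path_drawings_meet[OF G _ sub(1) i(1)] path_drawings_meet[OF G _ sub(2) i(2)] R(1) sl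
      unfolding J_def by blast
    also have "\<dots> \<subseteq> {hd R, last R}"
      using path_inner_not_leaf[OF that(1)] unfolding leaves_def by blast
    finally show "path_drawing \<gamma> R \<inter> J \<subseteq> {hd R, last R}" .
    have "path_edges R \<subseteq> T \<union> C" using R(1) by blast
    then have "set R \<subseteq> path_drawing \<gamma> R" using cover that(2) by blast
    then have "{hd R, last R} \<subseteq> path_drawing \<gamma> R" using R(2) by auto
    moreover have "{hd R, last R} \<subseteq> J" using that(3,4) c1 sl unfolding J_def by blast
    ultimately show "{hd R, last R} \<subseteq> path_drawing \<gamma> R \<inter> J" by blast
  qed
  have lv: "a \<in> leaves V T" "b \<in> leaves V T" "c \<in> leaves V T" "d \<in> leaves V T"
    unfolding cs(3)[symmetric] split by simp_all
  have tP: "path_drawing \<gamma> P \<inter> J = {a, c}" and tQ: "path_drawing \<gamma> Q \<inter> J = {b, d}"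
    using tree_arc[OF P(1) lP] tree_arc[OF Q(1) lQ] P Q lv by auto
  have "path_drawing \<gamma> vs1 \<inter> path_drawing \<gamma> vs2 \<subseteq> {a, c}"
    using path_drawings_meet[OF G sub(1,2) edis] s12 by blast
  moreover have "{a, c} \<subseteq> path_drawing \<gamma> vs1 \<inter> path_drawing \<gamma> vs2" using c1(1,2) s12 by blast
  ultimately have m12: "path_drawing \<gamma> vs1 \<inter> path_drawing \<gamma> vs2 = {a, c}" by (rule equalityI)
  have inD: "path_drawing \<gamma> R \<inter> outside J = {}" if "path_edges R \<subseteq> T" for R
    using out that unfolding drawing_def path_drawing_def by blast
  have "path_drawing \<gamma> P \<inter> path_drawing \<gamma> Q \<noteq> {}"
    unfolding g(4)[symmetric] h(4)[symmetric]
  proof (rule crossing_arcs[OF g1(1-3), of "reversepath g2" g h b d])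
    show "arc (reversepath g2)" using g2(1) by (rule arc_reversepath)
    show "b \<in> path_image g1" "d \<in> path_image (reversepath g2)"
      using c1 g1 g2 unfolding vs1_def vs2_def by auto
  qed (use g2 g h m12 tP tQ ac inD sub g1 in \<open>simp_all add: J_def\<close>)
  moreover have "path_drawing \<gamma> P \<inter> path_drawing \<gamma> Q \<subseteq> set P \<inter> set Q"
  proof (rule path_drawings_meet[OF G])
    show "path_edges P \<inter> path_edges Q = {}"
    proof (rule ccontr)
      assume "path_edges P \<inter> path_edges Q \<noteq> {}"
      then obtain e where e: "e \<in> path_edges P" "e \<in> path_edges Q" by blast
      then have "e = {}" using path_edges_subset[OF e(1)] path_edges_subset[OF e(2)] disj by blast
      then show False using card2[of e] e sub by auto
    qed
  qed (use sub in blast)+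
  ultimately show False using disj by simp
qed

section \<open>From the plane tree to nested pieces\<close>

text \<open>Reachability by tree edges inside \<open>X\<close>, as a closure of a relation: symmetry, transitivity and monotonicity are
  then immediate, and simple paths are extracted only where they are needed.\<close>

definition joined :: "'a set set \<Rightarrow> 'a set \<Rightarrow> 'a \<Rightarrow> 'a \<Rightarrow> bool" where
  "joined T X = (\<lambda>x y. {x, y} \<in> T \<and> x \<in> X \<and> y \<in> X)\<^sup>*\<^sup>*"

lemma joined_refl [simp]: "joined T X x x"
  unfolding joined_def by simp

lemma joined_edge: "{x, y} \<in> T \<Longrightarrow> x \<in> X \<Longrightarrow> y \<in> X \<Longrightarrow> joined T X x y"
  unfolding joined_def by blast

lemma joined_trans: "joined T X x y \<Longrightarrow> joined T X y z \<Longrightarrow> joined T X x z"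
  unfolding joined_def by simp

lemma joined_sym: "joined T X x y \<Longrightarrow> joined T X y x"
  unfolding joined_def by (rule sympD[OF symp_rtranclp]) (auto simp: symp_def insert_commute)

lemma joined_same: "joined T X x y \<Longrightarrow> joined T X x z \<Longrightarrow> joined T X y z"
  using joined_sym joined_trans by fast

lemma joined_mono: "joined T X x y \<Longrightarrow> X \<subseteq> Y \<Longrightarrow> joined T Y x y"
  unfolding joined_def by (erule rtranclp_mono[THEN predicate2D, rotated]) auto

lemma joined_in: "joined T X x y \<Longrightarrow> x \<in> X \<Longrightarrow> y \<in> X"
  unfolding joined_def by (induction rule: rtranclp_induct) auto

lemma joined_path:
  assumes "joined T X x y" "x \<in> X"
  shows "\<exists>vs. graph_path T vs \<and> set vs \<subseteq> X \<and> hd vs = x \<and> last vs = y"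
  using assms(1) unfolding joined_def
proof (induction rule: rtranclp_induct)
  case base
  show ?case using assms(2) by (intro exI[of _ "[x]"]) (simp add: graph_path_def)
next
  case (step y z)
  then obtain vs where vs: "graph_path T vs" "set vs \<subseteq> X" "hd vs = x" "last vs = y" by blast
  have ne: "vs \<noteq> []" using vs(1) unfolding graph_path_def by simp
  show ?case
  proof (cases "z \<in> set vs")
    case True
    then obtain as bs where s: "vs = as @ z # bs" by (meson split_list)
    \<comment> \<open>The walk returns to \<open>z\<close>, so the path is cut off there.\<close>
    have "graph_path T (as @ [z])"
      using vs(1) path_edges_append[of as z bs] unfolding graph_path_def s by auto
    moreover have "hd (as @ [z]) = x" using vs(3) unfolding s by (cases as) auto
    ultimately show ?thesis using vs(2) s by (intro exI[of _ "as @ [z]"]) auto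
  next
    case False
    obtain as where s: "vs = as @ [y]" using ne vs(4) by (metis append_butlast_last_id)
    have "path_edges (vs @ [z]) = path_edges vs \<union> {{y, z}}"
      unfolding s using path_edges_append[of as y "[z]"] by simp
    then have "graph_path T (vs @ [z])" using vs(1) step.hyps(2) False unfolding graph_path_def by auto
    then show ?thesis using vs step.hyps(2) ne by (intro exI[of _ "vs @ [z]"]) auto
  qed
qed

lemma path_joined:
  assumes "path_edges vs \<subseteq> T" "set vs \<subseteq> X" "vs \<noteq> []"
  shows "joined T X (hd vs) (last vs)"
  using assms
proof (induction vs rule: induct_list012)
  case (3 x y zs)
  then have "joined T X y (last (y # zs))" by simp
  moreover have "joined T X x y" using 3 by (intro joined_edge) auto
  ultimately have "joined T X x (last (y # zs))" by (rule joined_trans[rotated])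
  then show ?case by simp
qed auto

text \<open>What remains of a cubic Halin graph once its drawing has been forgotten. The list \<open>cs\<close> of the cycle starts at the leaf that
  serves as the root of the tree.\<close>

locale cubic_tree_cycle =
  fixes V :: "'a set" and T C :: "'a set set" and cs :: "'a list"
  assumes graph: "simple_graph V (T \<union> C)" and tree: "tree_graph V T"
    and cubic: "regular_graph 3 V (T \<union> C)"
    and inner: "\<And>v. v \<in> V - leaves V T \<Longrightarrow> 3 \<le> vdegree T v"
    and cycle: "graph_cycle C cs" "cycle_edges cs = C" "set cs = leaves V T"
begin

abbreviation E where "E \<equiv> T \<union> C"
abbreviation n where "n \<equiv> length cs"
abbreviation root where "root \<equiv> cs ! 0"

definition rim :: "nat \<Rightarrow> 'a set" where
  "rim i = {cs ! i, cs ! (Suc i mod n)}"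

lemma n3: "3 \<le> n" and dist: "distinct cs"
  using cycle(1) unfolding graph_cycle_def by auto

lemma card2: "e \<in> E \<Longrightarrow> card e = 2" and sub_V: "e \<in> E \<Longrightarrow> e \<subseteq> V"
  using graph unfolding simple_graph_def by auto

lemma finite_V: "finite V"
  using graph unfolding simple_graph_def by auto

lemma finite_E: "finite E"
  using finite_V sub_V by (meson PowI finite_Pow_iff finite_subset subsetI)

lemma card_inc: "v \<in> V \<Longrightarrow> card (inc E v) = 3"
  using cubic unfolding regular_graph_def vdegree_def inc_def by auto

lemma vdeg: "vdegree T v = card (inc T v)"
  unfolding vdegree_def inc_def by simp

lemma edge_split: "e \<in> E \<Longrightarrow> x \<in> e \<Longrightarrow> \<exists>y. y \<noteq> x \<and> e = {x, y}"
  using card2[of e] by (auto simp: card_2_iff)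

lemma C_rim: "C = rim ` {..<n}"
proof -
  have ne: "cs \<noteq> []" using n3 by auto
  have nth: "{(cs @ [hd cs]) ! i, (cs @ [hd cs]) ! Suc i} = rim i" if "i < n" for i
  proof (cases "Suc i < n")
    case True
    then show ?thesis by (simp add: rim_def nth_append)
  next
    case False
    then have "n = Suc i" using that by simp
    then show ?thesis using ne by (simp add: rim_def nth_append hd_conv_nth)
  qed
  have "e \<in> C \<longleftrightarrow> (\<exists>i<n. e = rim i)" for e
    unfolding cycle(2)[symmetric] cycle_edges_def path_edges_def using nth by fastforce
  then show ?thesis by auto
qed

lemma nth_eq: "i < n \<Longrightarrow> j < n \<Longrightarrow> cs ! i = cs ! j \<longleftrightarrow> i = j"
  using nth_eq_iff_index_eq[OF dist] .

lemma nth_image: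
  assumes "k < n" "I \<subseteq> {..<n}"
  shows "cs ! k \<in> (!) cs ` I \<longleftrightarrow> k \<in> I"
proof
  assume "cs ! k \<in> (!) cs ` I"
  then obtain k' where k': "k' \<in> I" "cs ! k = cs ! k'" by blast
  then have "k' < n" using assms(2) by blast
  then show "k \<in> I" using nth_eq[OF assms(1)] k' by blast
qed simp

lemma mod_n: "Suc i mod n < n"
  by (rule mod_less_divisor) (use n3 in linarith)

lemma rim_mem: "i < n \<Longrightarrow> k < n \<Longrightarrow> cs ! i \<in> rim k \<longleftrightarrow> k = i \<or> i = Suc k mod n"
  unfolding rim_def using nth_eq[of i k] nth_eq[of i "Suc k mod n"] mod_n[of k] by auto

lemma inc_rim: "i < n \<Longrightarrow> inc C (cs ! i) = rim ` {k. k < n \<and> (k = i \<or> i = Suc k mod n)}"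
  unfolding inc_def C_rim using rim_mem by auto

lemma inc_C:
  assumes "0 < i" "i < n"
  shows "inc C (cs ! i) = {rim (i - 1), rim i}"
proof -
  have "k < n \<and> (k = i \<or> i = Suc k mod n) \<longleftrightarrow> k = i - 1 \<or> k = i" for k
  proof (cases "Suc k < n")
    case True
    then show ?thesis using assms by auto
  next
    case False
    then have "k < n \<Longrightarrow> Suc k = n" by linarith
    then show ?thesis using assms by auto
  qed
  then have "{k. k < n \<and> (k = i \<or> i = Suc k mod n)} = {i - 1, i}" by auto
  then show ?thesis using inc_rim[OF assms(2)] by simp
qed

lemma inc_C_root: "inc C root = {rim 0, rim (n - 1)}"
proof -
  have "k < n \<and> (k = 0 \<or> 0 = Suc k mod n) \<longleftrightarrow> k = 0 \<or> k = n - 1" for k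
  proof (cases "Suc k < n")
    case True
    then show ?thesis using n3 by auto
  next
    case False
    then have "k < n \<Longrightarrow> Suc k = n" by linarith
    then show ?thesis using n3 by auto
  qed
  then have "{k. k < n \<and> (k = 0 \<or> 0 = Suc k mod n)} = {0, n - 1}" by auto
  moreover have "0 < n" using n3 by linarith
  ultimately show ?thesis using inc_rim[of 0] by simp
qed

lemma inc_E: "inc E v = inc T v \<union> inc C v"
  unfolding inc_def by auto

lemma leaf_edge:
  assumes "v \<in> leaves V T" "{u, v} \<in> T"
  shows "inc T v = {{u, v}}"
proof -
  have "card (inc T v) = 1" using assms(1) unfolding leaves_def vdeg by simp
  moreover have "{u, v} \<in> inc T v" using assms(2) unfolding inc_def by simp
  ultimately show ?thesis by (metis card_1_singletonE singletonD)
qed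

text \<open>A leaf that lies on an edge common to the tree and the cycle would only have the two cycle edges, not three edges.\<close>

lemma tree_cycle_disjoint: "T \<inter> C = {}"
proof (rule ccontr)
  assume "T \<inter> C \<noteq> {}"
  then obtain e where e: "e \<in> T" "e \<in> C" by blast
  then obtain k where k: "k < n" "e = rim k" unfolding C_rim by blast
  define v where "v = cs ! k"
  have ve: "v \<in> e" unfolding v_def k(2) rim_def by simp
  have v: "v \<in> leaves V T" unfolding v_def using cycle(3) k(1) nth_mem by blast
  obtain u where "e = {v, u}" using edge_split ve e by blast
  then have "{u, v} = e" by (simp add: insert_commute)
  then have "inc T v = {e}" using leaf_edge[OF v] e(1) by metis
  moreover have "e \<in> inc C v" using e(2) ve unfolding inc_def by simp
  ultimately have "inc E v = inc C v" unfolding inc_E by (simp add: insert_absorb)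
  moreover have "\<exists>a b. inc C v = {a, b}"
    unfolding v_def using inc_C[of k] inc_C_root k(1) by (cases "k = 0") auto
  ultimately obtain a b where ab: "inc E v = {a, b}" by metis
  have "card {a, b} \<le> 2" by (simp add: card_insert_if)
  moreover have "v \<in> V" using v unfolding leaves_def by simp
  ultimately show False using card_inc[of v] unfolding ab by simp
qed

lemma inner_edges:
  assumes "v \<in> V" "v \<notin> leaves V T"
  shows "inc E v = inc T v"
proof -
  have "3 \<le> card (inc T v)" using inner assms unfolding vdeg by blast
  moreover have "finite (inc E v)" unfolding inc_def using finite_E by simp
  ultimately show ?thesis
    using card_seteq[of "inc E v" "inc T v"] card_inc[OF assms(1)] unfolding inc_E by simp
qed

text \<open>One of the two components of the tree without the edge \<open>{u, v}\<close>, the one that contains \<open>v\<close>.\<close>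

definition side :: "'a set \<Rightarrow> 'a \<Rightarrow> 'a \<Rightarrow> bool" where
  "side X v u \<longleftrightarrow> X \<subseteq> V \<and> v \<in> X \<and> u \<in> V - X \<and> {u, v} \<in> T \<and>
     (\<forall>x\<in>X. joined T X v x) \<and> (\<forall>x\<in>V - X. joined T (V - X) u x) \<and>
     (\<forall>x\<in>X. \<forall>y\<in>V - X. {x, y} \<in> T \<longrightarrow> x = v \<and> y = u)"

text \<open>Removing \<open>v\<close> from its side leaves the components of its two children \<open>w1\<close>, \<open>w2\<close>; they are
  different, since a path from \<open>w1\<close> to \<open>w2\<close> that avoids \<open>v\<close> would close up to a cycle through \<open>v\<close>.\<close>

lemma side_subtree:
  assumes X: "side X v u" and v: "inc E v = {{u, v}, {v, w1}, {v, w2}}" "v \<notin> leaves V T"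
    and w: "w1 \<noteq> w2" "w1 \<in> X - {v}" "w2 \<in> X - {v}" "{v, w1} \<in> T" "{v, w2} \<in> T"
  defines "X1 \<equiv> {x. joined T (X - {v}) w1 x}" and "X2 \<equiv> {x. joined T (X - {v}) w2 x}"
  shows "X = insert v (X1 \<union> X2)" "X1 \<inter> X2 = {}" "side X1 w1 v" "X1 \<subseteq> X - {v}"
proof -
  have XV: "X \<subseteq> V" "v \<in> X" "u \<in> V" "u \<notin> X" "{u, v} \<in> T"
    and jX: "\<And>x. x \<in> X \<Longrightarrow> joined T X v x" and jV: "\<And>x. x \<in> V - X \<Longrightarrow> joined T (V - X) u x"
    and cross: "\<And>x y. x \<in> X \<Longrightarrow> y \<in> V - X \<Longrightarrow> {x, y} \<in> T \<Longrightarrow> x = v \<and> y = u"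
    using X unfolding side_def by auto
  have sub: "X1 \<subseteq> X - {v}" "X2 \<subseteq> X - {v}" unfolding X1_def X2_def using joined_in w by fast+
  then show "X1 \<subseteq> X - {v}" by simp
  have wX: "w1 \<in> X1" "w2 \<in> X2" unfolding X1_def X2_def by simp_all
  have nbr: "y \<in> {u, w1, w2}" if "{v, y} \<in> T" for y
  proof -
    have "{v, y} \<in> inc E v" using that unfolding inc_def by simp
    then show ?thesis unfolding v(1) by (auto simp: doubleton_eq_iff)
  qed
  show disj: "X1 \<inter> X2 = {}"
  proof (rule ccontr)
    assume "X1 \<inter> X2 \<noteq> {}"
    then have "joined T (X - {v}) w1 w2" unfolding X1_def X2_def using joined_sym joined_trans by fast
    then obtain vs where vs: "graph_path T vs" "set vs \<subseteq> X - {v}" "hd vs = w1" "last vs = w2"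
      using joined_path w(2) by metis
    obtain a vs' where a: "vs = a # vs'" using vs(1) unfolding graph_path_def by (cases vs) auto
    then have vs': "vs' \<noteq> []" using vs w(1) by auto
    have last: "vs = butlast vs @ [w2]" using vs(4) a append_butlast_last_id[of vs] by simp
    have "path_edges (vs @ [v]) = path_edges vs \<union> {{w2, v}}"
      using path_edges_append[of "butlast vs" w2 "[v]"] unfolding last[symmetric]
      by (subst last) simp
    then have "path_edges (v # vs @ [v]) = {{v, w1}, {w2, v}} \<union> path_edges vs"
      using a vs(3) by auto
    moreover have "{w2, v} \<in> T" using w(5) by (simp add: insert_commute)
    ultimately have "path_edges (v # vs @ [v]) \<subseteq> T" using w(4) vs(1) unfolding graph_path_def by simp
    then have "graph_cycle T (v # vs)"
      unfolding graph_cycle_def cycle_edges_def using vs a vs' unfolding graph_path_def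
      by (cases vs') auto
    then show False using tree unfolding tree_graph_def by blast
  qed
  show Xeq: "X = insert v (X1 \<union> X2)"
  proof (intro equalityI subsetI)
    fix x assume x: "x \<in> X"
    obtain vs where vs: "graph_path T vs" "set vs \<subseteq> X" "hd vs = v" "last vs = x"
      using joined_path[OF jX[OF x] XV(2)] by blast
    show "x \<in> insert v (X1 \<union> X2)"
    proof (cases "x = v")
      case False
      then obtain y zs where s: "vs = v # y # zs"
        using vs unfolding graph_path_def by (cases vs rule: remdups_adj.cases) auto
      have vy: "{v, y} \<in> T" "path_edges (y # zs) \<subseteq> T" "set (y # zs) \<subseteq> X - {v}"
        using vs(1,2) unfolding s graph_path_def by auto
      have "y = w1 \<or> y = w2" using nbr[OF vy(1)] vy(3) XV(4) by auto
      moreover have "joined T (X - {v}) y x" using path_joined[OF vy(2,3)] vs(4) unfolding s by simp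
      ultimately show ?thesis unfolding X1_def X2_def by auto
    qed simp
  qed (use sub XV(2) in blast)
  have closed: "y \<in> X1" if "x \<in> X1" "{x, y} \<in> T" "y \<in> X - {v}" for x y
  proof -
    have "joined T (X - {v}) x y" using that sub(1) by (intro joined_edge) auto
    then show ?thesis using that(1) joined_trans unfolding X1_def by fast
  qed
  \<comment> \<open>The component of \<open>w\<close> is connected inside itself: every vertex on the way belongs to it.\<close>
  have within: "joined T X' w x" if "joined T (X - {v}) w x" "X' = {x. joined T (X - {v}) w x}" "w \<in> X - {v}" for X' w x
    using that(1) unfolding joined_def[of T "X - {v}"]
  proof (induction rule: rtranclp_induct)
    case (step y z)
    have y: "joined T (X - {v}) w y" using step.hyps(1) unfolding joined_def .
    moreover have "joined T (X - {v}) y z" using step.hyps(2) by (intro joined_edge) auto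
    ultimately have "y \<in> X'" "z \<in> X'" unfolding that(2) using joined_trans by fast+
    then have "joined T X' y z" using step.hyps(2) by (intro joined_edge) auto
    then show ?case using step.IH joined_trans by fast
  qed simp
  show "side X1 w1 v"
    unfolding side_def
  proof (intro conjI ballI impI)
    show "X1 \<subseteq> V" "w1 \<in> X1" "v \<in> V - X1" "{v, w1} \<in> T" using sub XV wX w by auto
    show "joined T X1 w1 x" if "x \<in> X1" for x
      using within[of w1 x X1] that w(2) unfolding X1_def by simp
    have step_u: "joined T (V - X1) v u" using XV sub by (intro joined_edge) (auto simp: insert_commute)
    have step_w2: "joined T (V - X1) v w2" using XV sub wX disj w(5) by (intro joined_edge) auto
    show "joined T (V - X1) v x" if x: "x \<in> V - X1" for x
    proof -
      consider "x \<in> V - X" | "x = v" | "x \<in> X2" using x Xeq by blast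
      then show ?thesis
      proof cases
        case 1
        have "joined T (V - X1) u x" by (rule joined_mono[OF jV[OF 1]]) (use sub in blast)
        then show ?thesis using step_u joined_trans by fast
      next
        case 3
        then have "joined T X2 w2 x" using within[of w2 x X2] w(3) unfolding X2_def by simp
        then have "joined T (V - X1) w2 x" by (rule joined_mono) (use sub XV disj in blast)
        then show ?thesis using step_w2 joined_trans by fast
      qed simp
    qed
    fix x y assume x: "x \<in> X1" and y: "y \<in> V - X1" and xy: "{x, y} \<in> T"
    have "y \<in> X" using cross[of x y] x y xy sub by blast
    moreover have "y \<notin> X - {v}" using closed[OF x xy] y by blast
    ultimately show yv: "y = v" by blast
    then have "{v, x} \<in> T" using xy by (simp add: insert_commute)
    then show "x = w1" using nbr[of x] x sub XV wX disj by auto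
  qed
qed

end

text \<open>All that the argument retains of planarity.\<close>

locale noncrossing_tree_cycle = cubic_tree_cycle +
  assumes noncrossing: "\<And>a S1 b S2 c S3 d S4 P Q. \<lbrakk>cs = a # S1 @ b # S2 @ c # S3 @ d # S4;
      graph_path T P; hd P = a; last P = c; graph_path T Q; hd Q = b; last Q = d\<rbrakk> \<Longrightarrow> set P \<inter> set Q \<noteq> {}"
begin

text \<open>The path from the root to \<open>cs ! k\<close> outside \<open>X\<close> would have to cross the path from \<open>cs ! i\<close> to \<open>cs ! j\<close> inside \<open>X\<close>.\<close>

lemma noncrossing_index:
  assumes "0 < i" "i < k" "k < j" "j < n" and X: "root \<notin> X" "cs ! i \<in> X" "cs ! j \<in> X" "cs ! k \<notin> X"
    and jX: "joined T X (cs ! i) (cs ! j)" and jV: "joined T (V - X) root (cs ! k)"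
  shows False
proof -
  have root: "root \<in> V - X" using X cycle(3) n3 unfolding leaves_def
    by (metis (no_types, lifting) DiffI assms(1-4) dual_order.strict_trans mem_Collect_eq nth_mem)
  obtain P where P: "graph_path T P" "set P \<subseteq> V - X" "hd P = root" "last P = cs ! k"
    using joined_path[OF jV root] by blast
  obtain Q where Q: "graph_path T Q" "set Q \<subseteq> X" "hd Q = cs ! i" "last Q = cs ! j"
    using joined_path[OF jX X(2)] by blast
  have "cs = cs ! 0 # take (i - 1) (drop 1 cs) @ cs ! i # take (k - i - 1) (drop (Suc i) cs) @
      cs ! k # take (j - k - 1) (drop (Suc k) cs) @ cs ! j # drop (Suc j) cs"
  proof -
    have d: "drop a cs = take (b - a) (drop a cs) @ cs ! b # drop (Suc b) cs" if "a \<le> b" "b < n" for a b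
    proof -
      have "drop (b - a) (drop a cs) = cs ! b # drop (Suc b) cs"
        using that by (simp add: Cons_nth_drop_Suc)
      then show ?thesis using append_take_drop_id[of "b - a" "drop a cs"] by simp
    qed
    have "drop (Suc k) cs = take (j - k - 1) (drop (Suc k) cs) @ cs ! j # drop (Suc j) cs"
      using d[of "Suc k" j] assms(3,4) by simp
    note sk = this[symmetric]
    have "drop (Suc i) cs = take (k - i - 1) (drop (Suc i) cs) @ cs ! k # drop (Suc k) cs"
      using d[of "Suc i" k] assms(2-4) by simp
    note si = this[symmetric]
    have "drop 1 cs = take (i - 1) (drop 1 cs) @ cs ! i # drop (Suc i) cs"
      using d[of 1 i] assms(1-4) by simp
    note s1 = this[symmetric]
    show ?thesis unfolding sk si s1 using assms(4) by (cases cs) simp_all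
  qed
  from noncrossing[OF this P(1,3,4) Q(1,3,4)] show False using P(2) Q(2) by blast
qed

text \<open>The leaves of the two subtrees occupy two disjoint intervals of the cycle. A leaf in the gap between them would lie outside \<open>X\<close>, which is
  excluded by noncrossing, so the intervals are adjacent and the cycle edge between them is the one shared by
  the two pieces.\<close>

lemma side_part_node:
  assumes X: "side X v u" "root \<notin> X" and v: "inc E v = {{u, v}, {v, w1}, {v, w2}}" "v \<notin> leaves V T"
    and X12: "X = insert v (X1 \<union> X2)" "X1 \<inter> X2 = {}" "v \<notin> X1" "v \<notin> X2" "side X1 w1 v"
    and P1: "part E X1 {v, w1} (rim (i1 - 1)) (rim j1)" "X1 \<inter> leaves V T = (!) cs ` {i1..j1}"
    and P2: "part E X2 {v, w2} (rim (i2 - 1)) (rim j2)" "X2 \<inter> leaves V T = (!) cs ` {i2..j2}"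
    and ij: "0 < i1" "i1 \<le> j1" "j1 < i2" "i2 \<le> j2" "j2 < n"
  shows "part E X {u, v} (rim (i1 - 1)) (rim j2) \<and> X \<inter> leaves V T = (!) cs ` {i1..j2}"
proof -
  have jX: "\<And>x. x \<in> X \<Longrightarrow> joined T X v x" and jV: "\<And>x. x \<in> V - X \<Longrightarrow> joined T (V - X) u x"
    and u: "u \<notin> X"
    using X unfolding side_def by auto
  have leafX: "X \<inter> leaves V T = (!) cs ` ({i1..j1} \<union> {i2..j2})"
    unfolding image_Un P1(2)[symmetric] P2(2)[symmetric] using X12(1) v(2) by blast
  have cs_leaf: "cs ! k \<in> leaves V T" if "k < n" for k using cycle(3) that nth_mem by blast
  have inX: "cs ! k \<in> X \<longleftrightarrow> k \<in> {i1..j1} \<union> {i2..j2}" if "k < n" for k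
  proof -
    have "cs ! k \<in> X \<longleftrightarrow> cs ! k \<in> (!) cs ` ({i1..j1} \<union> {i2..j2})" unfolding leafX[symmetric] using cs_leaf[OF that] by simp
    also have "\<dots> \<longleftrightarrow> k \<in> {i1..j1} \<union> {i2..j2}"
      by (rule nth_image[OF that]) (use ij in auto)
    finally show ?thesis .
  qed
  have consecutive: "i2 = Suc j1"
  proof (rule ccontr)
    assume "i2 \<noteq> Suc j1"
    then have k: "j1 < Suc j1" "Suc j1 < i2" "i2 < n" "0 < j1" "Suc j1 < n" "j1 < n" using ij by auto
    have "0 < n" using n3 by linarith
    then have rV: "root \<in> V - X" using cs_leaf[of 0] X(2) unfolding leaves_def by blast
    have kX: "cs ! Suc j1 \<notin> X" "cs ! j1 \<in> X" "cs ! i2 \<in> X" using inX k ij by auto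
    then have "cs ! Suc j1 \<in> V - X" using cs_leaf[OF k(5)] unfolding leaves_def by auto
    then show False
      using noncrossing_index[OF k(4,1,2,3) X(2) kX(2,3,1)] joined_same[OF jX jX] joined_same[OF jV jV] kX rV
      by blast
  qed
  have inX1: "k \<in> {i1..j1}" if "cs ! k \<in> X1" "k < n" for k
  proof -
    have "cs ! k \<in> (!) cs ` {i1..j1}" unfolding P1(2)[symmetric] using cs_leaf that by blast
    moreover have "{i1..j1} \<subseteq> {..<n}" using ij by auto
    ultimately show ?thesis using nth_image[OF that(2)] by blast
  qed
  have inX2: "k \<in> {i2..j2}" if "cs ! k \<in> X2" "k < n" for k
  proof -
    have "cs ! k \<in> (!) cs ` {i2..j2}" unfolding P2(2)[symmetric] using cs_leaf that by blast
    moreover have "{i2..j2} \<subseteq> {..<n}" using ij by auto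
    ultimately show ?thesis using nth_image[OF that(2)] by blast
  qed
  have jn: "Suc j1 < n" using ij consecutive by simp
  have rimj: "rim j1 = {cs ! j1, cs ! Suc j1}" unfolding rim_def using jn by simp
  have j1X: "cs ! j1 \<in> X1" "cs ! Suc j1 \<in> X2"
    using P1(2) P2(2) ij consecutive by force+
  have "rim j1 \<in> E" unfolding C_rim using jn by auto
  then have m1: "rim j1 \<in> touching E X1 \<inter> touching E X2"
    using j1X unfolding touching_def rimj by auto
  have m2: "e = rim j1" if e: "e \<in> touching E X1" "e \<in> touching E X2" for e
  proof -
    obtain x y where xy: "x \<in> e" "x \<in> X1" "y \<in> e" "y \<in> X2" "e \<in> E" using e unfolding touching_def by blast
    have ne: "x \<noteq> y" using xy X12(2) by blast
    then have exy: "e = {x, y}" using edge_split[OF xy(5,1)] xy(3) by auto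
    have "y \<in> V - X1" using xy X12(2) sub_V[OF xy(5)] by blast
    then have "e \<notin> T" using X12(4,5) xy(2,4) unfolding side_def exy by blast
    then obtain k where k: "k < n" "e = rim k" using xy(5) unfolding C_rim by blast
    show ?thesis
    proof (cases "Suc k < n")
      case True
      then have "{x, y} = {cs ! k, cs ! Suc k}" using k(2) exy unfolding rim_def by simp
      then have "x = cs ! k \<and> y = cs ! Suc k \<or> x = cs ! Suc k \<and> y = cs ! k" by (auto simp: doubleton_eq_iff)
      then have "k \<in> {i1..j1} \<and> Suc k \<in> {i2..j2} \<or> Suc k \<in> {i1..j1} \<and> k \<in> {i2..j2}"
        using inX1 inX2 xy True k(1) by blast
      then have "k = j1" using consecutive by auto
      then show ?thesis using k by simp
    next
      case False
      then have "Suc k = n" using k(1) by simp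
      then have "root \<in> e" using k(2) unfolding rim_def by simp
      then have "root \<in> X1 \<union> X2" using exy xy by blast
      then show ?thesis using X(2) X12(1) by blast
    qed
  qed
  have "part E (insert v (X1 \<union> X2)) {u, v} (rim (i1 - 1)) (rim j2)"
  proof (rule part.node[OF P1(1)])
    show "part E X2 {v, w2} (rim j1) (rim j2)" using P2(1) unfolding consecutive by simp
    show "touching E X1 \<inter> touching E X2 = {rim j1}" using m1 m2 by blast
    show "{u, v} \<inter> (X1 \<union> X2) = {}" using u X12 by blast
  qed (fact X12 v(1))+
  moreover have "{i1..j1} \<union> {i2..j2} = {i1..j2}" using consecutive ij by auto
  ultimately show ?thesis using leafX X12(1) by simp
qed

text \<open>The index \<open>0\<close> belongs to the root. Because the root is outside \<open>X\<close>, the leaves of \<open>X\<close> form a genuine interval of indices and the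
  cyclic order causes no wrap-around.\<close>

lemma side_part:
  assumes "side X v u" "root \<notin> X"
  shows "\<exists>i j. 0 < i \<and> i \<le> j \<and> j < n \<and> X \<inter> leaves V T = (!) cs ` {i..j} \<and>
    part E X {u, v} (rim (i - 1)) (rim j)"
  using assms
proof (induction "card X" arbitrary: X v u rule: less_induct)
  case less
  have X: "X \<subseteq> V" "v \<in> X" "u \<in> V - X" "{u, v} \<in> T" and jX: "\<And>x. x \<in> X \<Longrightarrow> joined T X v x"
    and cross: "\<And>x y. x \<in> X \<Longrightarrow> y \<in> V - X \<Longrightarrow> {x, y} \<in> T \<Longrightarrow> x = v \<and> y = u"
    using less.prems(1) unfolding side_def by blast+
  show ?case
  proof (cases "v \<in> leaves V T")
    case True
    note incT = leaf_edge[OF True X(4)]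
    have Xv: "X = {v}"
    proof (rule ccontr)
      assume "X \<noteq> {v}"
      then obtain x where x: "x \<in> X" "x \<noteq> v" using X(2) by blast
      have "joined T X v x" using jX x by blast
      then obtain y where "{v, y} \<in> T" "y \<in> X" using x(2)
        unfolding joined_def by (metis (no_types, lifting) converse_rtranclpE)
      then have "{v, y} \<in> inc T v" unfolding inc_def by simp
      then have "y = u" unfolding incT by (auto simp: doubleton_eq_iff)
      then show False using \<open>y \<in> X\<close> X(3) by blast
    qed
    obtain i where i: "i < n" "v = cs ! i" using True cycle(3) by (metis in_set_conv_nth)
    have i0: "0 < i" using less.prems(2) X(2) i by (cases i) auto
    have iE: "inc E v = {{u, v}, rim (i - 1), rim i}"
      unfolding inc_E incT unfolding i(2) inc_C[OF i0 i(1)] by (rule insert_is_Un[symmetric])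
    have "card (inc E v) = 3" using card_inc X by blast
    then have d: "{u, v} \<noteq> rim (i - 1)" "{u, v} \<noteq> rim i" "rim (i - 1) \<noteq> rim i"
      unfolding iE by (auto simp: card_insert_if split: if_splits)
    have "part E X {u, v} (rim (i - 1)) (rim i)"
      unfolding Xv by (rule part.leaf[OF iE d])
    moreover have "X \<inter> leaves V T = (!) cs ` {i..i}" using Xv True i(2) by simp
    ultimately show ?thesis using i0 i(1) by blast
  next
    case False
    have vV: "v \<in> V" using X by blast
    note incT = inner_edges[OF vV False]
    have uv: "{u, v} \<in> inc E v" using X(4) unfolding inc_def by simp
    have c3: "card (inc E v) = 3" using card_inc[OF vV] .
    then have "card (inc E v - {{u, v}}) = 2" using uv by (simp add: card_Diff_singleton_if)
    then obtain e1 e2 where e: "inc E v - {{u, v}} = {e1, e2}" "e1 \<noteq> e2" by (auto simp: card_2_iff)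
    then have e12: "e1 \<in> inc T v" "e2 \<in> inc T v" "e1 \<noteq> {u, v}" "e2 \<noteq> {u, v}"
      unfolding incT[symmetric] by blast+
    obtain w1 where w1: "w1 \<noteq> v" "e1 = {v, w1}" using edge_split[of e1 v] e12(1) unfolding inc_def by blast
    obtain w2 where w2: "w2 \<noteq> v" "e2 = {v, w2}" using edge_split[of e2 v] e12(2) unfolding inc_def by blast
    have iE: "inc E v = {{u, v}, {v, w1}, {v, w2}}" using e(1) uv w1 w2 by blast
    then have iE': "inc E v = {{u, v}, {v, w2}, {v, w1}}" by blast
    have w12: "w1 \<noteq> w2" "w2 \<noteq> w1" using e(2) w1 w2 by blast+
    have wT: "{v, w1} \<in> T" "{v, w2} \<in> T" using e12 w1 w2 unfolding inc_def by blast+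
    have wX: "w1 \<in> X - {v}" "w2 \<in> X - {v}"
    proof -
      have "w1 \<in> V" "w2 \<in> V" using sub_V wT by blast+
      moreover have "w1 \<noteq> u" "w2 \<noteq> u" using e12 w1 w2 by (auto simp: insert_commute)
      ultimately show "w1 \<in> X - {v}" "w2 \<in> X - {v}"
        using cross[OF X(2) _ wT(1)] cross[OF X(2) _ wT(2)] w1 w2 by blast+
    qed
    define X1 where "X1 = {x. joined T (X - {v}) w1 x}"
    define X2 where "X2 = {x. joined T (X - {v}) w2 x}"
    note s1 = side_subtree[OF less.prems(1) iE False w12(1) wX wT, folded X1_def X2_def]
    note s2 = side_subtree[OF less.prems(1) iE' False w12(2) wX(2,1) wT(2,1), folded X1_def X2_def]
    have fX: "finite X" using X(1) finite_V finite_subset by blast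
    have lt: "card X1 < card X" "card X2 < card X"
      using psubset_card_mono[OF fX] s1(4) s2(4) X(2) by blast+
    have nr: "root \<notin> X1" "root \<notin> X2" using s1(4) s2(4) less.prems(2) by blast+
    obtain i1 j1 where P1: "0 < i1" "i1 \<le> j1" "j1 < n" "X1 \<inter> leaves V T = (!) cs ` {i1..j1}"
      "part E X1 {v, w1} (rim (i1 - 1)) (rim j1)"
      using less.hyps[OF lt(1) s1(3) nr(1)] by blast
    obtain i2 j2 where P2: "0 < i2" "i2 \<le> j2" "j2 < n" "X2 \<inter> leaves V T = (!) cs ` {i2..j2}"
      "part E X2 {v, w2} (rim (i2 - 1)) (rim j2)"
      using less.hyps[OF lt(2) s2(3) nr(2)] by blast
    have nv: "v \<notin> X1" "v \<notin> X2" using s1(4) s2(4) by blast+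
    have "j1 < i2 \<or> j2 < i1"
    proof (rule ccontr)
      assume "\<not> (j1 < i2 \<or> j2 < i1)"
      then have "max i1 i2 \<in> {i1..j1} \<inter> {i2..j2}" using P1(2) P2(2) by auto
      then have "cs ! max i1 i2 \<in> X1 \<inter> X2" using P1(4) P2(4) by blast
      then show False using s1(2) by blast
    qed
    then show ?thesis
    proof
      assume "j1 < i2"
      from side_part_node[OF less.prems iE False s1(1,2) nv s1(3) P1(5,4) P2(5,4) P1(1,2) this P2(2,3)]
      show ?thesis using P1 P2 \<open>j1 < i2\<close> by (intro exI[of _ i1] exI[of _ j2]) simp
    next
      assume "j2 < i1"
      from side_part_node[OF less.prems iE' False s2(1,2) nv(2,1) s2(3) P2(5,4) P1(5,4) P2(1,2) this P1(2,3)]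
      show ?thesis using P1 P2 \<open>j2 < i1\<close> by (intro exI[of _ i2] exI[of _ j1]) simp
    qed
  qed
qed

lemma star_6_edge_coloring: "\<exists>f. star_edge_coloring E 6 f"
proof -
  have rl: "root \<in> leaves V T" using cycle(3) n3 nth_mem[of 0 cs] by fastforce
  then have rV: "root \<in> V" unfolding leaves_def by simp
  have "card (inc T root) = 1" using rl unfolding leaves_def vdeg by simp
  then obtain p where p: "inc T root = {p}" by (rule card_1_singletonE)
  then have "p \<in> T" "root \<in> p" unfolding inc_def by blast+
  then obtain v where v: "v \<noteq> root" "p = {root, v}" using edge_split by blast
  have vV: "v \<in> V" using sub_V \<open>p \<in> T\<close> v by blast
  have nbr: "y = v" if "{root, y} \<in> T" for y
  proof -
    have "{root, y} \<in> inc T root" using that unfolding inc_def by simp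
    then show ?thesis unfolding p v(2) by (auto simp: doubleton_eq_iff)
  qed
  define X where "X = V - {root}"
  have VX: "V - X = {root}" unfolding X_def using rV by blast
  have sX: "side X v root"
    unfolding side_def VX
  proof (intro conjI ballI impI)
    show "X \<subseteq> V" "v \<in> X" "root \<in> {root}" "{root, v} \<in> T"
      unfolding X_def using vV v \<open>p \<in> T\<close> by auto
    show "joined T {root} root x" if "x \<in> {root}" for x using that by simp
    show "joined T X v x" if x: "x \<in> X" for x
    proof -
      have xV: "x \<in> V" "x \<noteq> root" using x unfolding X_def by auto
      obtain vs where vs: "graph_path T vs" "hd vs = root" "last vs = x"
        using tree rV xV unfolding tree_graph_def graph_connected_def by blast
      obtain y zs where s: "vs = root # y # zs"
        using vs xV unfolding graph_path_def by (cases vs rule: remdups_adj.cases) auto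
      have e: "{root, y} \<in> T" "path_edges (y # zs) \<subseteq> T" "root \<notin> set (y # zs)"
        using vs(1) unfolding s graph_path_def by auto
      have "set (y # zs) \<subseteq> X"
      proof
        fix z assume z: "z \<in> set (y # zs)"
        then have z': "z \<in> set vs" "2 \<le> length vs" unfolding s by simp_all
        obtain e' where e': "e' \<in> path_edges vs" "z \<in> e'" using path_edges_cover[OF z'] by blast
        have "path_edges vs \<subseteq> T" using vs(1) unfolding graph_path_def by simp
        then have "e' \<subseteq> V" using e'(1) sub_V by blast
        moreover have "z \<noteq> root" using e(3) z by metis
        ultimately show "z \<in> X" using e'(2) unfolding X_def by blast
      qed
      then have "joined T X y (last (y # zs))" using path_joined[OF e(2)] by simp
      then show ?thesis using nbr[OF e(1)] vs(3) unfolding s by simp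
    qed
    fix x y assume "x \<in> X" "y \<in> {root}" "{x, y} \<in> T"
    then show "x = v" "y = root" using nbr[of x] by (simp_all add: insert_commute)
  qed
  have rX: "root \<notin> X" unfolding X_def by simp
  obtain i j where ij: "0 < i" "i \<le> j" "j < n" "X \<inter> leaves V T = (!) cs ` {i..j}"
    "part E X {root, v} (rim (i - 1)) (rim j)"
    using side_part[OF sX rX] by (elim exE conjE) (rule that)
  \<comment> \<open>Every leaf except the root lies in \<open>X\<close>, which forces the interval of its leaves to be \<open>{1..n - 1}\<close>.\<close>
  have in_ij: "k \<in> {i..j}" if "0 < k" "k < n" for k
  proof -
    have "0 < n" using n3 by linarith
    then have "cs ! k \<noteq> root" using nth_eq[of k 0] that by simp
    moreover have "cs ! k \<in> leaves V T" using cycle(3) that nth_mem by blast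
    ultimately have "cs ! k \<in> X \<inter> leaves V T" unfolding X_def leaves_def by blast
    then have "cs ! k \<in> (!) cs ` {i..j}" unfolding ij(4) .
    moreover have "{i..j} \<subseteq> {..<n}" using ij(3) by auto
    ultimately show ?thesis using nth_image[OF that(2)] by blast
  qed
  have "1 \<in> {i..j}" "n - 1 \<in> {i..j}" by (rule in_ij; use n3 in linarith)+
  then have "i = 1" "j = n - 1" using ij(1,3) unfolding atLeastAtMost_iff by linarith+
  then have part: "part E X p (rim 0) (rim (n - 1))" using ij(5) v(2) by simp
  have inc: "inc E root = {p, rim 0, rim (n - 1)}" unfolding inc_E p inc_C_root by (rule insert_is_Un[symmetric])
  have "cs ! 1 \<in> X" "cs ! 2 \<in> X" "cs ! 1 \<noteq> cs ! 2"
  proof -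
    have *: "cs ! k \<in> V" "cs ! k \<noteq> root" if "0 < k" "k < n" for k
    proof -
      have "cs ! k \<in> leaves V T" using cycle(3) nth_mem that(2) by blast
      then show "cs ! k \<in> V" unfolding leaves_def by simp
      have "0 < n" using n3 by linarith
      then show "cs ! k \<noteq> root" using nth_eq[OF that(2), of 0] that(1) by simp
    qed
    show "cs ! 1 \<in> X" "cs ! 2 \<in> X" using *[of 1] *[of 2] n3 unfolding X_def by auto
    show "cs ! 1 \<noteq> cs ! 2" using nth_eq[of 1 2] n3 by simp
  qed
  then have "\<nexists>v. X = {v}" by (metis singletonD)
  then show ?thesis
    using star_6_edge_coloring_of_part[OF card2 part rX inc] sub_V unfolding X_def by blast
qed

end

lemma halin_tree_cycle:
  assumes "halin_graph V T C \<gamma>" "regular_graph 3 V (T \<union> C)"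
  shows "\<exists>cs. noncrossing_tree_cycle V T C cs"
proof -
  obtain cs where cs: "graph_cycle C cs" "cycle_edges cs = C" "set cs = leaves V T"
    using assms(1) unfolding halin_graph_def by blast
  interpret cubic_tree_cycle V T C cs
  proof
    show "simple_graph V (T \<union> C)" "tree_graph V T"
      using assms(1) unfolding halin_graph_def plane_graph_def by blast+
    show "3 \<le> vdegree T v" if "v \<in> V - leaves V T" for v
      using assms(1) that unfolding halin_graph_def by blast
  qed (fact assms(2) cs)+
  have "noncrossing_tree_cycle V T C cs"
  proof
    fix a S1 b S2 c S3 d S4 P Q
    assume "cs = a # S1 @ b # S2 @ c # S3 @ d # S4"
      "graph_path T P" "hd P = a" "last P = c" "graph_path T Q" "hd Q = b" "last Q = d"
    then show "set P \<inter> set Q \<noteq> {}"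
      using halin_noncrossing[OF assms(1) tree_cycle_disjoint cs] by blast
  qed
  then show ?thesis by blast
qed

lemma halin_star_6_edge_coloring:
  assumes "halin_graph V T C \<gamma>" "regular_graph 3 V (T \<union> C)"
  shows "\<exists>f. star_edge_coloring (T \<union> C) 6 f"
proof -
  obtain cs where "noncrossing_tree_cycle V T C cs" using halin_tree_cycle[OF assms] by blast
  then interpret noncrossing_tree_cycle V T C cs .
  show ?thesis by (rule star_6_edge_coloring)
qed

lemma halin_bounds:
  assumes H: "halin_graph V T C \<gamma>" and R: "regular_graph 3 V (T \<union> C)"
  shows "4 \<le> star_chromatic_index (T \<union> C)" "star_chromatic_index (T \<union> C) \<le> 6"
proof -
  obtain cs where "noncrossing_tree_cycle V T C cs" using halin_tree_cycle[OF assms] by blast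
  then interpret noncrossing_tree_cycle V T C cs .
  have ex: "\<exists>f. star_edge_coloring (T \<union> C) 6 f" by (rule halin_star_6_edge_coloring[OF assms])
  then show "star_chromatic_index (T \<union> C) \<le> 6"
    unfolding star_chromatic_index_def by (rule Least_le)
  obtain f where f: "star_edge_coloring (T \<union> C) (star_chromatic_index (T \<union> C)) f"
    using LeastI[of "\<lambda>k. \<exists>f. star_edge_coloring (T \<union> C) k f", OF ex]
    unfolding star_chromatic_index_def by blast
  have "V \<noteq> {}" using tree unfolding tree_graph_def graph_connected_def by blast
  then show "4 \<le> star_chromatic_index (T \<union> C)"
    using no_star_3_edge_coloring[OF card2 sub_V cubic _ f] by blast
qed

section \<open>The prism has no star 5-edge-coloring\<close>

text \<open>The triangles of the prism have vertices \<open>a1, a2, a3\<close> and \<open>b1, b2, b3\<close>; \<open>t\<close> and \<open>s\<close> are the colors of the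
  triangle edges, numbered by the opposite vertex, and \<open>m\<close> those of the edges \<open>{ai, bi}\<close>. The rule collects the
  consequences of a star 5-edge-coloring that are needed for the index 1, with 2 and 3 in this order.\<close>

definition prism_rule ::
  "nat \<Rightarrow> nat \<Rightarrow> nat \<Rightarrow> nat \<Rightarrow> nat \<Rightarrow> nat \<Rightarrow> nat \<Rightarrow> nat \<Rightarrow> nat \<Rightarrow> bool" where
  "prism_rule t1 t2 t3 s1 s2 s3 m1 m2 m3 \<longleftrightarrow> t1 < 5 \<and> s1 < 5 \<and> m1 < 5 \<and>
     t1 \<noteq> t2 \<and> s1 \<noteq> s2 \<and> m1 \<noteq> t2 \<and> m1 \<noteq> s2 \<and> \<not> (m1 = t1 \<and> m2 = t2) \<and> \<not> (m1 = s1 \<and> m2 = s2) \<and>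
     (m1 = t1 \<or> m1 = m2 \<longrightarrow> t3 \<noteq> s2 \<and> t3 \<noteq> s3) \<and> (m1 = s1 \<or> m1 = m2 \<longrightarrow> s3 \<noteq> t2 \<and> s3 \<noteq> t3)"

definition prism_colors ::
  "nat \<Rightarrow> nat \<Rightarrow> nat \<Rightarrow> nat \<Rightarrow> nat \<Rightarrow> nat \<Rightarrow> nat \<Rightarrow> nat \<Rightarrow> nat \<Rightarrow> bool" where
  "prism_colors t1 t2 t3 s1 s2 s3 m1 m2 m3 \<longleftrightarrow>
     prism_rule t1 t2 t3 s1 s2 s3 m1 m2 m3 \<and> prism_rule t1 t3 t2 s1 s3 s2 m1 m3 m2 \<and>
     prism_rule t2 t1 t3 s2 s1 s3 m2 m1 m3 \<and> prism_rule t2 t3 t1 s2 s3 s1 m2 m3 m1 \<and>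
     prism_rule t3 t1 t2 s3 s1 s2 m3 m1 m2 \<and> prism_rule t3 t2 t1 s3 s2 s1 m3 m2 m1"

lemma prism_colors_rotate:
  "prism_colors t1 t2 t3 s1 s2 s3 m1 m2 m3 \<Longrightarrow> prism_colors t2 t3 t1 s2 s3 s1 m2 m3 m1"
  unfolding prism_colors_def by simp

lemma five_colors:
  fixes a b c d e x :: nat
  assumes "distinct [a, b, c, d, e]" "{a, b, c, d, e} \<subseteq> {..<5}" "x < 5"
  shows "x = a \<or> x = b \<or> x = c \<or> x = d \<or> x = e"
proof -
  have "card {a, b, c, d, e} = 5" using distinct_card[OF assms(1)] by simp
  then have "{a, b, c, d, e} = {..<5}" using card_subset_eq[OF _ assms(2)] by simp
  then show ?thesis using assms(3) by blast
qed

lemma prism_ruleD: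
  assumes "prism_rule t1 t2 t3 s1 s2 s3 m1 m2 m3"
  shows "m1 = t1 \<Longrightarrow> m2 \<noteq> t2" "m1 = s1 \<Longrightarrow> m2 \<noteq> s2"
    and "m1 = t1 \<or> m1 = m2 \<Longrightarrow> t3 \<noteq> s2" "m1 = t1 \<or> m1 = m2 \<Longrightarrow> t3 \<noteq> s3"
    and "m1 = s1 \<or> m1 = m2 \<Longrightarrow> s3 \<noteq> t2" "m1 = s1 \<or> m1 = m2 \<Longrightarrow> s3 \<noteq> t3"
    and "t1 < 5" "s1 < 5" "m1 < 5" "t1 \<noteq> t2" "s1 \<noteq> s2" "m1 \<noteq> t2" "m1 \<noteq> s2"
  using assms unfolding prism_rule_def by simp_all

lemma prism_colorsD:
  assumes "prism_colors t1 t2 t3 s1 s2 s3 m1 m2 m3"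
  shows "t1 < 5" "t2 < 5" "t3 < 5" "s1 < 5" "s2 < 5" "s3 < 5" "m1 < 5" "m2 < 5" "m3 < 5"
    and "t1 \<noteq> t2" "t1 \<noteq> t3" "t2 \<noteq> t3" "s1 \<noteq> s2" "s1 \<noteq> s3" "s2 \<noteq> s3"
    and "m1 \<noteq> t2" "m1 \<noteq> t3" "m2 \<noteq> t1" "m2 \<noteq> t3" "m3 \<noteq> t1" "m3 \<noteq> t2"
    and "m1 \<noteq> s2" "m1 \<noteq> s3" "m2 \<noteq> s1" "m2 \<noteq> s3" "m3 \<noteq> s1" "m3 \<noteq> s2"
proof -
  note P = assms[unfolded prism_colors_def]
  note R = P[THEN conjunct1] P[THEN conjunct2, THEN conjunct1] P[THEN conjunct2, THEN conjunct2, THEN conjunct1]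
    P[THEN conjunct2, THEN conjunct2, THEN conjunct2, THEN conjunct1]
    P[THEN conjunct2, THEN conjunct2, THEN conjunct2, THEN conjunct2, THEN conjunct1]
    P[THEN conjunct2, THEN conjunct2, THEN conjunct2, THEN conjunct2, THEN conjunct2]
  show "t1 < 5" "t2 < 5" "t3 < 5" "s1 < 5" "s2 < 5" "s3 < 5" "m1 < 5" "m2 < 5" "m3 < 5"
    "t1 \<noteq> t2" "t1 \<noteq> t3" "t2 \<noteq> t3" "s1 \<noteq> s2" "s1 \<noteq> s3" "s2 \<noteq> s3"
    "m1 \<noteq> t2" "m1 \<noteq> t3" "m2 \<noteq> t1" "m2 \<noteq> t3" "m3 \<noteq> t1" "m3 \<noteq> t2"
    "m1 \<noteq> s2" "m1 \<noteq> s3" "m2 \<noteq> s1" "m2 \<noteq> s3" "m3 \<noteq> s1" "m3 \<noteq> s2"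
    by (fact R[THEN prism_ruleD(7)] R[THEN prism_ruleD(8)] R[THEN prism_ruleD(9)] R[THEN prism_ruleD(10)]
      R[THEN prism_ruleD(11)] R[THEN prism_ruleD(12)] R[THEN prism_ruleD(13)])+
qed

text \<open>If \<open>m1 = m2\<close>, then \<open>t3\<close> is different from all \<open>s\<close> and \<open>s3\<close> from all \<open>t\<close>, so \<open>t1, t2, t3, s3, m1\<close> are all five
  colors and \<open>{s1, s2} = {t1, t2}\<close>. For \<open>m3\<close> only \<open>t3\<close>, \<open>s3\<close> and \<open>m1\<close> remain, and each of them is ruled out.\<close>

lemma prism_rungs_differ:
  assumes P: "prism_colors t1 t2 t3 s1 s2 s3 m1 m2 m3"
  shows "m1 \<noteq> m2"
proof
  assume eq: "m1 = m2"
  note D = prism_colorsD[OF P]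
  have R: "prism_rule t1 t2 t3 s1 s2 s3 m1 m2 m3" "prism_rule t2 t1 t3 s2 s1 s3 m2 m1 m3"
    "prism_rule t3 t1 t2 s3 s1 s2 m3 m1 m2"
    using P unfolding prism_colors_def by simp_all
  have t3: "t3 \<noteq> s2" "t3 \<noteq> s3" "t3 \<noteq> s1" and s3: "s3 \<noteq> t2" "s3 \<noteq> t1"
    using prism_ruleD(3-6)[OF R(1)] prism_ruleD(3-6)[OF R(2)] eq by simp_all
  have base: "distinct [t1, t2, t3, s3, m1]" "{t1, t2, t3, s3, m1} \<subseteq> {..<5}"
    using D(1-19,23) t3 s3 eq by auto
  have "s1 = t1 \<or> s1 = t2" using five_colors[OF base, of s1] D t3 eq by auto
  moreover have "s2 = t1 \<or> s2 = t2" using five_colors[OF base, of s2] D t3 eq by auto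
  ultimately have s: "s1 = t1 \<and> s2 = t2 \<or> s1 = t2 \<and> s2 = t1" using D(13) by auto
  have "m3 = t3 \<or> m3 = s3 \<or> m3 = m1" using five_colors[OF base, of m3] D by auto
  then show False using s prism_ruleD(3-6)[OF R(3)] by auto
qed

text \<open>If \<open>m1 = t1\<close>, then the five colors are \<open>t1, t2, t3, m2, m3\<close>, and \<open>s2\<close> and \<open>s3\<close> are forced to be \<open>m2\<close> and \<open>m3\<close>; this
  gives a bicolored path through the other triangle.\<close>

lemma prism_rungs_not_matching:
  assumes P: "prism_colors t1 t2 t3 s1 s2 s3 m1 m2 m3" and md: "m2 \<noteq> m3"
  shows "m1 \<noteq> t1"
proof
  assume eq: "m1 = t1"
  note D = prism_colorsD[OF P]
  have R: "prism_rule t1 t2 t3 s1 s2 s3 m1 m2 m3" "prism_rule t1 t3 t2 s1 s3 s2 m1 m3 m2"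
    "prism_rule t2 t3 t1 s2 s3 s1 m2 m3 m1"
    using P unfolding prism_colors_def by simp_all
  have m: "m2 \<noteq> t2" "m3 \<noteq> t3" and t: "t3 \<noteq> s2" "t3 \<noteq> s3" "t2 \<noteq> s2" "t2 \<noteq> s3"
    using prism_ruleD(1,3,4)[OF R(1)] prism_ruleD(1,3,4)[OF R(2)] eq by simp_all
  have base: "distinct [t1, t2, t3, m2, m3]" "{t1, t2, t3, m2, m3} \<subseteq> {..<5}"
    using D(1-21) m md by auto
  have "s2 = m2" using five_colors[OF base, of s2] D t eq by auto
  moreover have "s3 = m3" using five_colors[OF base, of s3] D t eq by auto
  ultimately show False using prism_ruleD(2)[OF R(3)] by simp
qed

text \<open>Distinct colors \<open>m1, m2, m3\<close> that also avoid \<open>t1, t2, t3\<close> would make six colors.\<close>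

lemma no_prism_colors: "\<not> prism_colors t1 t2 t3 s1 s2 s3 m1 m2 m3"
proof
  assume 1: "prism_colors t1 t2 t3 s1 s2 s3 m1 m2 m3"
  note 2 = prism_colors_rotate[OF 1]
  note 3 = prism_colors_rotate[OF 2]
  note D = prism_colorsD[OF 1]
  have md: "m1 \<noteq> m2" "m2 \<noteq> m3" "m3 \<noteq> m1"
    by (rule prism_rungs_differ[OF 1] prism_rungs_differ[OF 2] prism_rungs_differ[OF 3])+
  have mt: "m1 \<noteq> t1" "m2 \<noteq> t2" "m3 \<noteq> t3"
    by (rule prism_rungs_not_matching[OF 1 md(2)] prism_rungs_not_matching[OF 2 md(3)]
        prism_rungs_not_matching[OF 3 md(1)])+
  have "distinct [m1, m2, t1, t2, t3]" "{m1, m2, t1, t2, t3} \<subseteq> {..<5}"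
    using D(1-21) md mt by auto
  then show False using five_colors[of m1 m2 t1 t2 t3 m3] D(1-21) md mt by auto
qed

lemma star_walk:
  assumes "star_at E f x" "{w, y} \<in> E" "{y, x} \<in> E" "{x, z} \<in> E" "{z, w'} \<in> E" "y \<noteq> z"
  shows "\<not> (f {w, y} = f {x, z} \<and> f {y, x} = f {z, w'})"
proof
  assume eq: "f {w, y} = f {x, z} \<and> f {y, x} = f {z, w'}"
  have "{w, y} \<in> inc E y" "{z, w'} \<in> inc E z" using assms(2,5) unfolding inc_def by simp_all
  then have "f {w, y} \<in> palette E f y" "f {z, w'} \<in> palette E f z" unfolding palette_def by blast+
  then have "f {x, z} \<in> palette E f y" "f {x, y} \<in> palette E f z"
    using eq by (simp_all add: insert_commute)
  moreover have "{x, y} \<in> E" using assms(3) by (simp add: insert_commute)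
  ultimately show False using assms(1,4,6) unfolding star_at_def by blast
qed

definition prism_edges :: "'a \<Rightarrow> 'a \<Rightarrow> 'a \<Rightarrow> 'a \<Rightarrow> 'a \<Rightarrow> 'a \<Rightarrow> 'a set set" where
  "prism_edges a1 a2 a3 b1 b2 b3 =
     {{a2, a3}, {a1, a3}, {a1, a2}, {b2, b3}, {b1, b3}, {b1, b2}, {a1, b1}, {a2, b2}, {a3, b3}}"

lemma prism_edges_commute:
  "prism_edges a2 a1 a3 b2 b1 b3 = prism_edges a1 a2 a3 b1 b2 b3"
  "prism_edges a1 a3 a2 b1 b3 b2 = prism_edges a1 a2 a3 b1 b2 b3"
  unfolding prism_edges_def by (auto simp: insert_commute)

lemma prism_rule_of_coloring:
  assumes d: "distinct [a1, a2, a3, b1, b2, b3]"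
    and col: "star_edge_coloring (prism_edges a1 a2 a3 b1 b2 b3) 5 f"
  shows "prism_rule (f {a2, a3}) (f {a1, a3}) (f {a1, a2}) (f {b2, b3}) (f {b1, b3}) (f {b1, b2})
    (f {a1, b1}) (f {a2, b2}) (f {a3, b3})"
proof -
  define E where "E = prism_edges a1 a2 a3 b1 b2 b3"
  have "card e = 2" if "e \<in> E" for e using that d unfolding E_def prism_edges_def by auto
  then have c: "f ` E \<subseteq> {..<5}" and inj: "\<And>x. inj_on f (inc E x)" and star: "\<And>x. star_at E f x"
    using star_edge_coloring_iff_star_at[of E 5 f] col unfolding E_def by blast+
  have M: "{a2, a3} \<in> E" "{a1, a3} \<in> E" "{a1, a2} \<in> E" "{b2, b3} \<in> E" "{b1, b3} \<in> E" "{b1, b2} \<in> E"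
    "{a1, b1} \<in> E" "{a2, b2} \<in> E" "{a3, b3} \<in> E"
    unfolding E_def prism_edges_def by simp_all
  have flip: "{a3, a2} = {a2, a3}" "{a3, a1} = {a1, a3}" "{a2, a1} = {a1, a2}"
    "{b3, b2} = {b2, b3}" "{b3, b1} = {b1, b3}" "{b2, b1} = {b1, b2}"
    "{b1, a1} = {a1, b1}" "{b2, a2} = {a2, b2}" "{b3, a3} = {a3, b3}"
    by (simp_all add: insert_commute)
  have ne: "f {x, y} \<noteq> f {x, z}" if "{x, y} \<in> E" "{x, z} \<in> E" "y \<noteq> z" for x y z
    using inj_onD[OF inj[of x], of "{x, y}" "{x, z}"] that unfolding inc_def by (auto simp: doubleton_eq_iff)
  have ds: "a2 \<noteq> a1" "b2 \<noteq> b1" "b1 \<noteq> a3" "a1 \<noteq> b3" "a2 \<noteq> b1" "b2 \<noteq> a1" using d by auto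
  have n: "f {a2, a3} \<noteq> f {a1, a3}" "f {b2, b3} \<noteq> f {b1, b3}"
    "f {a1, b1} \<noteq> f {a1, a3}" "f {a1, b1} \<noteq> f {b1, b3}"
    using ne[of a3 a2 a1] ne[of b3 b2 b1] ne[of a1 b1 a3] ne[of b1 a1 b3] M ds unfolding flip by simp_all
  have lt: "f {a2, a3} < 5" "f {b2, b3} < 5" "f {a1, b1} < 5"
    using c M by blast+
  have w: "\<not> (f {a1, b1} = f {a2, a3} \<and> f {a2, b2} = f {a1, a3})"
    "\<not> (f {a1, b1} = f {b2, b3} \<and> f {a2, b2} = f {b1, b3})"
    using star_walk[OF star[of a3], of b2 a2 a1 b1] star_walk[OF star[of b3], of a2 b2 b1 a1] M ds
    unfolding flip by auto
  have wa: "f {a1, b1} = f {a2, a3} \<or> f {a1, b1} = f {a2, b2} \<Longrightarrow>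
      f {a1, a2} \<noteq> f {b1, b3} \<and> f {a1, a2} \<noteq> f {b1, b2}"
    using star_walk[OF star[of a1], of a3 a2 b1 b3] star_walk[OF star[of a1], of a3 a2 b1 b2]
      star_walk[OF star[of a1], of b2 a2 b1 b3] star_walk[OF star[of a1], of b2 a2 b1 b2] M ds
    unfolding flip by auto
  have wb: "f {a1, b1} = f {b2, b3} \<or> f {a1, b1} = f {a2, b2} \<Longrightarrow>
      f {b1, b2} \<noteq> f {a1, a3} \<and> f {b1, b2} \<noteq> f {a1, a2}"
    using star_walk[OF star[of b1], of b3 b2 a1 a3] star_walk[OF star[of b1], of b3 b2 a1 a2]
      star_walk[OF star[of b1], of a2 b2 a1 a3] star_walk[OF star[of b1], of a2 b2 a1 a2] M ds
    unfolding flip by auto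
  show ?thesis unfolding prism_rule_def using n lt w wa wb by blast
qed

lemma prism_no_star_5_edge_coloring:
  assumes d: "distinct [a1, a2, a3, b1, b2, b3]"
  shows "\<not> star_edge_coloring (prism_edges a1 a2 a3 b1 b2 b3) 5 f"
proof
  assume c1: "star_edge_coloring (prism_edges a1 a2 a3 b1 b2 b3) 5 f"
  then have c2: "star_edge_coloring (prism_edges a1 a3 a2 b1 b3 b2) 5 f"
    and c3: "star_edge_coloring (prism_edges a2 a1 a3 b2 b1 b3) 5 f"
    by (simp_all only: prism_edges_commute)
  then have c4: "star_edge_coloring (prism_edges a2 a3 a1 b2 b3 b1) 5 f"
    and c5: "star_edge_coloring (prism_edges a3 a1 a2 b3 b1 b2) 5 f"
    by (simp_all only: prism_edges_commute)
  then have c6: "star_edge_coloring (prism_edges a3 a2 a1 b3 b2 b1) 5 f"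
    by (simp only: prism_edges_commute)
  have "prism_colors (f {a2, a3}) (f {a1, a3}) (f {a1, a2}) (f {b2, b3}) (f {b1, b3}) (f {b1, b2})
    (f {a1, b1}) (f {a2, b2}) (f {a3, b3})"
    unfolding prism_colors_def
    using prism_rule_of_coloring[OF _ c1] prism_rule_of_coloring[OF _ c2] prism_rule_of_coloring[OF _ c3]
      prism_rule_of_coloring[OF _ c4] prism_rule_of_coloring[OF _ c5] prism_rule_of_coloring[OF _ c6] d
    by (auto simp: insert_commute)
  then show False using no_prism_colors by blast
qed

section \<open>A plane drawing of the prism\<close>

text \<open>The orientation of the edge is chosen arbitrarily; only the segment matters.\<close>

definition straight :: "complex set \<Rightarrow> real \<Rightarrow> complex" where
  "straight e = (SOME g. \<exists>x y. e = {x, y} \<and> g = linepath x y)"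

lemma straight_edge:
  assumes "card e = 2"
  shows "arc (straight e)" "{pathstart (straight e), pathfinish (straight e)} = e"
    "path_image (straight e) = convex hull e"
proof -
  have "\<exists>g x y. e = {x, y} \<and> g = linepath x y" using assms by (auto simp: card_2_iff)
  then have "\<exists>x y. e = {x, y} \<and> straight e = linepath x y"
    unfolding straight_def by (rule someI_ex)
  then obtain x y where xy: "e = {x, y}" "straight e = linepath x y" by blast
  then have "x \<noteq> y" using assms by auto
  then show "arc (straight e)" "{pathstart (straight e), pathfinish (straight e)} = e"
    "path_image (straight e) = convex hull e"
    using xy by (simp_all add: segment_convex_hull)
qed

lemma plane_graph_straight:
  assumes "simple_graph V E" and "\<And>e. e \<in> E \<Longrightarrow> convex hull e \<inter> V \<subseteq> e"
    and "\<And>e e'. e \<in> E \<Longrightarrow> e' \<in> E \<Longrightarrow> e \<noteq> e' \<Longrightarrow> convex hull e \<inter> convex hull e' \<subseteq> e \<inter> e'"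
  shows "plane_graph V E straight"
  unfolding plane_graph_def
proof (intro conjI ballI impI)
  show "simple_graph V E" by fact
  have c: "card e = 2" if "e \<in> E" for e using assms(1) that unfolding simple_graph_def by blast
  fix e assume e: "e \<in> E"
  show "arc (straight e)" "{pathstart (straight e), pathfinish (straight e)} = e"
    using straight_edge[OF c[OF e]] by simp_all
  show "(path_image (straight e) - e) \<inter> V = {}"
    using assms(2)[OF e] straight_edge(3)[OF c[OF e]] by auto
  fix e' assume e': "e' \<in> E" "e' \<noteq> e"
  show "(path_image (straight e) - e) \<inter> path_image (straight e') = {}"
    using assms(3)[OF e e'(1) e'(2)[symmetric]]
    unfolding straight_edge(3)[OF c[OF e]] straight_edge(3)[OF c[OF e'(1)]] by blast
qed

text \<open>A drawing between a convex compact set and its frontier has the complement of that set as its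
  exterior face.\<close>

lemma frontier_outside_of_convex:
  fixes K :: "'a::euclidean_space set"
  assumes "convex K" "compact K" and D: "frontier K \<subseteq> D" "D \<subseteq> K"
  shows "frontier (outside D) = frontier K"
proof -
  have cl: "closed K" and bd: "bounded K" using assms(2) compact_imp_closed compact_imp_bounded by blast+
  have "outside D = - K"
  proof
    have "outside D \<subseteq> outside (frontier K)" using D(1) by (rule outside_mono)
    also have "\<dots> = - (frontier K \<union> interior K)"
      unfolding outside_inside inside_frontier_eq_interior[OF bd assms(1)] ..
    also have "\<dots> = - K"
      using cl interior_subset[of K] by (auto simp: frontier_def)
    finally show "outside D \<subseteq> - K" .
    show "- K \<subseteq> outside D" using outside_mono[OF D(2)] outside_convex[OF assms(1)] by simp
  qed
  then show ?thesis by (simp add: frontier_complement)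
qed

lemma convex_hull_edge:
  fixes p q :: complex
  assumes "Re p < Re q"
  shows "convex hull {p, q} = {z. Re p \<le> Re z \<and> Re z \<le> Re q \<and>
    (Im z - Im p) * (Re q - Re p) = (Im q - Im p) * (Re z - Re p)}"
  unfolding segment_convex_hull[symmetric]
proof (intro equalityI subsetI)
  fix z assume "z \<in> closed_segment p q"
  then obtain t where t: "0 \<le> t" "t \<le> 1" "z = (1 - t) *\<^sub>R p + t *\<^sub>R q" unfolding in_segment by blast
  have z: "Re z = Re p + t * (Re q - Re p)" "Im z = Im p + t * (Im q - Im p)"
    unfolding t(3) by (simp_all add: algebra_simps)
  have "0 \<le> t * (Re q - Re p)" "t * (Re q - Re p) \<le> 1 * (Re q - Re p)"
    using t assms by (auto intro: mult_right_mono)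
  then show "z \<in> {z. Re p \<le> Re z \<and> Re z \<le> Re q \<and>
      (Im z - Im p) * (Re q - Re p) = (Im q - Im p) * (Re z - Re p)}"
    unfolding z by (simp add: z)
next
  fix z assume "z \<in> {z. Re p \<le> Re z \<and> Re z \<le> Re q \<and>
      (Im z - Im p) * (Re q - Re p) = (Im q - Im p) * (Re z - Re p)}"
  then have z: "Re p \<le> Re z" "Re z \<le> Re q" "(Im z - Im p) * (Re q - Re p) = (Im q - Im p) * (Re z - Re p)"
    by auto
  define t where "t = (Re z - Re p) / (Re q - Re p)"
  have d: "Re q - Re p > 0" using assms by simp
  have t: "0 \<le> t" "t \<le> 1" unfolding t_def using z d by simp_all
  have "t * (Re q - Re p) = Re z - Re p" unfolding t_def using d by simp
  moreover have "t * (Im q - Im p) = Im z - Im p"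
    unfolding t_def using z(3) d by (simp add: field_simps)
  ultimately have "z = (1 - t) *\<^sub>R p + t *\<^sub>R q"
    by (simp add: complex_eq_iff algebra_simps)
  then show "z \<in> closed_segment p q" unfolding in_segment using t by blast
qed

definition "A1 = Complex (-1) 0"
definition "A2 = Complex (-2) 1"
definition "A3 = Complex (-2) (-1)"
definition "B1 = Complex 1 0"
definition "B2 = Complex 2 1"
definition "B3 = Complex 2 (-1)"

lemmas prism_vertex_defs = A1_def A2_def A3_def B1_def B2_def B3_def

definition "prism_V = {A1, A2, A3, B1, B2, B3}"
definition "prism_T = {{A1, A2}, {A1, A3}, {A1, B1}, {B1, B2}, {B1, B3}}"
definition "prism_C = {{A2, A3}, {A3, B3}, {B3, B2}, {B2, A2}}"

lemma prism_distinct: "distinct [A1, A2, A3, B1, B2, B3]"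
  unfolding prism_vertex_defs by simp

lemma prism_edges_eq: "prism_T \<union> prism_C = prism_edges A1 A2 A3 B1 B2 B3"
  unfolding prism_T_def prism_C_def prism_edges_def by (auto simp: insert_commute)

lemma prism_hulls:
  "convex hull {A2, A3} = {z. Re z = -2 \<and> -1 \<le> Im z \<and> Im z \<le> 1}"
  "convex hull {B3, B2} = {z. Re z = 2 \<and> -1 \<le> Im z \<and> Im z \<le> 1}"
  "convex hull {A3, B3} = {z. Im z = -1 \<and> -2 \<le> Re z \<and> Re z \<le> 2}"
  "convex hull {B2, A2} = {z. Im z = 1 \<and> -2 \<le> Re z \<and> Re z \<le> 2}"
  "convex hull {A1, B1} = {z. Im z = 0 \<and> -1 \<le> Re z \<and> Re z \<le> 1}"
  "convex hull {A1, A2} = {z. Im z = - Re z - 1 \<and> -2 \<le> Re z \<and> Re z \<le> -1}"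
  "convex hull {A1, A3} = {z. Im z = Re z + 1 \<and> -2 \<le> Re z \<and> Re z \<le> -1}"
  "convex hull {B1, B2} = {z. Im z = Re z - 1 \<and> 1 \<le> Re z \<and> Re z \<le> 2}"
  "convex hull {B1, B3} = {z. Im z = 1 - Re z \<and> 1 \<le> Re z \<and> Re z \<le> 2}"
proof -
  show "convex hull {A2, A3} = {z. Re z = -2 \<and> -1 \<le> Im z \<and> Im z \<le> 1}"
    "convex hull {B3, B2} = {z. Re z = 2 \<and> -1 \<le> Im z \<and> Im z \<le> 1}"
    unfolding segment_convex_hull[symmetric]
    by (auto simp: closed_segment_same_Re closed_segment_eq_real_ivl prism_vertex_defs)
  show "convex hull {A3, B3} = {z. Im z = -1 \<and> -2 \<le> Re z \<and> Re z \<le> 2}"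
    by (subst convex_hull_edge) (auto simp: prism_vertex_defs)
  show "convex hull {B2, A2} = {z. Im z = 1 \<and> -2 \<le> Re z \<and> Re z \<le> 2}"
    by (subst insert_commute, subst convex_hull_edge) (auto simp: prism_vertex_defs)
  show "convex hull {A1, B1} = {z. Im z = 0 \<and> -1 \<le> Re z \<and> Re z \<le> 1}"
    by (subst convex_hull_edge) (auto simp: prism_vertex_defs)
  show "convex hull {A1, A2} = {z. Im z = - Re z - 1 \<and> -2 \<le> Re z \<and> Re z \<le> -1}"
    by (subst insert_commute, subst convex_hull_edge) (auto simp: prism_vertex_defs)
  show "convex hull {A1, A3} = {z. Im z = Re z + 1 \<and> -2 \<le> Re z \<and> Re z \<le> -1}"
    by (subst insert_commute, subst convex_hull_edge) (auto simp: prism_vertex_defs)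
  show "convex hull {B1, B2} = {z. Im z = Re z - 1 \<and> 1 \<le> Re z \<and> Re z \<le> 2}"
    by (subst convex_hull_edge) (auto simp: prism_vertex_defs)
  show "convex hull {B1, B3} = {z. Im z = 1 - Re z \<and> 1 \<le> Re z \<and> Re z \<le> 2}"
    by (subst convex_hull_edge) (auto simp: prism_vertex_defs)
qed

lemma prism_simple_graph: "simple_graph prism_V (prism_T \<union> prism_C)"
  using prism_distinct unfolding simple_graph_def prism_V_def prism_T_def prism_C_def by auto

lemma prism_plane: "plane_graph prism_V (prism_T \<union> prism_C) straight"
proof (rule plane_graph_straight[OF prism_simple_graph])
  fix e assume "e \<in> prism_T \<union> prism_C"
  then show "convex hull e \<inter> prism_V \<subseteq> e"
    unfolding prism_T_def prism_C_def prism_V_def Un_iff insert_iff empty_iff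
    by (elim disjE) (simp_all add: prism_hulls; simp add: prism_vertex_defs)+
next
  fix e e' assume "e \<in> prism_T \<union> prism_C" "e' \<in> prism_T \<union> prism_C" and ne: "e \<noteq> e'"
  from this(1,2) have "e = e' \<or> convex hull e \<inter> convex hull e' \<subseteq> e \<inter> e'"
    unfolding prism_T_def prism_C_def Un_iff insert_iff empty_iff
    by (elim disjE FalseE) (hypsubst,
        ((rule disjI1, rule refl) |
         (rule disjI2, simp only: prism_hulls, (auto simp: prism_vertex_defs complex_eq_iff)[1])))+
  then show "convex hull e \<inter> convex hull e' \<subseteq> e \<inter> e'" using ne by blast
qed

lemma prism_frontier:
  "frontier (exterior_face prism_V (prism_T \<union> prism_C) straight) = drawing {A2, A3, B3, B2} prism_C straight"
proof -
  let ?K = "cbox (Complex (-2) (-1)) (Complex 2 1)"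
  have E: "card e = 2" "e \<subseteq> prism_V" if "e \<in> prism_T \<union> prism_C" for e
    using prism_simple_graph that unfolding simple_graph_def by blast+
  have J: "drawing {A2, A3, B3, B2} prism_C straight = frontier ?K"
  proof -
    have "path_image (straight e) = convex hull e" if "e \<in> prism_C" for e
      using straight_edge(3) E that by blast
    then have "drawing {A2, A3, B3, B2} prism_C straight = {A2, A3, B3, B2} \<union> (\<Union>e\<in>prism_C. convex hull e)"
      unfolding drawing_def by simp
    also have "\<dots> = frontier ?K"
    proof -
      have hulls: "(\<Union>e\<in>prism_C. convex hull e) = convex hull {A2, A3} \<union> convex hull {A3, B3} \<union>
          convex hull {B3, B2} \<union> convex hull {B2, A2}"
        unfolding prism_C_def by auto
      show ?thesis
        unfolding hulls prism_hulls frontier_def closure_cbox interior_cbox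
        by (auto simp: in_cbox_complex_iff in_box_complex_iff prism_vertex_defs)
    qed
    finally show ?thesis .
  qed
  have VK: "prism_V \<subseteq> ?K"
    unfolding prism_V_def by (auto simp: prism_vertex_defs in_cbox_complex_iff)
  have "convex hull e \<subseteq> ?K" if "e \<in> prism_T \<union> prism_C" for e
    using E[OF that] VK by (intro hull_minimal) auto
  then have DK: "drawing prism_V (prism_T \<union> prism_C) straight \<subseteq> ?K"
    unfolding drawing_def using VK E straight_edge(3) by auto
  have JD: "drawing {A2, A3, B3, B2} prism_C straight \<subseteq> drawing prism_V (prism_T \<union> prism_C) straight"
    unfolding drawing_def prism_V_def by auto
  show ?thesis
    unfolding exterior_face_def J by (rule frontier_outside_of_convex) (use JD DK J in auto)
qed

lemma prism_degrees:
  "v \<in> prism_V \<Longrightarrow> vdegree (prism_T \<union> prism_C) v = 3"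
  "vdegree prism_T A1 = 3" "vdegree prism_T B1 = 3"
  "vdegree prism_T A2 = 1" "vdegree prism_T A3 = 1" "vdegree prism_T B2 = 1" "vdegree prism_T B3 = 1"
proof -
  have filter_insert: "{e \<in> insert a S. Q e} = (if Q a then insert a {e \<in> S. Q e} else {e \<in> S. Q e})"
    for a :: "complex set" and S Q by auto
  show "vdegree prism_T A1 = 3" "vdegree prism_T B1 = 3"
    "vdegree prism_T A2 = 1" "vdegree prism_T A3 = 1" "vdegree prism_T B2 = 1" "vdegree prism_T B3 = 1"
    unfolding vdegree_def prism_T_def filter_insert by (simp_all add: prism_vertex_defs doubleton_eq_iff)
  show "vdegree (prism_T \<union> prism_C) v = 3" if "v \<in> prism_V"
    using that unfolding vdegree_def prism_T_def prism_C_def prism_V_def Un_insert_left Un_empty_left filter_insert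
    by (elim insertE emptyE; hypsubst) (simp_all add: prism_vertex_defs doubleton_eq_iff)
qed

lemma prism_leaves: "leaves prism_V prism_T = {A2, A3, B3, B2}"
  unfolding leaves_def prism_V_def using prism_degrees(2-) by auto

text \<open>Rotating the cycle makes the given vertex its first one; the edges to the second and from the last vertex are different.\<close>

lemma cycle_two_edges:
  assumes "graph_cycle T vs" "z \<in> set vs"
  shows "\<exists>e\<in>T. \<exists>e'\<in>T. e \<noteq> e' \<and> z \<in> e \<and> z \<in> e'"
proof -
  obtain as bs where s: "vs = as @ z # bs" using assms(2) by (meson split_list)
  define ws where "ws = bs @ as"
  have len: "2 \<le> length ws" and dist: "distinct (z # ws)"
    using assms(1) unfolding graph_cycle_def ws_def s by auto
  have "path_edges (z # ws @ [z]) = cycle_edges vs"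
  proof (cases as)
    case Nil
    then show ?thesis unfolding cycle_edges_def ws_def s by simp
  next
    case (Cons h as')
    then show ?thesis
      using path_edges_append[of "h # as'" z "bs @ [h]"] path_edges_append[of "z # bs" h "as' @ [z]"]
      unfolding cycle_edges_def ws_def s by auto
  qed
  then have T: "path_edges (z # ws @ [z]) \<subseteq> T" using assms(1) unfolding graph_cycle_def by simp
  obtain y r where y: "ws = y # r" "r \<noteq> []" using len by (cases ws; cases "tl ws") auto
  obtain r' l where l: "r = r' @ [l]" using y(2) by (metis append_butlast_last_id)
  have "path_edges (z # ws @ [z]) = path_edges ((z # y # r') @ [l]) \<union> path_edges [l, z]"
    using path_edges_append[of "z # y # r'" l "[z]"] unfolding y l by simp
  then have e: "{z, y} \<in> T" "{l, z} \<in> T" using T by auto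
  have "{z, y} \<noteq> {l, z}" using dist unfolding y l by (auto simp: doubleton_eq_iff)
  then show ?thesis
    using e by (intro bexI[of _ "{z, y}"] bexI[of _ "{l, z}"] conjI) simp_all
qed

lemma prism_tree: "tree_graph prism_V prism_T"
  unfolding tree_graph_def
proof (intro conjI notI)
  show "simple_graph prism_V prism_T" using prism_simple_graph unfolding simple_graph_def by blast
  have E: "{A1, A2} \<in> prism_T" "{A1, A3} \<in> prism_T" "{A1, B1} \<in> prism_T" "{B1, B2} \<in> prism_T" "{B1, B3} \<in> prism_T"
    unfolding prism_T_def by simp_all
  have V: "A1 \<in> prism_V" "A2 \<in> prism_V" "A3 \<in> prism_V" "B1 \<in> prism_V" "B2 \<in> prism_V" "B3 \<in> prism_V"
    unfolding prism_V_def by simp_all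
  have A: "joined prism_T prism_V A1 x" if "x \<in> prism_V" for x
  proof -
    have B: "joined prism_T prism_V A1 B1" using joined_edge[OF E(3)] V by blast
    have "joined prism_T prism_V A1 A2" "joined prism_T prism_V A1 A3"
      using joined_edge[OF E(1)] joined_edge[OF E(2)] V by blast+
    moreover have "joined prism_T prism_V A1 B2" "joined prism_T prism_V A1 B3"
      using joined_trans[OF B joined_edge[OF E(4)]] joined_trans[OF B joined_edge[OF E(5)]] V by blast+
    ultimately show ?thesis using that B unfolding prism_V_def by auto
  qed
  show "graph_connected prism_V prism_T"
    unfolding graph_connected_def
  proof (intro conjI ballI)
    show "prism_V \<noteq> {}" using V by blast
    fix x y assume "x \<in> prism_V" "y \<in> prism_V"
    then show "\<exists>vs. graph_path prism_T vs \<and> hd vs = x \<and> last vs = y"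
      using joined_path[OF joined_same[OF A A]] by blast
  qed
  assume "\<exists>vs. graph_cycle prism_T vs"
  then obtain vs where vs: "graph_cycle prism_T vs" by blast
  have "set vs \<subseteq> {A1, B1}"
  proof
    fix z assume "z \<in> set vs"
    then obtain e e' where "e \<in> prism_T" "e' \<in> prism_T" "e \<noteq> e'" "z \<in> e" "z \<in> e'"
      using cycle_two_edges[OF vs] by blast
    then show "z \<in> {A1, B1}" using prism_distinct unfolding prism_T_def by auto
  qed
  then have "card (set vs) \<le> card {A1, B1}" by (rule card_mono[rotated]) simp
  also have "\<dots> \<le> 2" by (simp add: card_insert_if)
  finally show False using vs distinct_card[of vs] unfolding graph_cycle_def by simp
qed

lemma prism_halin: "halin_graph prism_V prism_T prism_C straight"
  unfolding halin_graph_def prism_leaves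
proof (intro conjI ballI)
  show "3 \<le> vdegree prism_T v" if "v \<in> prism_V - {A2, A3, B3, B2}" for v
    using that prism_degrees(2,3) unfolding prism_V_def by auto
  have "graph_cycle prism_C [A2, A3, B3, B2] \<and> cycle_edges [A2, A3, B3, B2] = prism_C \<and>
      set [A2, A3, B3, B2] = {A2, A3, B3, B2}"
    using prism_distinct unfolding graph_cycle_def cycle_edges_def prism_C_def by auto
  then show "\<exists>cs. graph_cycle prism_C cs \<and> cycle_edges cs = prism_C \<and> set cs = {A2, A3, B3, B2}"
    by blast
qed (fact prism_plane prism_tree prism_frontier)+

lemma star_edge_coloring_mono: "star_edge_coloring E k f \<Longrightarrow> k \<le> k' \<Longrightarrow> star_edge_coloring E k' f"
  unfolding star_edge_coloring_def by (meson lessThan_subset_iff subset_trans)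

lemma prism_cubic: "regular_graph 3 prism_V (prism_T \<union> prism_C)"
  unfolding regular_graph_def using prism_degrees(1) by blast

lemma prism_index: "star_chromatic_index (prism_T \<union> prism_C) = 6"
proof (rule antisym)
  show "star_chromatic_index (prism_T \<union> prism_C) \<le> 6"
    by (rule halin_bounds(2)[OF prism_halin prism_cubic])
  obtain f where "star_edge_coloring (prism_T \<union> prism_C) 6 f"
    using halin_star_6_edge_coloring[OF prism_halin prism_cubic] by blast
  then obtain g where "star_edge_coloring (prism_T \<union> prism_C) (star_chromatic_index (prism_T \<union> prism_C)) g"
    unfolding star_chromatic_index_def using LeastI[of "\<lambda>k. \<exists>f. star_edge_coloring (prism_T \<union> prism_C) k f" 6]
    by blast
  then show "6 \<le> star_chromatic_index (prism_T \<union> prism_C)"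
    using star_edge_coloring_mono[of "prism_T \<union> prism_C" "star_chromatic_index (prism_T \<union> prism_C)" g 5]
      prism_no_star_5_edge_coloring[OF prism_distinct] unfolding prism_edges_eq by fastforce
qed

section \<open>The star chromatic index of cubic Halin graphs\<close>

theorem theorem2p1:
  shows "(\<forall>V T C \<gamma>. halin_graph V T C \<gamma> \<and> regular_graph 3 V (T \<union> C) \<longrightarrow>
            4 \<le> star_chromatic_index (T \<union> C) \<and> star_chromatic_index (T \<union> C) \<le> 6) \<and>
         (\<exists>V T C \<gamma>. halin_graph V T C \<gamma> \<and> regular_graph 3 V (T \<union> C) \<and>
            star_chromatic_index (T \<union> C) = 6)"
proof (intro conjI allI impI)
  fix V T C \<gamma>
  assume "halin_graph V T C \<gamma> \<and> regular_graph 3 V (T \<union> C)"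
  then show "4 \<le> star_chromatic_index (T \<union> C)" "star_chromatic_index (T \<union> C) \<le> 6"
    using halin_bounds by blast+
next
  show "\<exists>V T C \<gamma>. halin_graph V T C \<gamma> \<and> regular_graph 3 V (T \<union> C) \<and>
      star_chromatic_index (T \<union> C) = 6"
    using prism_halin prism_cubic prism_index by blast
qed

end
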